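(* Let $\mathcal{A}=(\mathcal{H},Act,\{\mathcal{E}_\alpha\}_{\alpha\in Act},\sigma_0)$ be a quantum automaton with rational data, and let $\phi=\bigvee_{i=1}^t p_i$ with each $p_i$ a subspace (projection) of $\mathcal{H}$. Then it is decidable whether $\square\lozenge\phi$ is valid, i.e. whether for every infinite word $\alpha_1\alpha_2\cdots\in Act^\omega$ the induced sequence satisfies $\sigma_i\models\phi$ for infinitely many $i$.
   Context: A quantum automaton consists of a $d$-dimensional Hilbert space $\mathcal{H}$, a finite set $Act$ of actions, a trace-preserving super-operator $\mathcal{E}_\alpha$ on $\mathcal{H}$ for each $\alpha\in Act$, and an initial state $\sigma_0$; all entries are rational. Each word $\alpha_1\alpha_2\cdots\in Act^\omega$ induces the admissible sequence $\sigma_0\sigma_1\cdots$ with $\sigma_i=\mathcal{E}_{\alpha_i}(\sigma_{i-1})$. For a state $\sigma$ and subspace $p$, $\sigma\models p$ iff $\mathrm{supp}(\sigma)\subseteq p$; for a finite union $\phi=\bigvee_i p_i$ of subspaces, $\sigma\models\phi$ iff $\sigma\models p_i$ for some $i$. *)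

theory Defs
  imports
    "Jordan_Normal_Form.Schur_Decomposition"
    "HOL-Library.Nat_Bijection"
begin

section \<open>Computability: partial recursive functions\<close>

datatype recf =
    Zero
  | Succ
  | Proj nat
  | Comp recf "recf list"
  | PrimRec recf recf
  | Mu recf

text \<open>\<open>rec_eval f xs y\<close>: the program \<open>f\<close> halts on the arguments \<open>xs\<close> with output \<open>y\<close>.
  The recursion argument of \<open>PrimRec\<close> and the search argument of \<open>Mu\<close> come first.\<close>

inductive rec_eval :: "recf \<Rightarrow> nat list \<Rightarrow> nat \<Rightarrow> bool" where
  zero: "rec_eval Zero xs 0"
| succ: "rec_eval Succ (x # xs) (Suc x)"
| proj: "i < length xs \<Longrightarrow> rec_eval (Proj i) xs (xs ! i)"
| comp: "list_all2 (\<lambda>g y. rec_eval g xs y) gs ys \<Longrightarrow> rec_eval f ys z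
    \<Longrightarrow> rec_eval (Comp f gs) xs z"
| prim_0: "rec_eval f xs y \<Longrightarrow> rec_eval (PrimRec f g) (0 # xs) y"
| prim_Suc: "rec_eval (PrimRec f g) (n # xs) y \<Longrightarrow> rec_eval g (n # y # xs) z
    \<Longrightarrow> rec_eval (PrimRec f g) (Suc n # xs) z"
| mu: "rec_eval f (n # xs) 0 \<Longrightarrow> (\<forall>m<n. \<exists>y. rec_eval f (m # xs) (Suc y))
    \<Longrightarrow> rec_eval (Mu f) xs n"

inductive_cases rec_eval_elims:
  "rec_eval Zero xs y" "rec_eval Succ xs y" "rec_eval (Proj i) xs y"
  "rec_eval (Comp f gs) xs y" "rec_eval (PrimRec f g) (0 # xs) y"
  "rec_eval (PrimRec f g) (Suc n # xs) y" "rec_eval (Mu f) xs y"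

lemma rec_eval_deterministic: "rec_eval f xs y \<Longrightarrow> rec_eval f xs z \<Longrightarrow> y = z"
proof (induction arbitrary: z rule: rec_eval.induct)
  case (comp xs gs ys f w)
  from comp.prems obtain ys' where
    ys': "list_all2 (\<lambda>g y. rec_eval g xs y) gs ys'" and f: "rec_eval f ys' z"
    by (elim rec_eval_elims)
  have "ys = ys'"
    using comp.IH(1) ys' by (intro nth_equalityI) (auto simp: list_all2_conv_all_nth)
  with comp.IH(2) f show ?case by blast
next
  case (mu f n xs)
  from mu.prems have z: "rec_eval f (z # xs) 0" "\<forall>m<z. \<exists>y. rec_eval f (m # xs) (Suc y)"
    by (auto elim: rec_eval_elims)
  show ?case
  proof (rule linorder_cases[of n z])
    assume "n < z"
    with z(2) obtain y where "rec_eval f (n # xs) (Suc y)" by blast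
    with mu.IH(1) show ?thesis by blast
  next
    assume "z < n"
    with mu.IH(2) z(1) show ?thesis by blast
  qed
next
  case (prim_0 f xs y g)
  from prim_0.prems have "rec_eval f xs z" by (auto elim: rec_eval_elims)
  with prim_0.IH show ?case by blast
next
  case (prim_Suc f g n xs y w)
  from prim_Suc.prems obtain y' where
    "rec_eval (PrimRec f g) (n # xs) y'" "rec_eval g (n # y' # xs) z"
    by (auto elim: rec_eval_elims)
  with prim_Suc.IH show ?case by blast
qed (auto elim: rec_eval_elims)

text \<open>A decision problem consists of a set of instances, an encoding of them as numbers, and a
  property.  It is decidable if one program halts on every instance and outputs 1 or 0 according
  to whether the instance has the property.\<close>

definition decidable :: "'i set \<Rightarrow> ('i \<Rightarrow> nat) \<Rightarrow> ('i \<Rightarrow> bool) \<Rightarrow> bool" where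
  "decidable I enc P \<longleftrightarrow>
     (\<exists>f. \<forall>x\<in>I. rec_eval f [enc x] (if P x then 1 else 0))"


section \<open>States, super-operators and subspaces\<close>

definition mat_trace :: "complex mat \<Rightarrow> complex" where
  "mat_trace A = (\<Sum>i<dim_row A. A $$ (i, i))"

text \<open>Over the complex numbers the condition below implies that \<open>A\<close> is Hermitian; note that
  \<open>0 \<le> z\<close> for complex \<open>z\<close> means that \<open>z\<close> is real and nonnegative.\<close>

definition positive_mat :: "nat \<Rightarrow> complex mat \<Rightarrow> bool" where
  "positive_mat d A \<longleftrightarrow>
     A \<in> carrier_mat d d \<and> (\<forall>v\<in>carrier_vec d. 0 \<le> (A *\<^sub>v v) \<bullet>c v)"

definition density_mat :: "nat \<Rightarrow> complex mat \<Rightarrow> bool" where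
  "density_mat d A \<longleftrightarrow> positive_mat d A \<and> mat_trace A = 1"

definition linear_superop :: "nat \<Rightarrow> (complex mat \<Rightarrow> complex mat) \<Rightarrow> bool" where
  "linear_superop d E \<longleftrightarrow>
     (\<forall>A\<in>carrier_mat d d. E A \<in> carrier_mat d d) \<and>
     (\<forall>A\<in>carrier_mat d d. \<forall>B\<in>carrier_mat d d. E (A + B) = E A + E B) \<and>
     (\<forall>c. \<forall>A\<in>carrier_mat d d. E (c \<cdot>\<^sub>m A) = c \<cdot>\<^sub>m E A)"

definition mat_block :: "nat \<Rightarrow> complex mat \<Rightarrow> nat \<Rightarrow> nat \<Rightarrow> complex mat" where
  "mat_block d X r s = mat d d (\<lambda>(i, j). X $$ (r * d + i, s * d + j))"

text \<open>The map \<open>id \<otimes> E\<close> on matrices of size \<open>k * d\<close>, seen as \<open>k \<times> k\<close> block matrices with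
  blocks of size \<open>d\<close>: it applies \<open>E\<close> to every block.\<close>

definition ampliation ::
  "nat \<Rightarrow> nat \<Rightarrow> (complex mat \<Rightarrow> complex mat) \<Rightarrow> complex mat \<Rightarrow> complex mat" where
  "ampliation k d E X =
     mat (k * d) (k * d) (\<lambda>(i, j). E (mat_block d X (i div d) (j div d)) $$ (i mod d, j mod d))"

definition completely_positive :: "nat \<Rightarrow> (complex mat \<Rightarrow> complex mat) \<Rightarrow> bool" where
  "completely_positive d E \<longleftrightarrow>
     (\<forall>k X. positive_mat (k * d) X \<longrightarrow> positive_mat (k * d) (ampliation k d E X))"

definition trace_preserving :: "nat \<Rightarrow> (complex mat \<Rightarrow> complex mat) \<Rightarrow> bool" where
  "trace_preserving d E \<longleftrightarrow> (\<forall>A\<in>carrier_mat d d. mat_trace (E A) = mat_trace A)"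

definition tp_superoperator :: "nat \<Rightarrow> (complex mat \<Rightarrow> complex mat) \<Rightarrow> bool" where
  "tp_superoperator d E \<longleftrightarrow>
     linear_superop d E \<and> completely_positive d E \<and> trace_preserving d E"

definition supp :: "nat \<Rightarrow> complex mat \<Rightarrow> complex vec set" where
  "supp d A = LinearCombinations.module.span class_ring (module_vec TYPE(complex) d)
     {v. \<exists>k. k \<noteq> 0 \<and> eigenvector A v k}"

definition projection :: "nat \<Rightarrow> complex mat \<Rightarrow> bool" where
  "projection d P \<longleftrightarrow> P \<in> carrier_mat d d \<and> P * P = P \<and> mat_adjoint P = P"

definition proj_subspace :: "nat \<Rightarrow> complex mat \<Rightarrow> complex vec set" where
  "proj_subspace d P = (*\<^sub>v) P ` carrier_vec d"

text \<open>A finite union of subspaces is given by the list of the orthogonal projections onto them.\<close>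

definition satisfies :: "nat \<Rightarrow> complex mat \<Rightarrow> complex mat list \<Rightarrow> bool" where
  "satisfies d A \<phi> \<longleftrightarrow> (\<exists>P\<in>set \<phi>. supp d A \<subseteq> proj_subspace d P)"


section \<open>Quantum automata\<close>

record quantum_automaton =
  qdim :: nat
  Act :: "nat set"
  superop :: "nat \<Rightarrow> complex mat \<Rightarrow> complex mat"
  init :: "complex mat"

definition wf_automaton :: "quantum_automaton \<Rightarrow> bool" where
  "wf_automaton A \<longleftrightarrow>
     finite (Act A) \<and>
     (\<forall>\<alpha>\<in>Act A. tp_superoperator (qdim A) (superop A \<alpha>)) \<and>
     density_mat (qdim A) (init A)"

text \<open>\<open>w i\<close> is the letter read in step \<open>i + 1\<close>.\<close>

primrec induced_state :: "quantum_automaton \<Rightarrow> (nat \<Rightarrow> nat) \<Rightarrow> nat \<Rightarrow> complex mat" where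
  "induced_state A w 0 = init A"
| "induced_state A w (Suc i) = superop A (w i) (induced_state A w i)"

definition box_diamond_valid :: "quantum_automaton \<Rightarrow> complex mat list \<Rightarrow> bool" where
  "box_diamond_valid A \<phi> \<longleftrightarrow>
     (\<forall>w. (\<forall>i. w i \<in> Act A) \<longrightarrow>
          infinite {i. satisfies (qdim A) (induced_state A w i) \<phi>})"


section \<open>Rational data and their encoding\<close>

text \<open>Rational means rational real and imaginary part.  The entries of a super-operator are those
  of its matrix with respect to the basis of matrix units.\<close>

definition rational_mat :: "complex mat \<Rightarrow> bool" where
  "rational_mat M \<longleftrightarrow>
     (\<forall>i<dim_row M. \<forall>j<dim_col M. Re (M $$ (i, j)) \<in> \<rat> \<and> Im (M $$ (i, j)) \<in> \<rat>)"

definition matrix_unit :: "nat \<Rightarrow> nat \<Rightarrow> nat \<Rightarrow> complex mat" where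
  "matrix_unit d i j = mat d d (\<lambda>(a, b). if a = i \<and> b = j then 1 else 0)"

definition rational_superop :: "nat \<Rightarrow> (complex mat \<Rightarrow> complex mat) \<Rightarrow> bool" where
  "rational_superop d E \<longleftrightarrow> (\<forall>i<d. \<forall>j<d. rational_mat (E (matrix_unit d i j)))"

definition rational_automaton :: "quantum_automaton \<Rightarrow> bool" where
  "rational_automaton A \<longleftrightarrow>
     (\<forall>\<alpha>\<in>Act A. rational_superop (qdim A) (superop A \<alpha>)) \<and> rational_mat (init A)"

text \<open>Rationals are encoded by numerator and denominator in lowest terms; the result is meaningful
  only for real arguments that are rational.\<close>

definition encode_rational :: "real \<Rightarrow> nat" where
  "encode_rational x =
     (let (p, q) = quotient_of (THE r. of_rat r = x)
      in prod_encode (int_encode p, int_encode q))"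

definition encode_complex :: "complex \<Rightarrow> nat" where
  "encode_complex z = prod_encode (encode_rational (Re z), encode_rational (Im z))"

definition encode_mat :: "complex mat \<Rightarrow> nat" where
  "encode_mat M =
     list_encode [list_encode [encode_complex (M $$ (i, j)). j \<leftarrow> [0..<dim_col M]].
                    i \<leftarrow> [0..<dim_row M]]"

definition encode_superop :: "nat \<Rightarrow> (complex mat \<Rightarrow> complex mat) \<Rightarrow> nat" where
  "encode_superop d E =
     list_encode [list_encode [encode_mat (E (matrix_unit d i j)). j \<leftarrow> [0..<d]]. i \<leftarrow> [0..<d]]"

definition encode_automaton :: "quantum_automaton \<Rightarrow> nat" where
  "encode_automaton A = list_encode
     [qdim A,
      list_encode [prod_encode (\<alpha>, encode_superop (qdim A) (superop A \<alpha>)).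
                     \<alpha> \<leftarrow> sorted_list_of_set (Act A)],
      encode_mat (init A)]"

definition encode_instance :: "quantum_automaton \<times> complex mat list \<Rightarrow> nat" where
  "encode_instance = (\<lambda>(A, \<phi>). prod_encode (encode_automaton A, list_encode (map encode_mat \<phi>)))"

definition rational_instances :: "(quantum_automaton \<times> complex mat list) set" where
  "rational_instances =
     {(A, \<phi>). wf_automaton A \<and> rational_automaton A \<and>
              (\<forall>P\<in>set \<phi>. projection (qdim A) P \<and> rational_mat P)}"

end

theory Submission
  imports Defs "HOL-Computational_Algebra.Polynomial" "HOL-Computational_Algebra.Primes"
    "HOL-Library.Function_Algebras" "HOL-Library.FuncSet"
begin

text \<open>For a positive matrix \<open>\<sigma>\<close>, the condition \<open>\<sigma> \<Turnstile> P\<close> is the linear equation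
  \<open>P \<sigma> = \<sigma>\<close>, and it is invariant under scaling.  Clearing denominators turns a rational automaton
  into a linear system over the integers: finitely many integer matrices, a start vector, and finitely
  many target subspaces.

  For such a system three conditions are equivalent: every infinite word hits a target infinitely
  often; every ultimately periodic word does; and there is an \<open>N\<close> such that from every reachable
  vector every word of length \<open>N\<close> hits a target.  From the second condition to the third one
  descends on the dimension of subspaces through which all long hit-free words have to pass.  A word
  that stays at the top dimension runs into a cycle that maps a subspace \<open>q\<close> onto itself.  By the
  theorem of Skolem, Mahler and Lech the orbit along that cycle hits a target within a time bound
  that depends on the cycle only, so a target contains all of \<open>q\<close> or one of its images along the
  cycle, which is a contradiction.

  Both validity and its negation now have certificates that can be checked.  For a fixed \<open>N\<close>, the
  third condition needs to be tested on short words only, by a dimension count in a tensor power.  An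
  ultimately periodic word that hits finitely often is certified by a linear recurrence for its states
  and a missed target in every residue class modulo a period computed from that recurrence.\<close>

section \<open>Zeros of linear recurrences\<close>

text \<open>Whether an integer recurrence has a zero at all is Skolem's problem, not known to be
  decidable, so no step may ask whether a single orbit ever hits. Infinitely many zeros are easier
  to handle: Hansel's proof yields a period explicitly from the order and the two end coefficients,
  and in a residue class modulo this period infinitely many zeros force all terms to vanish.
  Finitely many hits are thus witnessed by one miss per class and target. The same rigidity drives
  the descent. If all ultimately periodic words hit infinitely often, then on a cycle the first hit
  comes before the period, which depends on the cycle word and not on the vector. Hence finitely
  many preimages of targets cover the relevant vectors in \<open>q\<close>. As these vectors need
  not fill \<open>q\<close>, the cover is chosen minimal, so that its top members are not covered by
  finitely many proper subspaces. Because of such minimal choices the bound \<open>N\<close> is only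
  known to exist. The algorithm therefore searches at the same time for a good \<open>N\<close> and
  for a certificate of the negation.\<close>

text \<open>This is the ideal p^k Z_(p), i.e. p-adic valuation at least \<open>k\<close>, phrased so
  that zero is no special case.\<close>

definition pint :: "int \<Rightarrow> nat \<Rightarrow> rat \<Rightarrow> bool" where
  "pint p k r \<longleftrightarrow> (\<exists>s z. \<not> p dvd s \<and> of_int s * r = of_int (p ^ k * z))"

lemma pint_of_int: "pint p k r" if "\<not> p dvd 1" "r = of_int (p ^ k * z)"
  unfolding pint_def using that by (intro exI[of _ 1] exI[of _ z]) auto

lemma pint_0: "prime p \<Longrightarrow> pint p k 0"
  by (rule pint_of_int[where z = 0]) (auto simp: not_prime_unit)

lemma pint_add:
  assumes "prime p" "pint p k a" "pint p k b" shows "pint p k (a + b)"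
proof -
  obtain s z where 1: "\<not> p dvd s" "of_int s * a = of_int (p ^ k * z)"
    using assms(2) unfolding pint_def by blast
  obtain t y where 2: "\<not> p dvd t" "of_int t * b = of_int (p ^ k * y)"
    using assms(3) unfolding pint_def by blast
  have "of_int (s * t) * (a + b) = of_int t * (of_int s * a) + of_int s * (of_int t * b)"
    by (simp add: algebra_simps)
  also have "\<dots> = of_int (p ^ k * (t * z + s * y))"
    unfolding 1 2 by (simp add: algebra_simps)
  finally show ?thesis unfolding pint_def
    using 1 2 assms(1) prime_dvd_mult_iff by blast
qed

lemma pint_mult_int:
  assumes "pint p k r" shows "pint p k (of_int a * r)"
proof -
  obtain s z where 1: "\<not> p dvd s" "of_int s * r = of_int (p ^ k * z)"
    using assms unfolding pint_def by blast
  have "of_int s * (of_int a * r) = of_int a * (of_int s * r)"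
    by (simp add: algebra_simps)
  also have "\<dots> = of_int (p ^ k * (a * z))"
    unfolding 1 by (simp add: algebra_simps)
  finally show ?thesis unfolding pint_def using 1 by blast
qed

lemma pint_sum:
  assumes "prime p" "\<And>i. i \<in> A \<Longrightarrow> pint p k (f i)" shows "pint p k (sum f A)"
proof (cases "finite A")
  case True
  from this assms(2) show ?thesis
    by (induction A rule: finite_induct) (auto intro: pint_add[OF assms(1)] pint_0[OF assms(1)])
qed (auto intro: pint_0[OF assms(1)])

lemma pint_mono:
  assumes "pint p k r" "j \<le> k" shows "pint p j r"
proof -
  obtain s z where 1: "\<not> p dvd s" "of_int s * r = of_int (p ^ k * z)"
    using assms unfolding pint_def by blast
  have "p ^ k * z = p ^ j * (p ^ (k - j) * z)"
    using assms(2) by (simp add: mult.assoc[symmetric] power_add[symmetric])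
  with 1 show ?thesis unfolding pint_def by metis
qed

lemma pint_dvd:
  assumes "prime p" "pint p k (of_int a)" shows "p ^ k dvd a"
proof -
  obtain s z where 1: "\<not> p dvd s" "of_int s * (of_int a::rat) = of_int (p ^ k * z)"
    using assms unfolding pint_def by blast
  from 1(2) have "(of_int (s * a) :: rat) = of_int (p ^ k * z)" by simp
  hence "s * a = p ^ k * z" by (simp only: of_int_eq_iff)
  hence "p ^ k dvd s * a" by simp
  moreover have "coprime (p ^ k) s"
    using assms(1) 1(1) by (simp add: prime_imp_coprime)
  ultimately show ?thesis using coprime_dvd_mult_right_iff by blast
qed

text \<open>Legendre's recursion: the multiples of \<open>p\<close> among the factors contribute p^q
  q!, and all other factors are prime to \<open>p\<close>.\<close>

lemma fact_prime_quotient: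
  fixes p :: nat assumes p: "prime p" and "r < p"
  shows "\<exists>s. \<not> p dvd s \<and> fact (p * q + r) = p ^ q * fact q * s"
  using \<open>r < p\<close>
proof (induction q arbitrary: r)
  have step: "\<exists>s. \<not> p dvd s \<and> fact (p * q + r) = p ^ q * fact q * s"
    if "\<exists>s. \<not> p dvd s \<and> fact (p * q) = p ^ q * fact q * s" "r < p" for q r
    using that(2)
  proof (induction r)
    case 0 thus ?case using that(1) by simp
  next
    case (Suc r)
    then obtain s where s: "\<not> p dvd s" "fact (p * q + r) = p ^ q * fact q * s" by auto
    have "\<not> p dvd (p * q + Suc r)"
      using Suc.prems by (metis dvd_add_right_iff dvd_triv_left nat_dvd_not_less zero_less_Suc)
    hence "\<not> p dvd s * (p * q + Suc r)" using s(1) p prime_dvd_mult_iff by blast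
    moreover have "fact (p * q + Suc r) = p ^ q * fact q * (s * (p * q + Suc r))"
      using s(2) by (simp add: algebra_simps)
    ultimately show ?case by blast
  qed
  {
    case 0 show ?case using p 0 by (intro step) (auto simp: not_prime_unit intro!: exI[of _ 1])
  next
    case (Suc q)
    have p0: "p > 0" using p prime_gt_0_nat by blast
    then obtain s where s: "\<not> p dvd s" "fact (p * q + (p - 1)) = p ^ q * fact q * s"
      using Suc.IH[of "p - 1"] by auto
    have "p * Suc q = Suc (p * q + (p - 1))" using p0 by simp
    hence "fact (p * Suc q) = (p * Suc q) * fact (p * q + (p - 1))" by (metis fact_Suc of_nat_id)
    also have "\<dots> = p ^ Suc q * fact (Suc q) * s" unfolding s by (simp add: algebra_simps)
    finally show ?case using s(1) Suc.prems by (intro step) auto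
  }
qed

text \<open>Legendre's bound i/(p-1) on the valuation of i!, weakened to i/2, which is valid for odd
  primes.\<close>

lemma fact_prime_factorization:
  fixes p :: nat assumes p: "prime p" and "p > 2"
  shows "\<exists>v s. \<not> p dvd s \<and> fact i = p ^ v * s \<and> 2 * v \<le> i"
proof (induction i rule: less_induct)
  case (less i)
  show ?case
  proof (cases "i = 0")
    case True thus ?thesis using p by (intro exI[of _ 0] exI[of _ 1]) (auto simp: not_prime_unit)
  next
    case False
    define q r where "q = i div p" and "r = i mod p"
    have i: "i = p * q + r" and r: "r < p" unfolding q_def r_def using assms by auto
    have "q < i" unfolding q_def using False assms by simp
    with less obtain v s where v: "\<not> p dvd s" "fact q = p ^ v * s" "2 * v \<le> q" by blast
    obtain t where t: "\<not> p dvd t" "fact i = p ^ q * fact q * t"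
      using fact_prime_quotient[OF p r, of q] i by auto
    have "fact i = p ^ (q + v) * (s * t)" unfolding t v by (simp add: power_add algebra_simps)
    moreover have "\<not> p dvd s * t" using v t p prime_dvd_mult_iff by blast
    moreover have "2 * (q + v) \<le> i"
    proof -
      have "2 * (q + v) \<le> 3 * q" using v by simp
      also have "\<dots> \<le> p * q" using assms by simp
      finally show ?thesis using i by simp
    qed
    ultimately show ?thesis by blast
  qed
qed

text \<open>The growth estimate behind Hansel's argument. For p = 2 it fails: 2^i / i! has valuation
  1 whenever i is a power of 2. This is why the prime is taken odd.\<close>

lemma pint_power_div_fact:
  fixes p :: nat assumes p: "prime p" and "p > 2"
  shows "pint (int p) (i div 2) (of_nat p ^ i / fact i)"
proof -
  obtain v s where v: "\<not> p dvd s" "fact i = p ^ v * s" "2 * v \<le> i"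
    using fact_prime_factorization[OF assms] by blast
  have f: "(fact i :: rat) = of_nat (p ^ v * s)" using v(2) by (metis of_nat_fact)
  have nz: "p \<noteq> 0" "s \<noteq> 0" using assms v(1) by (auto intro: ccontr)
  have "i = v + (i div 2 + (i - v - i div 2))" using v(3) by simp
  hence "of_nat p ^ i = (of_nat p ^ v * of_nat p ^ (i div 2) * of_nat p ^ (i - v - i div 2) :: rat)"
    by (metis power_add mult.assoc)
  hence "of_int (int s) * (of_nat p ^ i / fact i) =
     (of_int (int p ^ (i div 2) * int p ^ (i - v - i div 2)) :: rat)"
    unfolding f using nz by (simp add: field_simps)
  thus ?thesis unfolding pint_def using v(1) int_dvd_int_iff by blast
qed

section \<open>Dividing out roots of polynomials with small tails\<close>

definition tail_pint :: "int \<Rightarrow> nat \<Rightarrow> nat \<Rightarrow> rat poly \<Rightarrow> bool" where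
  "tail_pint p K k P \<longleftrightarrow> (\<forall>j\<ge>k. pint p K (coeff P j))"

text \<open>If P = (X - a) Q, then q_j = p_(j+1) + a q_(j+1), so divisibility spreads downwards from
  the degree, and removing a root lowers the threshold by one.\<close>

lemma tail_pint_divide:
  assumes p: "prime p" and t: "tail_pint p K (Suc k) ([:- of_nat a, 1:] * Q)"
  shows "tail_pint p K k Q"
proof -
  have "pint p K (coeff Q j)" if "j \<ge> k" for j
    using that
  proof (induction "Suc (degree Q) - j" arbitrary: j)
    case 0
    thus ?case by (simp add: coeff_eq_0 pint_0[OF p])
  next
    case (Suc n)
    have IH: "pint p K (coeff Q (Suc j))" using Suc by (intro Suc.hyps(1)) auto
    have "coeff ([:- of_nat a, 1:] * Q) (Suc j) = coeff Q j - of_nat a * coeff Q (Suc j)"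
      by simp
    hence "coeff Q j = coeff ([:- of_nat a, 1:] * Q) (Suc j) + of_int (int a) * coeff Q (Suc j)"
      by simp
    moreover have "pint p K (coeff ([:- of_nat a, 1:] * Q) (Suc j))"
      using t Suc.prems unfolding tail_pint_def by blast
    ultimately show ?case using pint_add[OF p] pint_mult_int[OF IH] by metis
  qed
  thus ?thesis unfolding tail_pint_def by blast
qed

text \<open>One division per element of \<open>Z\<close> brings the threshold down to 0, so the last
  quotient has all coefficients divisible; the factors t - a that are multiplied back are
  integers.\<close>

lemma pint_poly_of_roots:
  assumes p: "prime p" and "finite Z" "\<And>a. a \<in> Z \<Longrightarrow> poly P (of_nat a) = 0"
    "tail_pint p K (card Z) P"
  shows "pint p K (poly P (of_nat t))"
  using assms(2-4)
proof (induction Z arbitrary: P rule: finite_induct)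
  case empty
  have eq: "poly P (of_nat t) = (\<Sum>i\<le>degree P. of_int (int t ^ i) * coeff P i)"
    by (simp add: poly_altdef mult.commute)
  moreover have "pint p K (of_int (int t ^ i) * coeff P i)" for i
    using empty(2) unfolding tail_pint_def by (intro pint_mult_int) simp
  ultimately show ?case unfolding eq by (intro pint_sum[OF p])
next
  case (insert a Z)
  have "poly P (of_nat a) = 0" using insert by blast
  then obtain Q where Q: "P = [:- of_nat a, 1:] * Q" using poly_eq_0_iff_dvd by blast
  have "poly Q (of_nat b) = 0" if "b \<in> Z" for b
  proof -
    have "poly P (of_nat b) = 0" using insert.prems(1) that by blast
    moreover have "poly P (of_nat b) = (of_nat b - of_nat a) * poly Q (of_nat b)"
      unfolding Q by (simp add: algebra_simps)
    moreover have "a \<noteq> b" using that insert.hyps by blast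
    ultimately show ?thesis by simp
  qed
  moreover have "tail_pint p K (card Z) Q"
  proof (rule tail_pint_divide[OF p])
    have "card (insert a Z) = Suc (card Z)" using insert.hyps by simp
    with insert.prems(2) have "tail_pint p K (Suc (card Z)) P" by metis
    thus "tail_pint p K (Suc (card Z)) ([:- of_nat a, 1:] * Q)" by (rule subst[OF Q])
  qed
  ultimately have "pint p K (poly Q (of_nat t))" by (rule insert.IH)
  hence "pint p K (of_int (int t - int a) * poly Q (of_nat t))" by (rule pint_mult_int)
  thus ?case unfolding Q by (simp add: algebra_simps)
qed

text \<open>The falling factorial, preferred to the binomial coefficient polynomial because its
  coefficients are integers.\<close>

definition falling :: "nat \<Rightarrow> rat poly" where
  "falling i = (\<Prod>j<i. [:- of_nat j, 1:])"

lemma falling_coeff: "(\<exists>a. coeff (falling i) j = of_int a) \<and> (i < j \<longrightarrow> coeff (falling i) j = 0)"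
proof (induction i arbitrary: j)
  case 0
  show ?case by (cases "j = 0") (auto simp: falling_def coeff_1 intro: exI[of _ 1] exI[of _ 0])
next
  case (Suc i)
  have eq: "falling (Suc i) = [:- of_nat i, 1:] * falling i"
    by (simp add: falling_def mult.commute)
  show ?case
  proof (cases j)
    case 0
    obtain a where "coeff (falling i) 0 = of_int a" using Suc by blast
    hence "coeff (falling (Suc i)) j = of_int (- int i * a)" unfolding eq 0 by simp
    thus ?thesis unfolding 0 by blast
  next
    case (Suc j')
    obtain a b where "coeff (falling i) j = of_int a" "coeff (falling i) j' = of_int b"
      using Suc.IH by blast
    hence "coeff (falling (Suc i)) j = of_int (b - int i * a)" unfolding eq Suc by simp
    moreover have "i < j' \<longrightarrow> coeff (falling (Suc i)) j = 0"
      using Suc.IH[of j] Suc.IH[of j'] unfolding eq Suc by simp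
    ultimately show ?thesis unfolding Suc by (simp only: Suc_less_eq) blast
  qed
qed

lemma poly_falling: "poly (falling i) (of_nat t) = fact i * of_nat (t choose i)"
proof -
  have "poly (falling i) (of_nat t) = (\<Prod>j<i. of_nat t - of_nat j)"
    by (simp add: falling_def poly_prod)
  also have "\<dots> = fact i * (of_nat t gchoose i)"
    by (simp add: gbinomial_prod_rev atLeast0LessThan)
  finally show ?thesis by (simp add: binomial_gbinomial)
qed

text \<open>Hansel's argument: on \<open>{..n}\<close> the sequence agrees with a polynomial whose coefficients
  of degree at least \<open>k\<close> are divisible by \<open>p ^ (k div 2)\<close>; dividing out \<open>k\<close> zeros moves this
  divisibility to all coefficients.\<close>

theorem binomial_series_zeros:
  fixes p :: nat and d :: "nat \<Rightarrow> int"
  assumes p: "prime p" "p > 2"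
    and f: "\<And>n. f n = (\<Sum>i\<le>n. int (n choose i) * int p ^ i * d i)"
    and inf: "infinite {n. f n = 0}"
  shows "f t = 0"
proof -
  have pi: "prime (int p)" using p by simp
  have "int p ^ K dvd f t" for K
  proof -
    \<comment> \<open>\<open>2 * K\<close> zeros, because divisibility by p^K is guaranteed for the
      coefficients of degree at least \<open>2 * K\<close>.\<close>
    obtain Z where Z: "Z \<subseteq> {n. f n = 0}" "finite Z" "card Z = 2 * K"
      using infinite_arbitrarily_large[OF inf] by blast
    define n where "n = Max (insert t Z)"
    have nZ: "a \<le> n" if "a \<in> insert t Z" for a unfolding n_def using that Z by simp
    \<comment> \<open>Truncation at \<open>n\<close> changes no value up to \<open>n\<close>, since
      binomial coefficients with too large a lower index vanish. Splitting off p^i / i! exposes the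
      p-adic decay.\<close>
    define P where "P = (\<Sum>i\<le>n. smult (of_nat p ^ i / fact i * of_int (d i)) (falling i))"
    have val: "poly P (of_nat a) = of_int (f a)" if "a \<le> n" for a
    proof -
      have "poly P (of_nat a) = (\<Sum>i\<le>n. of_int (int (a choose i) * int p ^ i * d i))"
        unfolding P_def by (simp add: poly_sum poly_falling algebra_simps)
      also have "\<dots> = (\<Sum>i\<le>a. of_int (int (a choose i) * int p ^ i * d i))"
        using that by (intro sum.mono_neutral_right) (auto simp: not_le)
      finally show ?thesis unfolding f by simp
    qed
    have "pint p K (coeff P j)" if j: "j \<ge> 2 * K" for j
    proof -
      have eq: "coeff P j = (\<Sum>i\<le>n. of_nat p ^ i / fact i * of_int (d i) * coeff (falling i) j)"
        unfolding P_def by (simp add: coeff_sum)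
      moreover have "pint p K (of_nat p ^ i / fact i * of_int (d i) * coeff (falling i) j)" for i
      proof (cases "i < j")
        case True thus ?thesis using falling_coeff[of i j] by (simp add: pint_0[OF pi])
      next
        case False
        obtain a where a: "coeff (falling i) j = of_int a" using falling_coeff by blast
        have "pint p K (of_nat p ^ i / fact i)"
          using pint_power_div_fact[OF p, of i] by (rule pint_mono) (use False j in linarith)
        from pint_mult_int[OF this, of "d i * a"] show ?thesis
          unfolding a by (simp add: algebra_simps)
      qed
      ultimately show ?thesis unfolding eq by (intro pint_sum[OF pi])
    qed
    hence "tail_pint p K (card Z) P" unfolding tail_pint_def Z(3) by blast
    hence "pint p K (poly P (of_nat t))"
      using Z nZ by (intro pint_poly_of_roots[OF pi, of Z]) (auto simp: val)
    thus ?thesis using pint_dvd[OF pi] val[of t] nZ by simp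
  qed
  \<comment> \<open>All powers of \<open>p\<close> divide \<open>f t\<close>, but the one with
    exponent |f t| already exceeds |f t|.\<close>
  from this[of "nat \<bar>f t\<bar>"] have "f t \<noteq> 0 \<Longrightarrow> int p ^ nat \<bar>f t\<bar> \<le> \<bar>f t\<bar>"
    using zdvd_imp_le[of _ "\<bar>f t\<bar>"] by simp
  moreover have "\<bar>f t\<bar> < int p ^ nat \<bar>f t\<bar>"
    using of_nat_less_two_power[of "nat \<bar>f t\<bar>", where 'a = int]
      power_mono[of 2 "int p" "nat \<bar>f t\<bar>"] p by simp
  ultimately show ?thesis by linarith
qed

section \<open>Linear recurrences modulo a prime and the Skolem-Mahler-Lech theorem\<close>

definition satisfies_recurrence :: "nat \<Rightarrow> (nat \<Rightarrow> int) \<Rightarrow> (nat \<Rightarrow> int) \<Rightarrow> bool" where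
  "satisfies_recurrence m c z \<longleftrightarrow> (\<forall>n. (\<Sum>k\<le>m. c k * z (n + k)) = 0)"

lemma satisfies_recurrence_diff:
  assumes "satisfies_recurrence m c z"
  shows "satisfies_recurrence m c (\<lambda>n. z (n + h) - z n)"
proof -
  have "(\<Sum>k\<le>m. c k * (z (n + k + h) - z (n + k))) = 0" for n
    using assms[unfolded satisfies_recurrence_def, rule_format, of "n + h"]
      assms[unfolded satisfies_recurrence_def, rule_format, of n]
    by (simp add: right_diff_distrib sum_subtractf algebra_simps)
  thus ?thesis unfolding satisfies_recurrence_def by simp
qed

text \<open>Both end coefficients are invertible modulo \<open>p\<close>, so the recurrence
  determines the next and the previous term, and a window of \<open>m\<close> zeros spreads both
  ways.\<close>

lemma recurrence_dvd_all:
  assumes p: "prime p" and c: "\<not> p dvd c 0" "\<not> p dvd c m"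
    and r: "satisfies_recurrence m c w" and i: "\<And>k. k < m \<Longrightarrow> p dvd w (i + k)"
  shows "p dvd w n"
proof -
  have fwd: "p dvd w (j + k)" if "\<And>k. k < m \<Longrightarrow> p dvd w (j + k)" "k \<le> m" for j k
  proof (cases "k = m")
    case True
    have "c m * w (j + m) = - (\<Sum>k<m. c k * w (j + k))"
      using r[unfolded satisfies_recurrence_def, rule_format, of j]
      by (simp add: lessThan_Suc_atMost[symmetric])
    moreover have "p dvd - (\<Sum>k<m. c k * w (j + k))"
      using that by (auto intro!: dvd_sum)
    ultimately have "p dvd c m * w (j + m)" by simp
    thus ?thesis using p c True prime_dvd_mult_iff by blast
  qed (use that in auto)
  have bwd: "p dvd w j" if "\<And>k. k < m \<Longrightarrow> p dvd w (Suc j + k)" for j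
  proof -
    have "c 0 * w j = - (\<Sum>k<m. c (Suc k) * w (Suc j + k))"
      using r[unfolded satisfies_recurrence_def, rule_format, of j]
      by (simp add: sum.atMost_shift)
    moreover have "p dvd - (\<Sum>k<m. c (Suc k) * w (Suc j + k))"
      using that by (auto intro!: dvd_sum dvd_mult)
    ultimately have "p dvd c 0 * w j" by simp
    thus ?thesis using p c prime_dvd_mult_iff by blast
  qed
  have up: "\<forall>k<m. p dvd w (i + t + k)" for t
  proof (induction t)
    case (Suc t)
    show ?case
    proof (intro allI impI)
      fix k assume "k < m"
      thus "p dvd w (i + Suc t + k)" using fwd[of "i + t" "Suc k"] Suc by simp
    qed
  qed (use i in auto)
  have down: "\<forall>k<m. p dvd w (i - t + k)" for t
  proof (induction t)
    case (Suc t)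
    show ?case
    proof (cases "i \<le> t")
      case False
      hence eq: "i - t = Suc (i - Suc t)" by simp
      have 0: "p dvd w (i - Suc t)" using Suc bwd unfolding eq by simp
      show ?thesis
      proof (intro allI impI)
        fix k assume "k < m"
        show "p dvd w (i - Suc t + k)"
        proof (cases k)
          case 0 thus ?thesis using \<open>p dvd w (i - Suc t)\<close> by simp
        next
          case (Suc k')
          thus ?thesis using \<open>k < m\<close> Suc.IH eq by simp
        qed
      qed
    qed (use Suc in simp)
  qed (use i in auto)
  \<comment> \<open>The detour over the window at \<open>Suc n\<close> also settles m = 0, where
    windows are empty and only the relation itself gives information.\<close>
  show ?thesis
  proof (rule bwd)
    fix k assume "k < m"
    show "p dvd w (Suc n + k)"
    proof (cases "i \<le> Suc n")
      case True thus ?thesis using up[of "Suc n - i"] \<open>k < m\<close> by simp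
    next
      case False thus ?thesis using down[of "i - Suc n"] \<open>k < m\<close> by simp
    qed
  qed
qed

text \<open>Pigeonhole gives two equal windows at a distance h of at most p^m. The difference
  sequence vanishes on a window, hence everywhere, so \<open>h\<close> is a period from the start.
  The factorial is a multiple of every such h, and the bound \<open>q\<close> replaces
  \<open>p\<close> so that no prime has to be computed.\<close>

lemma recurrence_mod_period:
  fixes p :: nat
  assumes p: "prime p" and c: "\<not> int p dvd c 0" "\<not> int p dvd c m"
    and r: "satisfies_recurrence m c z" and q: "p \<le> q"
  shows "int p dvd z (n + fact (q ^ m)) - z n"
proof -
  define S where "S n = map (\<lambda>k. z (n + k) mod int p) [0..<m]" for n
  define L where "L = {xs::int list. set xs \<subseteq> {0..<int p} \<and> length xs = m}"
  have p0: "int p > 0" using p prime_gt_0_nat by simp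
  have L: "finite L" "card L = p ^ m"
    unfolding L_def by (simp_all add: finite_lists_length_eq card_lists_length_eq)
  have "S ` {0..p ^ m} \<subseteq> L" unfolding S_def L_def using p0 by auto
  hence "card (S ` {0..p ^ m}) \<le> p ^ m" using L by (metis card_mono)
  hence "\<not> inj_on S {0..p ^ m}" using card_image by fastforce
  then obtain i j where ij: "i \<le> p ^ m" "j \<le> p ^ m" "i < j" "S i = S j"
    unfolding inj_on_def by (metis atLeastAtMost_iff nat_neq_iff)
  define h where "h = j - i"
  have h: "h > 0" "h \<le> p ^ m" "j = i + h" unfolding h_def using ij by auto
  have "int p dvd z (i + k + h) - z (i + k)" if "k < m" for k
  proof -
    have "S i ! k = S j ! k" using ij by simp
    hence "z (i + k) mod int p = z (j + k) mod int p" unfolding S_def using that by simp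
    hence "int p dvd z (j + k) - z (i + k)" by (metis mod_eq_dvd_iff)
    thus ?thesis using h(3) by (simp add: algebra_simps)
  qed
  hence per: "int p dvd z (n + h) - z n" for n
    using recurrence_dvd_all[OF _ c satisfies_recurrence_diff[OF r, of h], of i] p by simp
  have mult: "int p dvd z (n + h * t) - z n" for t n
  proof (induction t)
    case (Suc t)
    have "z (n + h * Suc t) - z n = (z (n + h * t + h) - z (n + h * t)) + (z (n + h * t) - z n)"
      by (simp add: algebra_simps)
    thus ?case using per[of "n + h * t"] Suc by (metis dvd_add)
  qed simp
  have "h \<le> q ^ m" using h(2) power_mono[OF q, of m] by simp
  hence "h dvd fact (q ^ m)" using h(1) by (intro dvd_fact) auto
  then obtain t where "(fact (q ^ m) :: nat) = h * t" by blast
  thus ?thesis using mult by metis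
qed

definition zero_period :: "nat \<Rightarrow> (nat \<Rightarrow> int) \<Rightarrow> nat" where
  "zero_period m c = fact ((2 * nat \<bar>c 0 * c m\<bar> + 1) ^ m)"

text \<open>Skolem-Mahler-Lech with an explicit period \<open>b\<close>: the shift by
  \<open>b\<close> is 1 + p D, where D maps solutions of the recurrence to solutions, so the
  binomial theorem produces the series required by Hansel's argument.\<close>

theorem recurrence_zeros:
  assumes r: "satisfies_recurrence m c z" and c: "c 0 \<noteq> 0" "c m \<noteq> 0"
    and inf: "infinite {n. z (a + zero_period m c * n) = 0}"
  shows "z (a + zero_period m c * n) = 0"
proof -
  define q where "q = 2 * nat \<bar>c 0 * c m\<bar> + 1"
  define b where "b = zero_period m c"
  have bq: "b = fact (q ^ m)" unfolding b_def zero_period_def q_def by simp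
  have "q \<noteq> 1" unfolding q_def using c by simp
  then obtain p where p: "prime p" "p dvd q" using prime_factor_nat by blast
  have "p \<noteq> 2" using p(2) unfolding q_def by (metis dvd_triv_left even_add even_mult_iff odd_one)
  hence p2: "p > 2" using p(1) prime_ge_2_nat[of p] by simp
  have pq: "p \<le> q" using p(2) unfolding q_def by (intro dvd_imp_le) auto
  have pc: "\<not> int p dvd c 0 * c m"
  proof
    assume "int p dvd c 0 * c m"
    hence "int p dvd int (2 * nat \<bar>c 0 * c m\<bar>)" by simp
    hence "p dvd 2 * nat \<bar>c 0 * c m\<bar>" by (simp only: int_dvd_int_iff)
    with p(2) have "p dvd 1" unfolding q_def by (metis dvd_add_right_iff)
    with p(1) show False by (simp add: not_prime_unit)
  qed
  hence pc: "\<not> int p dvd c 0" "\<not> int p dvd c m" by auto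
  have per: "int p dvd y (n + b) - y n" if "satisfies_recurrence m c y" for y n
    unfolding bq by (rule recurrence_mod_period[OF p(1) pc that pq])
  define D where "D y n = (y (n + b) - y n) div int p" for y :: "nat \<Rightarrow> int" and n
  have D: "y (n + b) = y n + int p * D y n" if "satisfies_recurrence m c y" for y n
    unfolding D_def using per[OF that, of n] by simp
  have Dr: "satisfies_recurrence m c (D y)" if y: "satisfies_recurrence m c y" for y
  proof -
    have "int p * (\<Sum>k\<le>m. c k * D y (n + k)) = 0" for n
    proof -
      have "int p * (\<Sum>k\<le>m. c k * D y (n + k)) = (\<Sum>k\<le>m. c k * (int p * D y (n + k)))"
        by (simp add: sum_distrib_left algebra_simps)
      also have "\<dots> = (\<Sum>k\<le>m. c k * (y (n + k + b) - y (n + k)))"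
        by (simp add: D[OF y])
      finally show ?thesis
        using satisfies_recurrence_diff[OF y, of b] unfolding satisfies_recurrence_def by simp
    qed
    thus ?thesis unfolding satisfies_recurrence_def using p2 by simp
  qed
  \<comment> \<open>Expansion of (1 + p D)^n; \<open>y\<close> is generalised because the induction
    hypothesis is applied to \<open>D y\<close> as well.\<close>
  have expand: "y (a + b * n) = (\<Sum>i\<le>n. int (n choose i) * int p ^ i * (D ^^ i) y a)"
    if "satisfies_recurrence m c y" for y n
    using that
  proof (induction n arbitrary: y)
    case (Suc n)
    let ?g = "\<lambda>i. int p ^ i * (D ^^ i) y a"
    have "y (a + b * Suc n) = y (a + b * n) + int p * D y (a + b * n)"
      using D[OF Suc.prems, of "a + b * n"] by (simp add: algebra_simps)
    also have "y (a + b * n) = (\<Sum>i\<le>n. int (n choose i) * ?g i)"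
      by (subst Suc.IH[OF Suc.prems]) (simp add: mult.assoc)
    also have "D y (a + b * n) = (\<Sum>i\<le>n. int (n choose i) * int p ^ i * (D ^^ Suc i) y a)"
      by (subst Suc.IH[OF Dr[OF Suc.prems]]) (simp add: funpow_swap1)
    also have "int p * \<dots> = (\<Sum>i\<le>n. int (n choose i) * ?g (Suc i))"
      by (simp add: sum_distrib_left algebra_simps)
    also have "(\<Sum>i\<le>n. int (n choose i) * ?g i) = (\<Sum>i\<le>Suc n. int (n choose i) * ?g i)"
      by simp
    also have "\<dots> = ?g 0 + (\<Sum>i\<le>n. int (n choose Suc i) * ?g (Suc i))"
      by (subst sum.atMost_Suc_shift) simp
    also have "\<dots> + (\<Sum>i\<le>n. int (n choose i) * ?g (Suc i)) =
        ?g 0 + (\<Sum>i\<le>n. int (Suc n choose Suc i) * ?g (Suc i))"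
      by (simp only: binomial_Suc_Suc of_nat_add distrib_right sum.distrib add.assoc
          add.commute[of "\<Sum>i\<le>n. int (n choose i) * ?g (Suc i)"])
    also have "\<dots> = (\<Sum>i\<le>Suc n. int (Suc n choose i) * ?g i)"
      by (subst sum.atMost_Suc_shift) simp
    finally show ?case by (simp add: mult.assoc)
  qed simp
  show ?thesis
    using binomial_series_zeros[OF p(1) p2, of "\<lambda>n. z (a + b * n)" "\<lambda>i. (D ^^ i) z a" n] expand[OF r] inf
    unfolding b_def by simp
qed

section \<open>Hit-free words of linear systems\<close>

definition pump :: "'a list \<Rightarrow> nat \<Rightarrow> 'a list" where
  "pump u a = map (\<lambda>t. u ! (t mod length u)) [0..<a]"

lemma pump_add: "u \<noteq> [] \<Longrightarrow> pump u (length u + a) = u @ pump u a"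
  unfolding pump_def by (intro nth_equalityI) (auto simp: nth_append le_mod_geq)

lemma pump_take: "a \<le> length u \<Longrightarrow> pump u a = take a u"
  unfolding pump_def by (intro nth_equalityI) auto

lemma set_pump: "u \<noteq> [] \<Longrightarrow> set (pump u a) \<subseteq> set u"
  unfolding pump_def by auto

text \<open>Full turns leave \<open>q\<close> in place, so only the phase within the cycle
  matters.\<close>

lemma fold_pump_image:
  assumes "u \<noteq> []" "fold M u ` q = q"
  shows "fold M (pump u a) ` q = fold M (take (a mod length u) u) ` q"
proof (induction a rule: less_induct)
  case (less a)
  show ?case
  proof (cases "a < length u")
    case True thus ?thesis by (simp add: pump_take)
  next
    case False
    then obtain c where a: "a = length u + c" using le_Suc_ex not_le by blast
    have "fold M (pump u a) ` q = fold M (pump u c) ` (fold M u ` q)"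
      unfolding a pump_add[OF assms(1)] by (auto simp: image_comp comp_def)
    also have "\<dots> = fold M (take (c mod length u) u) ` q"
      unfolding assms(2) using less[of c] a assms(1) by simp
    finally show ?thesis unfolding a by simp
  qed
qed

text \<open>A locale of its own: constants defined in \<open>vector_space\<close> itself are shadowed by those of
  its global interpretation for real vector spaces.\<close>

locale dimension_space = vector_space scale
  for scale :: "'f::field \<Rightarrow> 'b::ab_group_add \<Rightarrow> 'b"
begin

text \<open>Given by a finite spanning set, as the ambient space may have infinite dimension. The
  strict bound makes \<open>dim_less 0\<close> unsatisfiable, which is the base case of the
  descent.\<close>

definition dim_less :: "nat \<Rightarrow> 'b set \<Rightarrow> bool" where
  "dim_less r q \<longleftrightarrow> (\<exists>B. finite B \<and> card B < r \<and> q = span B)"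

lemma dim_less_imp_subspace: "dim_less r q \<Longrightarrow> subspace q"
  unfolding dim_less_def by auto

lemma dim_less_proper:
  assumes "dim_less (Suc r) q" "subspace q'" "q' \<subset> q"
  shows "dim_less r q'"
proof -
  obtain B where B: "finite B" "card B \<le> r" "q = span B"
    using assms(1) unfolding dim_less_def by auto
  obtain C where C: "C \<subseteq> q'" "independent C" "q' \<subseteq> span C"
    using maximal_independent_subset by blast
  have q': "q' = span C" using C assms(2) by (simp add: span_minimal subset_antisym)
  obtain a where a: "a \<in> q" "a \<notin> q'" using assms(3) by blast
  have "independent (insert a C)" using C(2) a(2) unfolding q' by (intro independent_insertI)
  moreover have "insert a C \<subseteq> span B"
    using C(1) a(1) assms(3) unfolding B(3)[symmetric] by blast
  ultimately have "finite (insert a C) \<and> card (insert a C) \<le> card B"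
    by (rule independent_span_bound[OF B(1)])
  moreover have "a \<notin> C" using a C by blast
  ultimately have "finite C" "card C < r" using B(2) by auto
  thus ?thesis unfolding dim_less_def using q' by blast
qed

lemma dim_less_subset:
  assumes "dim_less r q" "subspace q'" "q' \<subseteq> q" shows "dim_less r q'"
proof (cases "q' = q")
  case False
  obtain s where r: "r = Suc s" using assms(1) unfolding dim_less_def by (cases r) auto
  have "dim_less s q'" using dim_less_proper[of s q q'] assms False r by blast
  thus ?thesis unfolding dim_less_def r using less_SucI by blast
qed (use assms in simp)

lemma dim_less_image:
  assumes "module_hom scale scale f" "dim_less r q" shows "dim_less r (f ` q)"
proof -
  obtain B where B: "finite B" "card B < r" "q = span B"
    using assms(2) unfolding dim_less_def by auto
  have "f ` q = span (f ` B)" using module_hom.span_image[OF assms(1)] B(3) by simp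
  moreover have "card (f ` B) < r" using card_image_le[OF B(1), of f] B(2) by simp
  ultimately show ?thesis unfolding dim_less_def using B(1) by blast
qed

end

section \<open>Dimension descent along hit-free words\<close>

locale linear_system = dimension_space scale
  for scale :: "'f::field \<Rightarrow> 'b::ab_group_add \<Rightarrow> 'b" +
  fixes Act :: "'a set" and M :: "'a \<Rightarrow> 'b \<Rightarrow> 'b" and targets :: "'b set set" and R :: "'b set"
  assumes finite_Act: "finite Act"
    and hom: "a \<in> Act \<Longrightarrow> module_hom scale scale (M a)"
    and finite_targets: "finite targets"
    and target_subspace: "p \<in> targets \<Longrightarrow> subspace p"
    and R_closed: "a \<in> Act \<Longrightarrow> x \<in> R \<Longrightarrow> M a x \<in> R"
begin

text \<open>Only states from which a letter is read are tested, so consecutive segments of a word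
  share no tested state.\<close>

definition hitfree :: "'b \<Rightarrow> 'a list \<Rightarrow> bool" where
  "hitfree x w \<longleftrightarrow> (\<forall>j<length w. \<forall>p\<in>targets. fold M (take j w) x \<notin> p)"

lemma hom_fold: "set w \<subseteq> Act \<Longrightarrow> module_hom scale scale (fold M w)"
proof (induction w)
  case Nil
  show ?case unfolding fold.simps using linear_id by (simp only: linear_iff_module_hom)
next
  case (Cons a w)
  show ?case unfolding fold.simps 
    by (rule module_hom_compose[OF hom Cons.IH]) (use Cons.prems in auto)
qed

lemma R_fold: "set w \<subseteq> Act \<Longrightarrow> x \<in> R \<Longrightarrow> fold M w x \<in> R"
  by (induction w arbitrary: x) (auto intro: R_closed)

lemma hitfree_segment:
  assumes "hitfree x w" "j + N \<le> length w"
  shows "hitfree (fold M (take j w) x) (take N (drop j w))"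
  unfolding hitfree_def
proof (intro allI impI ballI)
  fix i p assume i: "i < length (take N (drop j w))" and p: "p \<in> targets"
  have "take (j + i) w = take j w @ take i (take N (drop j w))"
    using i assms(2) by (auto simp: take_add min_def split: if_splits)
  moreover have "fold M (take (j + i) w) x \<notin> p"
    using assms i p unfolding hitfree_def by simp
  ultimately show "fold M (take i (take N (drop j w))) (fold M (take j w) x) \<notin> p" by simp
qed

definition passes_through :: "'b set \<Rightarrow> nat \<Rightarrow> bool" where
  "passes_through Y N \<longleftrightarrow> (\<forall>x\<in>R. \<forall>w. set w \<subseteq> Act \<and> length w = N \<and> hitfree x w \<longrightarrow>
     (\<exists>j<N. fold M (take j w) x \<in> Y))"

text \<open>Take a cover with the fewest members of top dimension. If finitely many proper subspaces
  of such a member covered its part of \<open>Y\<close>, replacing it by them would lower that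
  number.\<close>

lemma indecomposable_cover:
  assumes "finite Q" "\<forall>q\<in>Q. dim_less (Suc r) q" "Y \<subseteq> \<Union>Q"
  obtains Q' where "finite Q'" "\<forall>q\<in>Q'. dim_less (Suc r) q" "Y \<subseteq> \<Union>Q'"
    "\<And>q S. q \<in> Q' \<Longrightarrow> \<not> dim_less r q \<Longrightarrow> finite S \<Longrightarrow> (\<forall>s\<in>S. subspace s \<and> s \<subseteq> q) \<Longrightarrow>
       Y \<inter> q \<subseteq> \<Union>S \<Longrightarrow> q \<in> S"
proof -
  define cover where "cover Q \<longleftrightarrow> finite Q \<and> (\<forall>q\<in>Q. dim_less (Suc r) q) \<and> Y \<subseteq> \<Union>Q" for Q
  define tops where "tops Q = {q\<in>Q. \<not> dim_less r q}" for Q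
  have "cover Q" unfolding cover_def using assms by blast
  then obtain Q' where Q': "cover Q'" "\<And>S. cover S \<Longrightarrow> card (tops Q') \<le> card (tops S)"
    using ex_has_least_nat[of cover Q "\<lambda>S. card (tops S)"] by blast
  show thesis
  proof (rule that[of Q'])
    fix q S assume q: "q \<in> Q'" "\<not> dim_less r q" and S: "finite S" "\<forall>s\<in>S. subspace s \<and> s \<subseteq> q"
      and Y: "Y \<inter> q \<subseteq> \<Union>S"
    show "q \<in> S"
    proof (rule ccontr)
      assume "q \<notin> S"
      have dq: "dim_less (Suc r) q" using q Q'(1) unfolding cover_def by blast
      have low: "dim_less r s" if "s \<in> S" for s
        using dim_less_proper[OF dq] S(2) that \<open>q \<notin> S\<close> by blast
      let ?S = "(Q' - {q}) \<union> S"
      have "dim_less (Suc r) s" if "s \<in> S" for s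
        using dim_less_subset[OF dq] S(2) that by blast
      moreover have "Y \<subseteq> \<Union>?S"
      proof
        fix x assume "x \<in> Y"
        thus "x \<in> \<Union>?S" using Q'(1) Y unfolding cover_def by (cases "x \<in> q") blast+
      qed
      ultimately have "cover ?S" using Q'(1) S(1) unfolding cover_def by auto
      moreover have "tops ?S = tops Q' - {q}" unfolding tops_def using low by auto
      moreover have "q \<in> tops Q'" "finite (tops Q')"
        using q Q'(1) unfolding tops_def cover_def by auto
      ultimately show False using Q'(2)[of ?S] by (metis card_Diff1_less not_le)
    qed
  qed (use Q'(1) in \<open>auto simp: cover_def\<close>)
qed

text \<open>The bounded gaps matter: the segments between successive visits then range over a finite
  set of words.\<close>

lemma passes_through_times:
  assumes pt: "passes_through Y N" and x: "x \<in> R" and w: "set w \<subseteq> Act" "hitfree x w"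
    and len: "length w = (K + 2) * (N + 1)"
  obtains f where "\<And>i. i \<le> K \<Longrightarrow> f i < length w \<and> fold M (take (f i) w) x \<in> Y"
    "\<And>i. i < K \<Longrightarrow> f i < f (Suc i) \<and> f (Suc i) - f i \<le> N"
proof -
  have "\<exists>j'. j \<le> j' \<and> j' < j + N \<and> fold M (take j' w) x \<in> Y" if j: "j + N \<le> length w" for j
  proof -
    let ?w = "take N (drop j w)"
    have "set ?w \<subseteq> Act" using w(1) by (meson order_trans set_drop_subset set_take_subset)
    moreover have "length ?w = N" using j by simp
    moreover have "set (take j w) \<subseteq> Act" using w(1) by (meson order_trans set_take_subset)
    hence "fold M (take j w) x \<in> R" using x by (rule R_fold)
    ultimately obtain i where i: "i < N" "fold M (take i ?w) (fold M (take j w) x) \<in> Y"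
      using pt hitfree_segment[OF w(2) j] unfolding passes_through_def by blast
    have "take (j + i) w = take j w @ take i ?w" using i by (simp add: take_add min_def)
    hence "fold M (take (j + i) w) x \<in> Y" using i by simp
    thus ?thesis using i(1) by (intro exI[of _ "j + i"]) auto
  qed
  then obtain v where v: "\<And>j. j + N \<le> length w \<Longrightarrow>
      j \<le> v j \<and> v j < j + N \<and> fold M (take (v j) w) x \<in> Y" by metis
  \<comment> \<open>The next visit is sought from \<open>Suc (f i)\<close> on, so it comes strictly
    later but at most \<open>N\<close> letters after the previous one.\<close>
  define f where "f = rec_nat (v 0) (\<lambda>_ y. v (Suc y))"
  have f: "f 0 = v 0" "f (Suc i) = v (Suc (f i))" for i unfolding f_def by auto
  have b: "f i < (i + 1) * (N + 1) \<and> fold M (take (f i) w) x \<in> Y" if "i \<le> K" for i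
    using that
  proof (induction i)
    case 0 show ?case using v[of 0] len unfolding f by auto
  next
    case (Suc i)
    have "(i + 3) * (N + 1) \<le> (K + 2) * (N + 1)" using Suc.prems by (intro mult_right_mono) auto
    hence "(i + 1) * (N + 1) + N < length w" unfolding len by (simp add: algebra_simps)
    with v[of "Suc (f i)"] Suc show ?case unfolding f by auto
  qed
  show thesis
  proof (rule that[of f])
    fix i assume i: "i \<le> K"
    have "(i + 1) * (N + 1) \<le> (K + 2) * (N + 1)" using i by (intro mult_right_mono) auto
    thus "f i < length w \<and> fold M (take (f i) w) x \<in> Y" using b[OF i] unfolding len by linarith
  next
    fix i assume i: "i < K"
    have "(i + 3) * (N + 1) \<le> (K + 2) * (N + 1)" using i by (intro mult_right_mono) auto
    hence "(i + 1) * (N + 1) + N < length w" unfolding len by (simp add: algebra_simps)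
    with v[of "Suc (f i)"] b[of i] i show "f i < f (Suc i) \<and> f (Suc i) - f i \<le> N"
      unfolding f by auto
  qed
qed

text \<open>Dimension descent: if the hit-free words pass through a set covered by subspaces of
  dimension at most \<open>r\<close>, then they also pass through one covered by subspaces of smaller
  dimension.  A word avoiding the latter would move bijectively between the top-dimensional
  subspaces, hence run into a cycle among them, and there \<open>cycle_hits\<close> forces a hit.\<close>

lemma hitfree_bounded:
  assumes cycle_hits: "\<And>u q. u \<noteq> [] \<Longrightarrow> set u \<subseteq> Act \<Longrightarrow> subspace q \<Longrightarrow> fold M u ` q = q \<Longrightarrow>
      \<exists>b. \<forall>x\<in>R \<inter> q. \<exists>a<b. \<exists>p\<in>targets. fold M (pump u a) x \<in> p"
    and "passes_through Y N" "finite Q" "\<forall>q\<in>Q. dim_less r q" "Y \<subseteq> \<Union>Q" "Y \<subseteq> R"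
  shows "\<exists>N. \<forall>x\<in>R. \<forall>w. set w \<subseteq> Act \<and> length w = N \<longrightarrow> \<not> hitfree x w"
  using assms(2-)
proof (induction r arbitrary: Y N Q)
  case 0
  hence "Q = {}" unfolding dim_less_def by auto
  hence "Y = {}" using 0 by simp
  thus ?case using 0(1) unfolding passes_through_def by (intro exI[of _ N]) auto
next
  case (Suc r)
  obtain C where C: "finite C" "\<forall>q\<in>C. dim_less (Suc r) q" "Y \<subseteq> \<Union>C"
    and indec: "\<And>q S. q \<in> C \<Longrightarrow> \<not> dim_less r q \<Longrightarrow> finite S \<Longrightarrow> (\<forall>s\<in>S. subspace s \<and> s \<subseteq> q) \<Longrightarrow>
       Y \<inter> q \<subseteq> \<Union>S \<Longrightarrow> q \<in> S"
    using indecomposable_cover[OF Suc.prems(2-4)] by metis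
  define T where "T = {q\<in>C. \<not> dim_less r q}"
  have T: "finite T" "T \<subseteq> C" unfolding T_def using C by auto
  define W where "W = {w. set w \<subseteq> Act \<and> length w \<le> N}"
  have W: "finite W" unfolding W_def using finite_lists_length_le[OF finite_Act] by auto
  \<comment> \<open>The places of dimension below \<open>r\<close> where a word can leave the top
    level: low members of the cover, images of top members that lose dimension, and overlaps of an
    image with a different top member. They are finitely many because the words have length at most
    \<open>N\<close>.\<close>
  define Q1 where "Q1 = {q\<in>C. dim_less r q}"
  define Q2 where "Q2 = {s. \<exists>w\<in>W. \<exists>q\<in>T. s = fold M w ` q \<and> dim_less r s}"
  define Q3 where "Q3 = {s. \<exists>w\<in>W. \<exists>q\<in>T. \<exists>q'\<in>T. s = fold M w ` q \<inter> q' \<and> fold M w ` q \<noteq> q'}"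
  define Y' where "Y' = R \<inter> \<Union>(Q1 \<union> Q2 \<union> Q3)"
  have "Q2 \<subseteq> (\<lambda>(w, q). fold M w ` q) ` (W \<times> T)" unfolding Q2_def by auto
  hence Q2: "finite Q2" by (rule finite_subset) (use W T in simp)
  have "Q3 \<subseteq> (\<lambda>(w, q, q'). fold M w ` q \<inter> q') ` (W \<times> T \<times> T)"
  proof
    fix s assume "s \<in> Q3"
    then obtain w q q' where "w \<in> W" "q \<in> T" "q' \<in> T" "s = fold M w ` q \<inter> q'"
      unfolding Q3_def by blast
    thus "s \<in> (\<lambda>(w, q, q'). fold M w ` q \<inter> q') ` (W \<times> T \<times> T)"
      by (intro image_eqI[of _ _ "(w, q, q')"]) auto
  qed
  hence Q3: "finite Q3" by (rule finite_subset) (use W T in simp)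
  have fin: "finite (Q1 \<union> Q2 \<union> Q3)" using Q2 Q3 C unfolding Q1_def by simp
  have dims: "\<forall>q\<in>Q1 \<union> Q2 \<union> Q3. dim_less r q"
  proof -
    have "dim_less r s" if s3: "s \<in> Q3" for s
    proof -
      obtain w q q' where s: "w \<in> W" "q \<in> T" "q' \<in> T" "s = fold M w ` q \<inter> q'" "fold M w ` q \<noteq> q'"
        using s3 unfolding Q3_def by blast
      have i: "dim_less (Suc r) (fold M w ` q)"
        using s C T hom_fold[of w] unfolding W_def by (intro dim_less_image) auto
      have q': "dim_less (Suc r) q'" "\<not> dim_less r q'" using s C T unfolding T_def by auto
      have sub: "subspace s" using i q'(1) s(4) by (auto intro: subspace_inter dim_less_imp_subspace)
      \<comment> \<open>Otherwise \<open>q'\<close> would be a proper subspace of an image of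
        dimension at most \<open>r\<close>, although \<open>q'\<close> has dimension
        \<open>r\<close> itself.\<close>
      have "s \<noteq> q'"
      proof
        assume "s = q'"
        hence "q' \<subset> fold M w ` q" using s by auto
        thus False using dim_less_proper[OF i] q' dim_less_imp_subspace by blast
      qed
      thus ?thesis using s(4) by (intro dim_less_proper[OF q'(1) sub]) auto
    qed
    thus ?thesis unfolding Q1_def Q2_def by auto
  qed
  \<comment> \<open>\<open>K + 1\<close> visits to \<open>K\<close> top members: some member is
    visited twice, which closes the cycle.\<close>
  define K where "K = card T"
  have "passes_through Y' ((K + 2) * (N + 1))"
    unfolding passes_through_def
  proof (intro ballI allI impI, rule ccontr)
    fix x w assume x: "x \<in> R" and w: "set w \<subseteq> Act \<and> length w = (K + 2) * (N + 1) \<and> hitfree x w"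
      and no: "\<not> (\<exists>j<(K + 2) * (N + 1). fold M (take j w) x \<in> Y')"
    define st where "st j = fold M (take j w) x" for j
    have wA: "set (take i (drop j w)) \<subseteq> Act" for i j
      using w by (meson order_trans set_drop_subset set_take_subset)
    have stR: "st j \<in> R" for j unfolding st_def using wA[of j 0] x by (intro R_fold) auto
    obtain f where f: "\<And>i. i \<le> K \<Longrightarrow> f i < length w \<and> st (f i) \<in> Y"
      "\<And>i. i < K \<Longrightarrow> f i < f (Suc i) \<and> f (Suc i) - f i \<le> N"
    proof (rule passes_through_times[OF Suc.prems(1) x, of w K])
      fix f assume 1: "\<And>i. i \<le> K \<Longrightarrow> f i < length w \<and> fold M (take (f i) w) x \<in> Y"
        and 2: "\<And>i. i < K \<Longrightarrow> f i < f (Suc i) \<and> f (Suc i) - f i \<le> N"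
      show thesis
      proof (rule that[of f])
        fix i assume "i \<le> K"
        thus "f i < length w \<and> st (f i) \<in> Y" unfolding st_def by (rule 1)
      qed (rule 2)
    qed (use w in simp_all)
    have no': "st j \<notin> \<Union>(Q1 \<union> Q2 \<union> Q3)" if j: "j < length w" for j
    proof
      assume "st j \<in> \<Union>(Q1 \<union> Q2 \<union> Q3)"
      hence "st j \<in> Y'" unfolding Y'_def using stR by (rule IntI[rotated])
      moreover have "j < (K + 2) * (N + 1)" using j w by metis
      ultimately show False using no unfolding st_def by blast
    qed
    have "\<exists>q\<in>T. st (f i) \<in> q" if iK: "i \<le> K" for i
    proof -
      obtain q where "q \<in> C" "st (f i) \<in> q" using f(1)[OF iK] C(3) by blast
      thus ?thesis using no'[of "f i"] f(1)[OF iK] unfolding T_def Q1_def by auto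
    qed
    then obtain g where g: "\<And>i. i \<le> K \<Longrightarrow> g i \<in> T \<and> st (f i) \<in> g i" by metis
    define seg where "seg i j = take (j - i) (drop i w)" for i j
    have seg_st: "fold M (seg i j) (st i) = st j" if "i \<le> j" for i j
    proof -
      have "take j w = take i w @ seg i j" unfolding seg_def using that
        by (metis le_add_diff_inverse take_add)
      thus ?thesis unfolding st_def by simp
    qed
    \<comment> \<open>A word that avoids the overlaps carries each visited top member exactly onto
      the next one.\<close>
    have step: "fold M (seg (f i) (f (Suc i))) ` g i = g (Suc i)" if iK: "i < K" for i
    proof (rule ccontr)
      assume ne: "fold M (seg (f i) (f (Suc i))) ` g i \<noteq> g (Suc i)"
      have sW: "seg (f i) (f (Suc i)) \<in> W" unfolding W_def seg_def using f(2)[OF iK] wA by auto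
      have "fold M (seg (f i) (f (Suc i))) (st (f i)) = st (f (Suc i))"
        using f(2)[OF iK] by (intro seg_st) simp
      hence "st (f (Suc i)) \<in> fold M (seg (f i) (f (Suc i))) ` g i"
        using g[of i] iK by (metis imageI less_imp_le_nat)
      moreover have "g i \<in> T" "g (Suc i) \<in> T" "st (f (Suc i)) \<in> g (Suc i)"
        using g[of i] g[of "Suc i"] iK by auto
      ultimately have "st (f (Suc i)) \<in> \<Union>Q3"
        using sW ne unfolding Q3_def by blast
      thus False using no'[of "f (Suc i)"] f(1)[of "Suc i"] iK by auto
    qed
    have f_mono: "i \<le> j \<Longrightarrow> j \<le> K \<Longrightarrow> f i \<le> f j" for i j
    proof (induction j)
      case (Suc j)
      thus ?case using f(2)[of j] by (cases "i = Suc j") auto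
    qed simp
    have steps: "i \<le> j \<Longrightarrow> j \<le> K \<Longrightarrow> fold M (seg (f i) (f j)) ` g i = g j" for i j
    proof (induction j)
      case 0 thus ?case by (simp add: seg_def)
    next
      case (Suc j)
      show ?case
      proof (cases "i = Suc j")
        case True thus ?thesis by (simp add: seg_def)
      next
        case False
        hence ij: "i \<le> j" "j < K" using Suc by auto
        have le: "f i \<le> f j" "f j \<le> f (Suc j)" using f_mono[of i j] f_mono[of j "Suc j"] ij by auto
        have eq: "f (Suc j) - f i = (f j - f i) + (f (Suc j) - f j)" using le by simp
        hence "seg (f i) (f (Suc j)) = seg (f i) (f j) @ seg (f j) (f (Suc j))"
          unfolding seg_def eq take_add drop_drop using le by simp
        hence "fold M (seg (f i) (f (Suc j))) ` g i =
            fold M (seg (f j) (f (Suc j))) ` (fold M (seg (f i) (f j)) ` g i)"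
          by (simp add: image_comp comp_def)
        also have "\<dots> = g (Suc j)" using Suc.IH step ij by simp
        finally show ?thesis .
      qed
    qed
    have "card (g ` {0..K}) \<le> K" unfolding K_def using g T by (intro card_mono) (auto simp: K_def)
    hence "\<not> inj_on g {0..K}" using card_image by fastforce
    then obtain i j where ij: "i < j" "j \<le> K" "g i = g j"
      unfolding inj_on_def by (metis atLeastAtMost_iff nat_neq_iff)
    define u where "u = seg (f i) (f j)"
    define q where "q = g i"
    have qT: "q \<in> C" "\<not> dim_less r q" "st (f i) \<in> q" unfolding q_def using g[of i] ij T
      by (auto simp: T_def)
    have flt: "f i < f j" using f(2)[of i] f_mono[of "Suc i" j] ij by auto
    have lu: "length u = f j - f i" "u \<noteq> []"
      using flt f(1)[of j] ij unfolding u_def seg_def by auto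
    have uA: "set u \<subseteq> Act" unfolding u_def seg_def using wA by blast
    have uq: "fold M u ` q = q" unfolding u_def q_def using steps[of i j] ij by simp
    have sq: "subspace q" using qT C dim_less_imp_subspace by blast
    obtain b where b: "\<forall>x\<in>R \<inter> q. \<exists>a<b. \<exists>p\<in>targets. fold M (pump u a) x \<in> p"
      using cycle_hits[OF lu(2) uA sq uq] by blast
    \<comment> \<open>Since \<open>b\<close> is uniform in the vector, these finitely many preimages
      of targets cover \<open>Y \<inter> q\<close>, and indecomposability makes one of them all of
      \<open>q\<close>.\<close>
    define S where "S = (\<lambda>(a, p). {x\<in>q. fold M (pump u a) x \<in> p}) ` ({..<b} \<times> targets)"
    have "finite S" unfolding S_def using finite_targets by simp
    moreover have "\<forall>s\<in>S. subspace s \<and> s \<subseteq> q"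
    proof
      fix s assume "s \<in> S"
      then obtain a p where s: "p \<in> targets" "s = {x\<in>q. fold M (pump u a) x \<in> p}"
        unfolding S_def by auto
      have h: "module_hom scale scale (fold M (pump u a))"
        using set_pump[OF lu(2)] uA by (intro hom_fold) blast
      have "s = q \<inter> {x. fold M (pump u a) x \<in> p}" unfolding s by auto
      thus "subspace s \<and> s \<subseteq> q"
        using subspace_inter[OF sq] module_hom.subspace_linear_preimage[OF h target_subspace[OF s(1)]]
        by auto
    qed
    moreover have "Y \<inter> q \<subseteq> \<Union>S"
    proof
      fix y assume y: "y \<in> Y \<inter> q"
      then obtain a p where ap: "a < b" "p \<in> targets" "fold M (pump u a) y \<in> p"
        using b Suc.prems(5) by blast
      have "{x\<in>q. fold M (pump u a) x \<in> p} \<in> S"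
        unfolding S_def using ap by (intro image_eqI[of _ _ "(a, p)"]) auto
      thus "y \<in> \<Union>S" using y ap(3) by blast
    qed
    ultimately have "q \<in> S" using indec[OF qT(1,2)] by blast
    then obtain a p where p: "p \<in> targets" "q = {x\<in>q. fold M (pump u a) x \<in> p}"
      unfolding S_def by auto
    hence ap: "fold M (pump u a) ` q \<subseteq> p" by blast
    \<comment> \<open>Reducing the time to its phase places the hit inside the segment
      \<open>u\<close> of the word \<open>w\<close>, which was assumed hit-free.\<close>
    define a' where "a' = a mod length u"
    have a': "a' < length u" unfolding a'_def using lu(2) by simp
    have "fold M (take a' u) (st (f i)) \<in> p"
      using ap qT(3) unfolding fold_pump_image[OF lu(2) uq] a'_def by blast
    moreover have "take a' u = seg (f i) (f i + a')"
      unfolding u_def seg_def using a' lu by (simp add: min_def)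
    ultimately have "st (f i + a') \<in> p" using seg_st[of "f i" "f i + a'"] by simp
    moreover have "f j < length w" using f(1)[OF ij(2)] by blast
    hence "f i + a' < length w" using a' lu(1) flt by linarith
    ultimately show False using w p(1) unfolding hitfree_def st_def by blast
  qed
  thus ?case using Suc.IH[OF _ fin dims, of Y'] unfolding Y'_def by blast
qed

end

section \<open>Integer linear systems\<close>

text \<open>Fraction-free Gaussian elimination: coordinate \<open>a\<close> is cleared with the
  pivot vector \<open>j0\<close>, and cross-multiplication keeps all coefficients integral.\<close>

lemma int_dependence:
  fixes v :: "'j \<Rightarrow> 'i \<Rightarrow> int"
  assumes "finite I" "finite J" "card I < card J"
  shows "\<exists>c. (\<exists>j\<in>J. c j \<noteq> 0) \<and> (\<forall>i\<in>I. (\<Sum>j\<in>J. c j * v j i) = 0)"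
  using assms
proof (induction I arbitrary: J v rule: finite_induct)
  case empty
  hence "J \<noteq> {}" by auto
  thus ?case by (intro exI[of _ "\<lambda>_. 1"]) auto
next
  case (insert a I)
  show ?case
  proof (cases "\<forall>j\<in>J. v j a = 0")
    case True
    have "card I < card J" using insert by simp
    then obtain c where "\<exists>j\<in>J. c j \<noteq> 0" "\<forall>i\<in>I. (\<Sum>j\<in>J. c j * v j i) = 0"
      using insert.IH[OF insert.prems(1), of v] by blast
    thus ?thesis using True by (intro exI[of _ c]) auto
  next
    case False
    then obtain j0 where j0: "j0 \<in> J" "v j0 a \<noteq> 0" by blast
    define J' where "J' = J - {j0}"
    have J: "J = insert j0 J'" "j0 \<notin> J'" "finite J'" using j0 insert.prems unfolding J'_def by auto
    define v' where "v' j i = v j0 a * v j i - v j a * v j0 i" for j i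
    have "card I < card J'" using insert J by simp
    then obtain c where c: "\<exists>j\<in>J'. c j \<noteq> 0" "\<forall>i\<in>I. (\<Sum>j\<in>J'. c j * v' j i) = 0"
      using insert.IH[of J' v'] J by blast
    define d where "d j = (if j = j0 then - (\<Sum>j\<in>J'. c j * v j a) else v j0 a * c j)" for j
    have "(\<Sum>j\<in>J. d j * v j i) = (\<Sum>j\<in>J'. c j * v' j i)" for i
    proof -
      have "(\<Sum>j\<in>J. d j * v j i) = d j0 * v j0 i + (\<Sum>j\<in>J'. d j * v j i)"
        unfolding J(1) using J by simp
      also have "(\<Sum>j\<in>J'. d j * v j i) = (\<Sum>j\<in>J'. v j0 a * c j * v j i)"
        using J by (intro sum.cong) (auto simp: d_def)
      also have "d j0 * v j0 i = - (\<Sum>j\<in>J'. c j * v j a * v j0 i)"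
        unfolding d_def by (simp add: sum_distrib_right)
      finally show ?thesis
        unfolding v'_def by (simp add: algebra_simps sum_subtractf)
    qed
    moreover have "(\<Sum>j\<in>J'. c j * v' j a) = 0"
      unfolding v'_def by (intro sum.neutral) (auto simp: algebra_simps)
    moreover have "\<exists>j\<in>J. d j \<noteq> 0" using c(1) j0 J unfolding d_def by auto
    ultimately show ?thesis using c(2) by (intro exI[of _ d]) auto
  qed
qed

lemma infinite_residue_class:
  fixes b :: nat
  assumes "infinite {n. \<exists>t<(T::nat). P t n}" "b > 0"
  shows "\<exists>a<b. \<exists>t<T. infinite {n. P t (a + b * n)}"
proof (rule ccontr)
  assume no: "\<not> ?thesis"
  have "{n. \<exists>t<T. P t n} \<subseteq> (\<Union>a<b. \<Union>t<T. (\<lambda>n. a + b * n) ` {n. P t (a + b * n)})"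
  proof
    fix n assume "n \<in> {n. \<exists>t<T. P t n}"
    then obtain t where t: "t < T" "P t n" by blast
    have "n = n mod b + b * (n div b)" "n mod b < b" using assms(2) by auto
    thus "n \<in> (\<Union>a<b. \<Union>t<T. (\<lambda>n. a + b * n) ` {n. P t (a + b * n)})"
      using t by (intro UN_I[of "n mod b"] UN_I[of t] image_eqI[of _ _ "n div b"]) auto
  qed
  moreover have "finite (\<Union>a<b. \<Union>t<T. (\<lambda>n. a + b * n) ` {n. P t (a + b * n)})"
    using no by auto
  ultimately show False using assms(1) finite_subset by blast
qed

lemma sum_dvd_stride:
  fixes l :: nat and f :: "nat \<Rightarrow> 'a::comm_monoid_add"
  assumes "l > 0"
  shows "(\<Sum>k\<le>m * l. if l dvd k then f (k div l) else 0) = (\<Sum>k\<le>m. f k)"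
proof -
  have "(\<Sum>k\<le>m * l. if l dvd k then f (k div l) else 0) = (\<Sum>k\<in>{k\<in>{..m * l}. l dvd k}. f (k div l))"
    by (rule sum.inter_filter[symmetric]) simp
  also have "\<dots> = (\<Sum>k\<le>m. f k)"
    using assms by (intro sum.reindex_bij_witness[of _ "\<lambda>k. k * l" "\<lambda>k. k div l"])
      (auto simp: div_le_mono elim!: dvdE)
  finally show ?thesis .
qed

text \<open>The coefficients of c(X^l): a relation between terms at distance \<open>l\<close>
  becomes an ordinary recurrence of order \<open>m * l\<close>.\<close>

definition strided :: "nat \<Rightarrow> (nat \<Rightarrow> int) \<Rightarrow> nat \<Rightarrow> int" where
  "strided l c k = (if l dvd k then c (k div l) else 0)"

lemma sum_strided:
  assumes "l > 0"
  shows "(\<Sum>k\<le>m * l. strided l c k * y k) = (\<Sum>k\<le>m. c k * y (k * l))"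
proof -
  have "(\<Sum>k\<le>m * l. strided l c k * y k) = (\<Sum>k\<le>m * l. if l dvd k then c (k div l) * y (k div l * l) else 0)"
    unfolding strided_def by (intro sum.cong) auto
  thus ?thesis using sum_dvd_stride[OF assms, where m = m and f = "\<lambda>k. c k * y (k * l)"] by simp
qed

text \<open>An ultimately periodic word with stem length \<open>s\<close> and loop length
  \<open>l\<close>; for l > 0 it depends on finitely many values of \<open>f\<close>.\<close>

definition lasso :: "(nat \<Rightarrow> nat) \<Rightarrow> nat \<Rightarrow> nat \<Rightarrow> nat \<Rightarrow> nat" where
  "lasso f s l t = f (if t < s + l then t else s + (t - s) mod l)"

lemma lasso_add: "l > 0 \<Longrightarrow> lasso f s l (s + t) = f (s + t mod l)"
  unfolding lasso_def by simp

lemma sum_mult_swap: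
  fixes g :: "nat \<Rightarrow> 'a::comm_semiring_0"
  shows "(\<Sum>l<D. g l * (\<Sum>n<D. e l n * y n)) = (\<Sum>n<D. (\<Sum>l<D. g l * e l n) * y n)"
  unfolding sum_distrib_left sum_distrib_right mult.assoc by (rule sum.swap)

text \<open>\<open>k\<close> letters, dimension \<open>D\<close>, \<open>T\<close> target subspaces, the \<open>t\<close>-th being the kernel of the
  matrix \<open>K t\<close>.\<close>

locale int_system =
  fixes k D T :: nat and A :: "nat \<Rightarrow> nat \<Rightarrow> nat \<Rightarrow> int" and x0 :: "nat \<Rightarrow> int"
    and K :: "nat \<Rightarrow> nat \<Rightarrow> nat \<Rightarrow> int"
begin

text \<open>The ring is left open: orbits are computed over the integers, while the dimension
  argument needs rational vectors.\<close>

definition step :: "nat \<Rightarrow> (nat \<Rightarrow> 'r::comm_ring_1) \<Rightarrow> nat \<Rightarrow> 'r" where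
  "step a x = (\<lambda>i. if i < D then \<Sum>j<D. of_int (A a i j) * x j else 0)"

definition start :: "nat \<Rightarrow> int" where
  "start i = (if i < D then x0 i else 0)"

definition in_target :: "nat \<Rightarrow> (nat \<Rightarrow> 'r::comm_ring_1) \<Rightarrow> bool" where
  "in_target t x \<longleftrightarrow> (\<forall>i<D. (\<Sum>j<D. of_int (K t i j) * x j) = 0)"

definition hit :: "(nat \<Rightarrow> 'r::comm_ring_1) \<Rightarrow> bool" where
  "hit x \<longleftrightarrow> (\<exists>t<T. in_target t x)"

definition state :: "(nat \<Rightarrow> nat) \<Rightarrow> nat \<Rightarrow> nat \<Rightarrow> int" where
  "state \<omega> n = fold step (map \<omega> [0..<n]) start"

definition valid :: bool where
  "valid \<longleftrightarrow> (\<forall>\<omega>. (\<forall>n. \<omega> n < k) \<longrightarrow> infinite {n. hit (state \<omega> n)})"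

definition word :: "nat list \<Rightarrow> bool" where
  "word w \<longleftrightarrow> set w \<subseteq> {..<k}"

definition supported :: "(nat \<Rightarrow> 'r::comm_ring_1) \<Rightarrow> bool" where
  "supported x \<longleftrightarrow> (\<forall>i\<ge>D. x i = 0)"

text \<open>The images of the unit vectors, hence the matrix of the whole word; its entries are
  integers whatever ring the vectors live in.\<close>

definition entry :: "nat list \<Rightarrow> nat \<Rightarrow> nat \<Rightarrow> int" where
  "entry w i j = fold step w (\<lambda>l. if l = j then 1 else 0) i"

lemma supported_start: "supported start"
  unfolding supported_def start_def by auto

lemma supported_step: "supported (step a x)"
  unfolding supported_def step_def by auto

lemma supported_fold: "supported x \<Longrightarrow> supported (fold step w x)"
  by (induction w arbitrary: x) (auto simp: supported_step)

lemma supported_fold_nonempty: "w \<noteq> [] \<Longrightarrow> supported (fold step w x)"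
  by (cases w) (auto intro: supported_fold supported_step)

lemma fold_entry:
  assumes "supported x" "i < D"
  shows "fold step w x i = (\<Sum>j<D. of_int (entry w i j) * x j)"
  using assms(2)
proof (induction w arbitrary: i rule: rev_induct)
  case Nil
  have "(\<Sum>j<D. of_int (entry [] i j) * x j) = (\<Sum>j<D. if j = i then x j else 0)"
    by (intro sum.cong) (auto simp: entry_def)
  thus ?case using Nil by simp
next
  case (snoc a w)
  have "fold step (w @ [a]) x i = (\<Sum>l<D. of_int (A a i l) * fold step w x l)"
    using snoc.prems by (simp add: step_def)
  also have "\<dots> = (\<Sum>l<D. \<Sum>j<D. of_int (A a i l * entry w l j) * x j)"
    by (intro sum.cong) (auto simp: snoc.IH sum_distrib_left mult.assoc)
  also have "\<dots> = (\<Sum>j<D. of_int (\<Sum>l<D. A a i l * entry w l j) * x j)"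
    by (subst sum.swap) (simp add: sum_distrib_right)
  also have "\<dots> = (\<Sum>j<D. of_int (entry (w @ [a]) i j) * x j)"
    using snoc.prems by (simp add: entry_def step_def)
  finally show ?case .
qed

lemma fold_of_int: "fold step w (\<lambda>i. of_int (x i)) = (\<lambda>i. of_int (fold step w x i))"
proof (induction w arbitrary: x)
  case (Cons a w)
  have "step a (\<lambda>i. of_int (x i) :: 'a) = (\<lambda>i. of_int (step a x i))"
    unfolding step_def by auto
  thus ?case using Cons by simp
qed simp

lemma in_target_of_int:
  "in_target t (\<lambda>i. of_int (x i) :: 'r::{comm_ring_1, ring_char_0}) \<longleftrightarrow> in_target t x"
proof -
  have "(\<Sum>j<D. of_int (K t i j) * of_int (x j)) = (of_int (\<Sum>j<D. K t i j * x j) :: 'r)" for i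
    by simp
  thus ?thesis unfolding in_target_def by (simp only: of_int_eq_0_iff of_int_eq_id id_apply)
qed

lemma fold_linear_combination:
  assumes "\<And>k. k \<le> m \<Longrightarrow> supported (z k)" "\<And>i. i < D \<Longrightarrow> (\<Sum>k\<le>m. c k * z k i) = 0"
  shows "(\<Sum>k\<le>m. c k * fold step w (z k) i) = 0"
proof (cases "i < D")
  case True
  have "(\<Sum>k\<le>m. c k * fold step w (z k) i) = (\<Sum>k\<le>m. c k * (\<Sum>j<D. of_int (entry w i j) * z k j))"
    using assms(1) True by (intro sum.cong) (auto simp: fold_entry)
  also have "\<dots> = (\<Sum>j<D. \<Sum>k\<le>m. of_int (entry w i j) * (c k * z k j))"
    by (subst sum.swap) (simp add: sum_distrib_left algebra_simps)
  also have "\<dots> = 0"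
    using assms(2) by (simp add: sum_distrib_left[symmetric])
  finally show ?thesis .
next
  case False
  hence "fold step w (z k) i = 0" if "k \<le> m" for k
    using supported_fold[OF assms(1)[OF that], of w] unfolding supported_def by simp
  thus ?thesis by simp
qed

section \<open>Orbits of ultimately periodic words\<close>

text \<open>The powers of the matrix of \<open>u\<close> with exponents 0 to D^2 are dependent over
  the integers. The relation is trimmed to nonzero end coefficients; its lowest exponent
  \<open>e\<close> has to stay, since the matrix may be singular.\<close>

lemma annihilator:
  obtains m e and c :: "nat \<Rightarrow> int" where "c 0 \<noteq> 0" "c m \<noteq> 0"
    "\<And>x i. supported (x :: nat \<Rightarrow> 'r::comm_ring_1) \<Longrightarrow> i < D \<Longrightarrow>
       (\<Sum>k\<le>m. of_int (c k) * fold step (concat (replicate (e + k) u)) x i) = 0"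
proof -
  define P where "P n = concat (replicate n u)" for n
  have "\<exists>c. (\<exists>j\<in>{..D * D}. c j \<noteq> 0) \<and>
      (\<forall>i\<in>{..<D} \<times> {..<D}. (\<Sum>j\<in>{..D * D}. c j * (case i of (i, l) \<Rightarrow> entry (P j) i l)) = 0)"
    by (rule int_dependence) (auto simp: card_cartesian_product)
  then obtain c where c: "\<exists>j\<in>{..D * D}. c j \<noteq> 0"
    "\<And>i l. i < D \<Longrightarrow> l < D \<Longrightarrow> (\<Sum>j\<le>D * D. c j * entry (P j) i l) = 0" by force
  define S where "S = {j. j \<le> D * D \<and> c j \<noteq> 0}"
  have S: "finite S" "S \<noteq> {}" unfolding S_def using c(1) by auto
  define e m where "e = Min S" and "m = Max S - e"
  have em: "e \<in> S" "e + m \<in> S" "\<And>j. j \<in> S \<Longrightarrow> e \<le> j \<and> j \<le> e + m"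
    unfolding e_def m_def using S by auto
  have "(\<Sum>k\<le>m. of_int (c (e + k)) * fold step (P (e + k)) x i) = 0"
    if x: "supported (x :: nat \<Rightarrow> 'r)" and i: "i < D" for x i
  proof -
    have "(\<Sum>k\<le>m. of_int (c (e + k)) * fold step (P (e + k)) x i) =
        (\<Sum>j\<in>{e..e + m}. of_int (c j) * fold step (P j) x i)"
      by (rule sum.reindex_bij_witness[of _ "\<lambda>j. j - e" "\<lambda>k. e + k"]) auto
    also have "\<dots> = (\<Sum>j\<le>D * D. of_int (c j) * fold step (P j) x i)"
    proof (rule sum.mono_neutral_left)
      show "{e..e + m} \<subseteq> {..D * D}" using em(2) unfolding S_def by auto
      show "\<forall>j\<in>{..D * D} - {e..e + m}. of_int (c j) * fold step (P j) x i = 0"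
      proof
        fix j assume j: "j \<in> {..D * D} - {e..e + m}"
        hence "c j = 0" using em(3)[of j] unfolding S_def by auto
        thus "of_int (c j) * fold step (P j) x i = 0" by simp
      qed
    qed simp
    also have "\<dots> = (\<Sum>j\<le>D * D. of_int (c j) * (\<Sum>l<D. of_int (entry (P j) i l) * x l))"
      using x i by (simp add: fold_entry)
    also have "\<dots> = (\<Sum>l<D. of_int (\<Sum>j\<le>D * D. c j * entry (P j) i l) * x l)"
      by (simp add: sum_distrib_left sum_distrib_right sum.swap[of _ "{..D * D}"] mult.assoc)
    also have "\<dots> = 0" using c(2) i by simp
    finally show ?thesis .
  qed
  moreover have "c (e + 0) \<noteq> 0" "c (e + m) \<noteq> 0" using em unfolding S_def by auto
  ultimately show thesis using that[of "\<lambda>k. c (e + k)" m e] unfolding P_def by blast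
qed

text \<open>Lying in a target means that \<open>D\<close> scalar sequences vanish together; they
  share the coefficients \<open>c\<close> and therefore the period.\<close>

lemma recurrence_target_zeros:
  fixes x :: "nat \<Rightarrow> nat \<Rightarrow> int"
  assumes rec: "\<And>n i. i < D \<Longrightarrow> (\<Sum>j\<le>m. c j * x (n + j) i) = 0" and c: "c 0 \<noteq> 0" "c m \<noteq> 0"
    and inf: "infinite {n. in_target t (x (a + zero_period m c * n))}"
  shows "in_target t (x (a + zero_period m c * n))"
  unfolding in_target_def
proof (intro allI impI)
  fix i assume i: "i < D"
  define z where "z n = (\<Sum>j<D. K t i j * x n j)" for n
  have "satisfies_recurrence m c z"
    unfolding satisfies_recurrence_def
  proof
    fix n
    have "(\<Sum>l\<le>m. c l * z (n + l)) = (\<Sum>j<D. K t i j * (\<Sum>l\<le>m. c l * x (n + l) j))"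
      unfolding z_def by (simp add: sum_distrib_left sum.swap[of _ "{..m}"] algebra_simps)
    also have "\<dots> = 0" using rec by simp
    finally show "(\<Sum>l\<le>m. c l * z (n + l)) = 0" .
  qed
  moreover have "infinite {n. z (a + zero_period m c * n) = 0}"
    using inf by (rule infinite_super[rotated]) (use i in \<open>auto simp: in_target_def z_def\<close>)
  ultimately have "z (a + zero_period m c * n) = 0" using recurrence_zeros c by blast
  thus "(\<Sum>j<D. of_int (K t i j) * x (a + zero_period m c * n) j) = 0" unfolding z_def by simp
qed

lemma zero_period_pos: "zero_period m c > 0"
  unfolding zero_period_def by simp

lemma pump_replicate:
  assumes "u \<noteq> []" shows "pump u (n * length u + a) = concat (replicate n u) @ pump u a"
  by (induction n) (simp_all add: add.assoc pump_add[OF assms])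

lemma fold_concat_replicate_image:
  "fold M u ` q = q \<Longrightarrow> fold M (concat (replicate n u)) ` q = q"
proof (induction n)
  case (Suc n)
  have "fold M (concat (replicate (Suc n) u)) ` q = fold M (concat (replicate n u)) ` (fold M u ` q)"
    by (simp add: image_comp comp_def)
  thus ?case using Suc by simp
qed simp

definition bounded_hits :: "nat \<Rightarrow> bool" where
  "bounded_hits N \<longleftrightarrow> (\<forall>v w. word v \<and> word w \<and> length w = N \<longrightarrow>
     (\<exists>j<N. hit (fold step (v @ take j w) start)))"

lemma word_append: "word (v @ w) \<longleftrightarrow> word v \<and> word w"
  unfolding word_def by auto

lemma word_take: "word w \<Longrightarrow> word (take j w)"
  unfolding word_def by (meson order_trans set_take_subset)

lemma word_drop: "word w \<Longrightarrow> word (drop j w)"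
  unfolding word_def by (meson order_trans set_drop_subset)

lemma word_map_upt: "(\<And>n. \<omega> n < k) \<Longrightarrow> word (map \<omega> [i..<j])"
  unfolding word_def by auto

lemma bounded_hits_imp_valid:
  assumes "bounded_hits N" shows valid
  unfolding valid_def
proof (intro allI impI)
  fix \<omega> :: "nat \<Rightarrow> nat" assume \<omega>: "\<forall>n. \<omega> n < k"
  show "infinite {n. hit (state \<omega> n)}"
    unfolding infinite_nat_iff_unbounded_le
  proof
    fix n
    let ?w = "map \<omega> [n..<n + N]"
    have "word (map \<omega> [0..<n])" "word ?w" "length ?w = N"
      using \<omega> by (simp_all add: word_map_upt)
    then obtain j where j: "j < N" "hit (fold step (map \<omega> [0..<n] @ take j ?w) start)"
      using assms unfolding bounded_hits_def by blast
    have "take j ?w = map \<omega> [n..<n + j]" using j(1) by (simp add: take_map)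
    hence "map \<omega> [0..<n] @ take j ?w = map \<omega> [0..<n + j]"
      by (metis le_add1 map_append upt_add_eq_append zero_le)
    thus "\<exists>j\<ge>n. j \<in> {n. hit (state \<omega> n)}"
      using j(2) unfolding state_def by (intro exI[of _ "n + j"]) simp
  qed
qed

definition vscale :: "rat \<Rightarrow> (nat \<Rightarrow> rat) \<Rightarrow> nat \<Rightarrow> rat" where
  "vscale c f = (\<lambda>i. c * f i)"

lemma vector_space_vscale: "vector_space vscale"
  by unfold_locales (auto simp: vscale_def fun_eq_iff algebra_simps)

definition reachable :: "(nat \<Rightarrow> rat) set" where
  "reachable = {\<lambda>i. of_int (fold step v start i) | v. word v}"

definition target_sets :: "(nat \<Rightarrow> rat) set set" where
  "target_sets = (\<lambda>t. {x. in_target t x}) ` {..<T}"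

lemma linear_system_reachable: "linear_system vscale {..<k} step target_sets reachable"
proof -
  interpret vector_space vscale by (rule vector_space_vscale)
  have sub: "subspace {x. in_target t x}" for t
    by (rule subspaceI)
      (auto simp: in_target_def vscale_def algebra_simps sum.distrib sum_distrib_left[symmetric])
  have cl: "step a x \<in> reachable" if a: "a \<in> {..<k}" and x: "x \<in> reachable" for a x
  proof -
    obtain v where v: "word v" "x = (\<lambda>i. of_int (fold step v start i))"
      using x unfolding reachable_def by blast
    have "step a x = (\<lambda>i. of_int (fold step (v @ [a]) start i))"
      unfolding v fold_append comp_apply fold_of_int[of "[a]", simplified] by simp
    moreover have "word (v @ [a])" using v a by (simp add: word_def)
    ultimately show ?thesis unfolding reachable_def by blast
  qed
  have add: "step a (x + y) = step a x + step a y" for a and x y :: "nat \<Rightarrow> rat"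
    unfolding step_def by (auto simp: fun_eq_iff algebra_simps sum.distrib)
  have scale: "step a (vscale r x) = vscale r (step a x)" for a r x
    unfolding step_def vscale_def by (auto simp: fun_eq_iff algebra_simps sum_distrib_left)
  show ?thesis
    using cl by unfold_locales (auto simp: target_sets_def sub add scale)
qed

definition periodic_hits :: bool where
  "periodic_hits \<longleftrightarrow> (\<forall>v u. word v \<and> word u \<and> u \<noteq> [] \<longrightarrow>
     infinite {a. hit (fold step (v @ pump u a) start)})"

text \<open>As \<open>u\<close> maps \<open>q\<close> onto itself, each of its vectors is an image
  under u^e of a vector in \<open>q\<close>, so the annihilating relation holds without the offset
  \<open>e\<close>. The period then depends on \<open>u\<close> alone.\<close>

lemma cycle_hits:
  assumes per: periodic_hits and u: "word u" "u \<noteq> []" and q: "fold step u ` q = q"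
  shows "\<exists>b. \<forall>x\<in>reachable \<inter> q. \<exists>a<b. \<exists>p\<in>target_sets. fold step (pump u a) x \<in> p"
proof -
  obtain m e and c :: "nat \<Rightarrow> int" where c: "c 0 \<noteq> 0" "c m \<noteq> 0"
    and ann: "\<And>x i. supported (x :: nat \<Rightarrow> rat) \<Longrightarrow> i < D \<Longrightarrow>
       (\<Sum>k\<le>m. of_int (c k) * fold step (concat (replicate (e + k) u)) x i) = 0"
    by (rule annihilator[where u = u and ?'r = rat]) (rule that)
  define l where "l = length u"
  have l: "l > 0" unfolding l_def using u by simp
  define b where "b = zero_period (m * l) (strided l c)"
  have "\<exists>a<b. \<exists>p\<in>target_sets. fold step (pump u a) x \<in> p" if x: "x \<in> reachable \<inter> q" for x
  proof -
    obtain v where v: "word v" "x = (\<lambda>i. of_int (fold step v start i))"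
      using x unfolding reachable_def by blast
    define y where "y t = fold step (v @ pump u t) start" for t
    have y: "(of_int (y t i) :: rat) = fold step (pump u t) x i" for t i
      unfolding y_def v fold_of_int by simp
    have sup: "supported x" if "x \<in> q" for x
      using that q supported_fold_nonempty[OF u(2)] by (metis imageE)
    have rel: "(\<Sum>k\<le>m. of_int (c k) * fold step (concat (replicate k u)) x i) = 0" if "i < D" for i
    proof -
      have "x \<in> fold step (concat (replicate e u)) ` q"
        using x fold_concat_replicate_image[OF q] by blast
      then obtain x' where x': "x' \<in> q" "x = fold step (concat (replicate e u)) x'" by blast
      show ?thesis using ann[OF sup[OF x'(1)] that] unfolding x'(2) by (simp add: replicate_add)
    qed
    have rec: "(\<Sum>j\<le>m * l. strided l c j * y (n + j) i) = 0" if "i < D" for n i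
    proof -
      have "(of_int (\<Sum>j\<le>m * l. strided l c j * y (n + j) i) :: rat) =
          (\<Sum>j\<le>m. of_int (c j) * of_int (y (n + j * l) i))"
        unfolding sum_strided[OF l] by simp
      also have "\<dots> = (\<Sum>j\<le>m. of_int (c j) * fold step (pump u n) (fold step (concat (replicate j u)) x) i)"
        unfolding y l_def by (simp add: add.commute[of n] pump_replicate[OF u(2)])
      also have "\<dots> = 0"
        using rel sup x by (intro fold_linear_combination supported_fold) auto
      finally show ?thesis by (simp only: of_int_eq_0_iff)
    qed
    have "infinite {t. \<exists>\<tau><T. in_target \<tau> (y t)}"
      using per v(1) u unfolding periodic_hits_def y_def hit_def by blast
    then obtain a \<tau> where a: "a < b" "\<tau> < T" "infinite {n. in_target \<tau> (y (a + b * n))}"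
      using infinite_residue_class zero_period_pos unfolding b_def by meson
    \<comment> \<open>A class with infinitely many hits of one target hits it throughout, in
      particular at its first member, which lies before \<open>b\<close>.\<close>
    have "in_target \<tau> (y (a + b * 0))"
      using rec a(3) l c unfolding b_def
      by (intro recurrence_target_zeros[where c = "strided l c" and m = "m * l"]) (auto simp: strided_def)
    hence "in_target \<tau> (fold step (pump u a) x)"
      using in_target_of_int[of \<tau> "y a", where ?'r = rat] unfolding y by simp
    thus ?thesis using a unfolding target_sets_def by blast
  qed
  thus ?thesis by blast
qed

text \<open>The descent starts from all reachable vectors, which every word visits at time 0,
  covered by the single coordinate space of dimension \<open>D\<close>.\<close>

lemma periodic_hits_imp_bounded_hits:
  assumes periodic_hits shows "\<exists>N. bounded_hits N"
proof -
  interpret ls: linear_system vscale "{..<k}" step target_sets reachable by (rule linear_system_reachable)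
  define q where "q = {x :: nat \<Rightarrow> rat. supported x}"
  define B where "B = (\<lambda>j i. if i = j then 1 else 0 :: rat) ` {..<D}"
  have "q = ls.span B"
  proof
    show "q \<subseteq> ls.span B"
    proof
      fix x assume x: "x \<in> q"
      have "x = (\<Sum>j<D. vscale (x j) (\<lambda>i. if i = j then 1 else 0))"
      proof
        fix i
        have "(\<Sum>j<D. vscale (x j) (\<lambda>i. if i = j then 1 else 0)) i = (\<Sum>j<D. if j = i then x j else 0)"
          by (induction D) (auto simp: vscale_def zero_fun_def)
        also have "\<dots> = x i" using x unfolding q_def supported_def by simp
        finally show "x i = (\<Sum>j<D. vscale (x j) (\<lambda>i. if i = j then 1 else 0)) i" ..
      qed
      moreover have "(\<Sum>j<D. vscale (x j) (\<lambda>i. if i = j then 1 else 0)) \<in> ls.span B"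
        by (intro ls.span_sum ls.span_scale ls.span_base) (auto simp: B_def)
      ultimately show "x \<in> ls.span B" by simp
    qed
    have "ls.subspace q"
      by (rule ls.subspaceI) (auto simp: q_def supported_def vscale_def)
    moreover have "B \<subseteq> q" unfolding B_def q_def supported_def by auto
    ultimately show "ls.span B \<subseteq> q" by (rule ls.span_minimal[rotated])
  qed
  moreover have "card B < Suc D" unfolding B_def using card_image_le[of "{..<D}"] by (simp add: less_Suc_eq_le)
  moreover have "finite B" unfolding B_def by simp
  ultimately have dim: "ls.dim_less (Suc D) q" unfolding ls.dim_less_def by blast
  have "ls.passes_through reachable 1" unfolding ls.passes_through_def by auto
  moreover have "reachable \<subseteq> \<Union>{q}"
    using supported_fold[OF supported_start] unfolding reachable_def q_def by (auto simp: supported_def)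
  ultimately have "\<exists>N. \<forall>x\<in>reachable. \<forall>w. set w \<subseteq> {..<k} \<and> length w = N \<longrightarrow> \<not> ls.hitfree x w"
    using dim by (intro ls.hitfree_bounded[where Y = reachable and N = 1 and Q = "{q}"]
        cycle_hits[OF assms]) (auto simp: word_def)
  then obtain N where N: "\<And>x w. x \<in> reachable \<Longrightarrow> set w \<subseteq> {..<k} \<Longrightarrow> length w = N \<Longrightarrow> \<not> ls.hitfree x w"
    by blast
  have "bounded_hits N"
    unfolding bounded_hits_def
  proof (intro allI impI, elim conjE)
    fix v w assume v: "word v" and w: "word w" "length w = N"
    let ?x = "\<lambda>i. rat_of_int (fold step v start i)"
    have "\<not> ls.hitfree ?x w" using v w by (intro N) (auto simp: reachable_def word_def)
    then obtain j p where "j < N" "p \<in> target_sets" "fold step (take j w) ?x \<in> p"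
      unfolding ls.hitfree_def using w(2) by blast
    then obtain t where j: "j < N" "t < T" "in_target t (fold step (take j w) ?x)"
      unfolding target_sets_def by blast
    hence "in_target t (fold step (v @ take j w) start)"
      unfolding fold_of_int in_target_of_int by simp
    thus "\<exists>j<N. hit (fold step (v @ take j w) start)" using j unfolding hit_def by blast
  qed
  thus ?thesis by blast
qed

section \<open>Certificates for invalidity\<close>

lemma state_0: "state \<omega> 0 = start"
  unfolding state_def by simp

lemma state_Suc: "state \<omega> (Suc n) = step (\<omega> n) (state \<omega> n)"
  unfolding state_def by simp

lemma supported_state: "supported (state \<omega> n)"
  unfolding state_def by (rule supported_fold[OF supported_start])

text \<open>Every condition is finite. The relation is demanded only where the loop is entered,
  since it propagates along the loop, and \<open>N\<close> bounds the search for the misses.\<close>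

definition miss_certificate :: "nat \<Rightarrow> nat \<Rightarrow> (nat \<Rightarrow> nat) \<Rightarrow> nat \<Rightarrow> (nat \<Rightarrow> int) \<Rightarrow> nat \<Rightarrow> bool" where
  "miss_certificate s l \<omega> m c N \<longleftrightarrow> l > 0 \<and> c 0 \<noteq> 0 \<and> c m \<noteq> 0 \<and>
     (\<forall>i<D. (\<Sum>j\<le>m. c j * state \<omega> (s + j * l) i) = 0) \<and>
     (\<forall>a<zero_period (m * l) (strided l c). \<forall>t<T.
        \<exists>n<N. \<not> in_target t (state \<omega> (s + a + zero_period (m * l) (strided l c) * n)))"

lemma miss_certificate_sound:
  assumes \<omega>: "\<And>t. t < s + l \<Longrightarrow> f t < k" "\<omega> = lasso f s l" and cert: "miss_certificate s l \<omega> m c N"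
  shows "\<not> valid"
proof
  assume valid
  define b where "b = zero_period (m * l) (strided l c)"
  have l: "l > 0" and c: "c 0 \<noteq> 0" "c m \<noteq> 0"
    and rel: "\<And>i. i < D \<Longrightarrow> (\<Sum>j\<le>m. c j * state \<omega> (s + j * l) i) = 0"
    and miss: "\<And>a t. a < b \<Longrightarrow> t < T \<Longrightarrow> \<exists>n<N. \<not> in_target t (state \<omega> (s + a + b * n))"
    using cert unfolding miss_certificate_def b_def by auto
  have "(if t < s + l then t else s + (t - s) mod l) < s + l" for t using l by auto
  hence lt: "\<forall>t. \<omega> t < k" using \<omega> unfolding lasso_def by blast
  define y where "y t = state \<omega> (s + t)" for t
  \<comment> \<open>Positions in the loop that differ by a multiple of \<open>l\<close> read the
    same letter, so one linear step moves the whole relation from time \<open>n\<close> to time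
    \<open>n + 1\<close>.\<close>
  have ySuc: "y (Suc n + j * l) = step (\<omega> (s + n)) (y (n + j * l))" for n j
    unfolding y_def using lasso_add[OF l] by (simp add: state_Suc \<omega>(2) add.assoc[symmetric])
      (simp add: add.assoc lasso_add[OF l])
  have rec: "(\<Sum>j\<le>m. c j * y (n + j * l) i) = 0" if "i < D" for n i
    using that
  proof (induction n arbitrary: i)
    case 0
    thus ?case using rel unfolding y_def by simp
  next
    case (Suc n)
    have "(\<Sum>j\<le>m. c j * fold step [\<omega> (s + n)] (y (n + j * l)) i) = 0"
      using Suc.IH by (intro fold_linear_combination) (auto simp: y_def supported_state)
    thus ?case unfolding ySuc by simp
  qed
  have "infinite {n. hit (state \<omega> n)}" using \<open>valid\<close> lt unfolding valid_def by blast
  moreover have "{n. hit (state \<omega> n)} \<subseteq> {..<s} \<union> (+) s ` {t. hit (y t)}"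
  proof
    fix n assume "n \<in> {n. hit (state \<omega> n)}"
    thus "n \<in> {..<s} \<union> (+) s ` {t. hit (y t)}"
      unfolding y_def by (cases "n < s") (auto intro!: image_eqI[of _ _ "n - s"])
  qed
  ultimately have "infinite {t. \<exists>\<tau><T. in_target \<tau> (y t)}"
    unfolding hit_def by (meson finite_UnI finite_imageI finite_lessThan finite_subset)
  then obtain a \<tau> where a: "a < b" "\<tau> < T" "infinite {n. in_target \<tau> (y (a + b * n))}"
    using infinite_residue_class zero_period_pos unfolding b_def by meson
  have "in_target \<tau> (y (a + b * n))" for n
    using rec a(3) l c unfolding b_def
    by (intro recurrence_target_zeros[where c = "strided l c" and m = "m * l"])
      (auto simp: strided_def[of l c 0] strided_def[of l c "m * l"] sum_strided[OF l])
  thus False using miss[OF a(1,2)] unfolding y_def by (simp add: add.assoc)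
qed

lemma miss_certificate_complete:
  assumes "\<not> (\<exists>N. bounded_hits N)"
  obtains f s l m c N where "\<And>t. t < s + l \<Longrightarrow> f t < k" "miss_certificate s l (lasso f s l) m c N"
proof -
  have "\<not> periodic_hits"
    using assms periodic_hits_imp_bounded_hits by blast
  then obtain v u where vu: "word v" "word u" "u \<noteq> []"
    and fin: "finite {a. hit (fold step (v @ pump u a) start)}"
    unfolding periodic_hits_def by blast
  obtain m e and c :: "nat \<Rightarrow> int" where c: "c 0 \<noteq> 0" "c m \<noteq> 0"
    and ann: "\<And>x i. supported (x :: nat \<Rightarrow> int) \<Longrightarrow> i < D \<Longrightarrow>
       (\<Sum>k\<le>m. of_int (c k) * fold step (concat (replicate (e + k) u)) x i) = 0"
    by (rule annihilator[where u = u and ?'r = int]) (rule that)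
  \<comment> \<open>The offset \<open>e\<close> is absorbed into the stem, so that the relation
    holds from the start of the loop.\<close>
  define w where "w = v @ concat (replicate e u)"
  define s l where "s = length w" and "l = length u"
  define f where "f t = (w @ u) ! t" for t
  define \<omega> where "\<omega> = lasso f s l"
  define b where "b = zero_period (m * l) (strided l c)"
  have l: "l > 0" unfolding l_def using vu by simp
  have b: "b > 0" unfolding b_def by (rule zero_period_pos)
  have map: "map \<omega> [0..<s + n] = w @ pump u n" for n
  proof (rule nth_equalityI)
    fix t assume "t < length (map \<omega> [0..<s + n])"
    hence t: "t < s + n" by simp
    show "map \<omega> [0..<s + n] ! t = (w @ pump u n) ! t"
    proof (cases "t < s")
      case True
      thus ?thesis unfolding \<omega>_def lasso_def f_def by (simp add: nth_append s_def)
    next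
      case False
      then obtain d where d: "t = s + d" using le_Suc_ex not_le by blast
      have "\<omega> (s + d) = u ! (d mod l)"
        unfolding \<omega>_def lasso_add[OF l] f_def s_def by (simp add: nth_append)
      moreover have "(w @ pump u n) ! (s + d) = u ! (d mod l)"
        using t d unfolding s_def l_def pump_def by (simp add: nth_append)
      ultimately show ?thesis using t d by simp
    qed
  qed (simp add: s_def pump_def)
  have st: "state \<omega> (s + n) = fold step (v @ pump u (e * l + n)) start" for n
    unfolding state_def map w_def l_def pump_replicate[OF vu(3)] by simp
  have "(\<Sum>j\<le>m. c j * state \<omega> (s + j * l) i) = 0" if "i < D" for i
  proof -
    have "state \<omega> (s + j * l) = fold step (concat (replicate (e + j) u)) (fold step v start)" for j
      using pump_replicate[OF vu(3), of "e + j" 0] unfolding st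
      by (simp add: pump_def l_def algebra_simps)
    thus ?thesis using ann[OF supported_fold[OF supported_start, of v] that] by simp
  qed
  moreover have ex: "\<exists>n. \<not> in_target t (state \<omega> (s + a + b * n))" if "t < T" for a t
  proof (rule ccontr)
    assume "\<not> ?thesis"
    hence "in_target t (state \<omega> (s + (a + b * n)))" for n by (simp add: add.assoc)
    hence "in_target t (fold step (v @ pump u (e * l + (a + b * n))) start)" for n
      unfolding st .
    hence "hit (fold step (v @ pump u (e * l + a + b * n)) start)" for n
      using that unfolding hit_def add.assoc by blast
    hence "range (\<lambda>n. e * l + a + b * n) \<subseteq> {a. hit (fold step (v @ pump u a) start)}" by blast
    moreover have "inj (\<lambda>n. e * l + a + b * n)" using b by (intro injI) simp
    ultimately show False using fin finite_subset range_inj_infinite by blast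
  qed
  define g where "g a t = (SOME n. \<not> in_target t (state \<omega> (s + a + b * n)))" for a t
  have g: "\<not> in_target t (state \<omega> (s + a + b * g a t))" if "t < T" for a t
    unfolding g_def by (rule someI_ex[OF ex[OF that]])
  define N where "N = Suc (Max ((\<lambda>(a, t). g a t) ` ({..b} \<times> {..T})))"
  have "g a t < N" if "a < b" "t < T" for a t
    unfolding N_def less_Suc_eq_le using that by (intro Max_ge) (auto intro!: image_eqI[of _ _ "(a, t)"])
  hence "\<forall>a<b. \<forall>t<T. \<exists>n<N. \<not> in_target t (state \<omega> (s + a + b * n))" using g by blast
  ultimately have "miss_certificate s l \<omega> m c N"
    unfolding miss_certificate_def b_def[symmetric] using l c by blast
  moreover have "f t < k" if "t < s + l" for t
  proof -
    have "f t \<in> set (w @ u)" unfolding f_def using that by (intro nth_mem) (simp add: s_def l_def)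
    moreover have "set (w @ u) \<subseteq> {..<k}" using vu unfolding w_def word_def by auto
    ultimately show ?thesis by blast
  qed
  ultimately show thesis using that unfolding \<omega>_def by blast
qed

text \<open>The product is a linear functional of the \<open>card S\<close>-fold tensor power of the state, so it
  vanishes everywhere once it does for words shorter than the dimension of that power.\<close>

lemma functional_product_zero:
  assumes S: "finite S"
    and short: "\<And>v. word v \<Longrightarrow> length v \<le> D ^ card S \<Longrightarrow>
      (\<Prod>s\<in>S. \<Sum>l<D. G s l * fold step v start l) = (0::int)"
    and v: "word v"
  shows "(\<Prod>s\<in>S. \<Sum>l<D. G s l * fold step v start l) = 0"
  using v
proof (induction "length v" arbitrary: v rule: less_induct)
  case (less v)
  define I where "I = PiE S (\<lambda>_. {..<D})"
  define d where "d = D ^ card S"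
  have I: "finite I" "card I = d"
    unfolding I_def d_def using S by (simp_all add: finite_PiE card_PiE)
  show ?case
  proof (cases "length v \<le> d")
    case True thus ?thesis using short less.prems unfolding d_def by blast
  next
    case False
    define x where "x i = fold step (take i v) start" for i
    define \<tau> where "\<tau> i J = (\<Prod>s\<in>S. x i (J s))" for i J
    obtain c where c: "\<exists>j\<in>{..d}. c j \<noteq> 0" "\<And>J. J \<in> I \<Longrightarrow> (\<Sum>j\<in>{..d}. c j * \<tau> j J) = 0"
      using int_dependence[OF I(1), of "{..d}" \<tau>] I(2) by auto
    \<comment> \<open>The tensor of the prefix of length \<open>i\<close> is a rational combination
      of those of shorter prefixes. Exchanging the prefix while keeping the rest \<open>w\<close>
      gives strictly shorter words, to which the induction hypothesis applies.\<close>
    define i where "i = Max {j. j \<le> d \<and> c j \<noteq> 0}"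
    have ne: "{j. j \<le> d \<and> c j \<noteq> 0} \<noteq> {}" using c(1) by auto
    have i: "i \<le> d" "c i \<noteq> 0" using Max_in[OF _ ne] unfolding i_def by auto
    have top: "c j = 0" if "i < j" "j \<le> d" for j
    proof (rule ccontr)
      assume "c j \<noteq> 0"
      hence "j \<le> i" unfolding i_def using that by (intro Max_ge) auto
      thus False using that by simp
    qed
    define w where "w = drop i v"
    define H where "H j = (\<Prod>s\<in>S. \<Sum>l<D. G s l * fold step w (x j) l)" for j
    define G' where "G' s j = (\<Sum>l<D. G s l * entry w l j)" for s j
    \<comment> \<open>Multilinear expansion: for the fixed rest \<open>w\<close>, the product is a
      linear functional of the tensor.\<close>
    have H: "H j = (\<Sum>J\<in>I. (\<Prod>s\<in>S. G' s (J s)) * \<tau> j J)" for j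
    proof -
      have "supported (x j)" unfolding x_def by (rule supported_fold[OF supported_start])
      hence "H j = (\<Prod>s\<in>S. \<Sum>l<D. G s l * (\<Sum>n<D. entry w l n * x j n))"
        unfolding H_def by (intro prod.cong sum.cong) (auto simp: fold_entry)
      also have "\<dots> = (\<Prod>s\<in>S. \<Sum>n<D. G' s n * x j n)"
        unfolding G'_def by (simp only: sum_mult_swap)
      also have "\<dots> = (\<Sum>J\<in>I. \<Prod>s\<in>S. G' s (J s) * x j (J s))"
        unfolding I_def using S by (intro prod_sum_PiE) auto
      finally show ?thesis unfolding \<tau>_def by (simp add: prod.distrib)
    qed
    have "(\<Sum>j\<le>d. c j * H j) = (\<Sum>J\<in>I. (\<Prod>s\<in>S. G' s (J s)) * (\<Sum>j\<le>d. c j * \<tau> j J))"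
      unfolding H by (simp add: sum_distrib_left sum.swap[of _ I] algebra_simps)
    also have "\<dots> = 0" using c(2) by simp
    finally have 0: "(\<Sum>j\<le>d. c j * H j) = 0" .
    have lower: "c j * H j = 0" if "j \<noteq> i" "j \<le> d" for j
    proof (cases "j < i")
      case True
      have "word (take j v @ w)" unfolding w_def word_append
        using less.prems word_take word_drop by blast
      moreover have "length (take j v @ w) < length v"
        using True i(1) False unfolding w_def by simp
      ultimately have "(\<Prod>s\<in>S. \<Sum>l<D. G s l * fold step (take j v @ w) start l) = 0"
        by (intro less.hyps)
      thus ?thesis unfolding H_def x_def by simp
    next
      case False thus ?thesis using top that by simp
    qed
    have "(\<Sum>j\<le>d. c j * H j) = (\<Sum>j\<in>{i}. c j * H j)"
      using lower i(1) by (intro sum.mono_neutral_right) auto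
    hence "H i = 0" using 0 i(2) by simp
    moreover have "fold step w (x i) = fold step v start"
      unfolding x_def w_def by (metis append_take_drop_id fold_append comp_apply)
    ultimately show ?thesis unfolding H_def by simp
  qed
qed

text \<open>Without a hit, each pair of a time and a target has a nonvanishing row, and the product
  of these \<open>N * T\<close> functionals of the state after \<open>v\<close> is nonzero. After a
  short word some hit makes a factor vanish, so the product would vanish for all words.\<close>

lemma bounded_hits_short:
  "bounded_hits N \<longleftrightarrow> (\<forall>v w. word v \<and> length v \<le> D ^ (N * T) \<and> word w \<and> length w = N \<longrightarrow>
     (\<exists>j<N. hit (fold step (v @ take j w) start)))" (is "_ \<longleftrightarrow> ?R")
proof
  assume R: ?R
  show "bounded_hits N"
    unfolding bounded_hits_def
  proof (intro allI impI, elim conjE)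
    fix v w assume v: "word v" and w: "word w" "length w = N"
    define S where "S = {..<N} \<times> {..<T}"
    have S: "finite S" "card S = N * T" unfolding S_def by (simp_all add: card_cartesian_product)
    show "\<exists>j<N. hit (fold step (v @ take j w) start)"
    proof (rule ccontr)
      assume no: "\<not> ?thesis"
      have "\<exists>i<D. (\<Sum>n<D. K t i n * fold step (v @ take j w) start n) \<noteq> 0" if "j < N" "t < T" for j t
        using no that unfolding hit_def in_target_def by auto
      then obtain \<rho> where \<rho>: "\<And>j t. j < N \<Longrightarrow> t < T \<Longrightarrow> \<rho> j t < D \<and>
          (\<Sum>n<D. K t (\<rho> j t) n * fold step (v @ take j w) start n) \<noteq> 0" by metis
      define G where "G = (\<lambda>(j, t) l. \<Sum>n<D. K t (\<rho> j t) n * entry (take j w) n l)"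
      have G: "(\<Sum>l<D. G (j, t) l * fold step v start l) =
          (\<Sum>n<D. K t (\<rho> j t) n * fold step (v @ take j w) start n)" for v j t
      proof -
        have "(\<Sum>n<D. K t (\<rho> j t) n * fold step (v @ take j w) start n) =
            (\<Sum>n<D. K t (\<rho> j t) n * (\<Sum>l<D. entry (take j w) n l * fold step v start l))"
          by (intro sum.cong) (simp_all add: fold_entry supported_fold supported_start)
        thus ?thesis unfolding G_def by (simp only: sum_mult_swap prod.case)
      qed
      have "(\<Prod>s\<in>S. \<Sum>l<D. G s l * fold step v start l) = 0"
      proof (rule functional_product_zero[OF S(1) _ v])
        fix v' assume "word v'" "length v' \<le> D ^ card S"
        then obtain j where j: "j < N" "hit (fold step (v' @ take j w) start)"
          using R w S(2) by metis
        then obtain t where t: "t < T" "in_target t (fold step (v' @ take j w) start)"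
          unfolding hit_def by blast
        have "(\<Sum>l<D. G (j, t) l * fold step v' start l) = 0"
          unfolding G using t \<rho>[OF j(1) t(1)] unfolding in_target_def by simp
        thus "(\<Prod>s\<in>S. \<Sum>l<D. G s l * fold step v' start l) = 0"
          using j t S(1) by (intro prod_zero) (auto simp: S_def)
      qed
      then obtain j t where "j < N" "t < T" "(\<Sum>l<D. G (j, t) l * fold step v start l) = 0"
        using S(1) by (auto simp: S_def)
      thus False unfolding G using \<rho> by blast
    qed
  qed
qed (simp add: bounded_hits_def)

lemma valid_iff_bounded_hits: "valid \<longleftrightarrow> (\<exists>N. bounded_hits N)"
proof
  assume v: valid
  show "\<exists>N. bounded_hits N"
  proof (rule ccontr)
    assume "\<not> ?thesis"
    then obtain f s l m c N where "\<And>t. t < s + l \<Longrightarrow> f t < k" "miss_certificate s l (lasso f s l) m c N"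
      by (rule miss_certificate_complete) (rule that)
    hence "\<not> valid" by (rule miss_certificate_sound[OF _ refl])
    thus False using v by contradiction
  qed
qed (use bounded_hits_imp_valid in blast)

end

section \<open>Closure properties of computable functions\<close>

text \<open>Fixing only the number of arguments and hiding the program gives closure rules that
  follow the syntax of a term.\<close>

definition computable :: "nat \<Rightarrow> (nat list \<Rightarrow> nat) \<Rightarrow> bool" where
  "computable n f \<longleftrightarrow> (\<exists>r. \<forall>xs. length xs = n \<longrightarrow> rec_eval r xs (f xs))"

lemma computable_cong:
  "computable n f \<Longrightarrow> (\<And>xs. length xs = n \<Longrightarrow> g xs = f xs) \<Longrightarrow> computable n g"
  unfolding computable_def by metis

lemma computable_const: "computable n (\<lambda>xs. c)"
proof (induction c)
  case 0
  show ?case unfolding computable_def by (intro exI[of _ Zero]) (simp add: rec_eval.zero)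
next
  case (Suc c)
  then obtain r where "\<And>xs. length xs = n \<Longrightarrow> rec_eval r xs c" unfolding computable_def by blast
  thus ?case unfolding computable_def
    by (intro exI[of _ "Comp Succ [r]"])
      (auto intro!: rec_eval.comp[where ys = "[c]"] rec_eval.succ)
qed

lemma computable_nth: "i < n \<Longrightarrow> computable n (\<lambda>xs. xs ! i)"
  unfolding computable_def by (intro exI[of _ "Proj i"]) (auto intro: rec_eval.proj)

text \<open>Bounded sums and quantifiers put their variable in front of the parameters, so under
  such a binder an outer parameter is an entry of a \<open>drop\<close>. Deeper nesting has its own
  rules below.\<close>

lemma computable_drop_nth: "computable n (\<lambda>xs. drop k xs ! i)" if "k + i < n"
  by (rule computable_cong[OF computable_nth[of "k + i"]]) (use that in auto)

lemma computable_comp: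
  assumes f: "computable (length gs) f" and gs: "\<And>g. g \<in> set gs \<Longrightarrow> computable n g"
  shows "computable n (\<lambda>xs. f (map (\<lambda>g. g xs) gs))"
proof -
  obtain rf where rf: "\<And>ys. length ys = length gs \<Longrightarrow> rec_eval rf ys (f ys)"
    using f unfolding computable_def by blast
  have "\<forall>g\<in>set gs. \<exists>r. \<forall>xs. length xs = n \<longrightarrow> rec_eval r xs (g xs)"
    using gs unfolding computable_def by blast
  then obtain R where R: "\<And>g xs. g \<in> set gs \<Longrightarrow> length xs = n \<Longrightarrow> rec_eval (R g) xs (g xs)"
    by (metis (full_types))
  have "rec_eval (Comp rf (map R gs)) xs (f (map (\<lambda>g. g xs) gs))" if "length xs = n" for xs
    by (rule rec_eval.comp[where ys = "map (\<lambda>g. g xs) gs"])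
      (auto intro!: rf R that simp: list_all2_conv_all_nth)
  thus ?thesis unfolding computable_def by blast
qed

lemma computable_comp1:
  assumes "computable 1 (\<lambda>ys. f (ys ! 0))" "computable n a"
  shows "computable n (\<lambda>xs. f (a xs))"
  using computable_comp[of "[a]" "\<lambda>ys. f (ys ! 0)" n] assms by simp

lemma computable_comp2:
  assumes "computable 2 (\<lambda>ys. f (ys ! 0) (ys ! 1))" "computable n a" "computable n b"
  shows "computable n (\<lambda>xs. f (a xs) (b xs))"
  using computable_comp[of "[a, b]" "\<lambda>ys. f (ys ! 0) (ys ! 1)" n] assms
  by (auto simp: numeral_2_eq_2)

lemma computable_Suc: "computable n a \<Longrightarrow> computable n (\<lambda>xs. Suc (a xs))"
proof -
  have "computable 1 (\<lambda>ys. Suc (ys ! 0))"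
    unfolding computable_def
  proof (intro exI[of _ Succ] allI impI)
    fix ys :: "nat list" assume "length ys = 1"
    then obtain y where "ys = [y]" by (auto simp: length_Suc_conv)
    thus "rec_eval Succ ys (Suc (ys ! 0))" by (auto intro: rec_eval.succ)
  qed
  thus "computable n a \<Longrightarrow> computable n (\<lambda>xs. Suc (a xs))" by (rule computable_comp1)
qed

lemma computable_rec_nat:
  assumes f: "computable n f" and h: "computable n h"
    and g: "computable (Suc (Suc n)) (\<lambda>ys. G (ys ! 0) (ys ! 1) (drop 2 ys))"
  shows "computable n (\<lambda>xs. rec_nat (f xs) (\<lambda>k y. G k y xs) (h xs))"
proof -
  obtain rf where rf: "\<And>xs. length xs = n \<Longrightarrow> rec_eval rf xs (f xs)"
    using f unfolding computable_def by blast
  obtain rg where rg: "\<And>ys. length ys = Suc (Suc n) \<Longrightarrow>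
      rec_eval rg ys (G (ys ! 0) (ys ! 1) (drop 2 ys))"
    using g unfolding computable_def by blast
  have step: "rec_eval (PrimRec rf rg) (m # xs) (rec_nat (f xs) (\<lambda>k y. G k y xs) m)"
    if "length xs = n" for m xs
  proof (induction m)
    case 0 show ?case using rf[OF that] by (auto intro: rec_eval.prim_0)
  next
    case (Suc m)
    show ?case
      using rec_eval.prim_Suc[OF Suc] rg[of "m # rec_nat (f xs) (\<lambda>k y. G k y xs) m # xs"] that
      by simp
  qed
  have "computable (Suc n) (\<lambda>ys. rec_nat (f (tl ys)) (\<lambda>k y. G k y (tl ys)) (hd ys))"
    unfolding computable_def
  proof (intro exI[of _ "PrimRec rf rg"] allI impI)
    fix ys :: "nat list" assume "length ys = Suc n"
    then obtain m xs where "ys = m # xs" "length xs = n" by (auto simp: length_Suc_conv)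
    thus "rec_eval (PrimRec rf rg) ys (rec_nat (f (tl ys)) (\<lambda>k y. G k y (tl ys)) (hd ys))"
      using step by simp
  qed
  hence "computable n (\<lambda>xs. (\<lambda>ys. rec_nat (f (tl ys)) (\<lambda>k y. G k y (tl ys)) (hd ys))
      (map (\<lambda>g. g xs) (h # map (\<lambda>i xs. xs ! i) [0..<n])))"
    by (intro computable_comp) (auto intro: h computable_nth)
  moreover have "map (\<lambda>i. xs ! i) [0..<n] = xs" if "length xs = n" for xs :: "nat list"
    using that by (metis map_nth)
  ultimately show ?thesis
    by (elim computable_cong) (simp add: comp_def)
qed

definition decides :: "nat \<Rightarrow> (nat list \<Rightarrow> bool) \<Rightarrow> bool" where
  "decides n P \<longleftrightarrow> computable n (\<lambda>xs. of_bool (P xs))"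

section \<open>Arithmetic and bounded quantifiers\<close>

lemma computable_add:
  assumes "computable n a" "computable n b" shows "computable n (\<lambda>xs. a xs + b xs)"
proof (rule computable_cong)
  show "computable n (\<lambda>xs. rec_nat (b xs) (\<lambda>k y. Suc y) (a xs))"
    by (intro computable_rec_nat computable_Suc computable_nth assms) simp
  have "p + q = rec_nat q (\<lambda>k y. Suc y) p" for p q by (induction p) auto
  thus "a xs + b xs = rec_nat (b xs) (\<lambda>k y. Suc y) (a xs)" for xs .
qed

lemma computable_drop:
  assumes "computable n a" "m = k + n" shows "computable m (\<lambda>ys. a (drop k ys))"
proof (rule computable_cong)
  show "computable m (\<lambda>ys. a (map (\<lambda>g. g ys) (map (\<lambda>i ys. ys ! (k + i)) [0..<n])))"
    using assms by (intro computable_comp) (auto intro: computable_nth)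
  show "a (drop k ys) = a (map (\<lambda>g. g ys) (map (\<lambda>i ys. ys ! (k + i)) [0..<n]))"
    if "length ys = m" for ys
    using that assms(2) by (intro arg_cong[where f = a] nth_equalityI) auto
qed

text \<open>Makes room for the running value of a primitive recursion, which comes second among the
  arguments.\<close>

lemma computable_skip:
  assumes "computable (Suc n) (\<lambda>ys. G (ys ! 0) (drop 1 ys))"
  shows "computable (Suc (Suc n)) (\<lambda>ys. G (ys ! 0) (drop 2 ys))"
proof -
  have "computable (Suc (Suc n)) (\<lambda>ys. (\<lambda>ys. G (ys ! 0) (drop 1 ys))
      (map (\<lambda>g. g ys) ((\<lambda>ys. ys ! 0) # map (\<lambda>i ys. ys ! (i + 2)) [0..<n])))"
    using assms by (intro computable_comp) (auto intro: computable_nth)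
  thus "computable (Suc (Suc n)) (\<lambda>ys. G (ys ! 0) (drop 2 ys))"
  proof (rule computable_cong)
    fix ys :: "nat list" assume "length ys = Suc (Suc n)"
    hence "map (\<lambda>i. ys ! (i + 2)) [0..<n] = drop 2 ys" by (intro nth_equalityI) auto
    thus "G (ys ! 0) (drop 2 ys) = (\<lambda>ys. G (ys ! 0) (drop 1 ys))
      (map (\<lambda>g. g ys) ((\<lambda>ys. ys ! 0) # map (\<lambda>i ys. ys ! (i + 2)) [0..<n]))"
      by (simp add: comp_def)
  qed
qed

lemma computable_sum:
  fixes G :: "nat \<Rightarrow> nat list \<Rightarrow> nat"
  assumes "computable n h" "computable (Suc n) (\<lambda>ys. G (ys ! 0) (drop 1 ys))"
  shows "computable n (\<lambda>xs. \<Sum>i<h xs. G i xs)"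
proof (rule computable_cong)
  show "computable n (\<lambda>xs. rec_nat 0 (\<lambda>k y. y + G k xs) (h xs))"
    by (intro computable_rec_nat computable_add computable_nth computable_const
        computable_skip assms) auto
  have "(\<Sum>i<m. G i xs) = rec_nat 0 (\<lambda>k y. y + G k xs) m" for m xs
    by (induction m) auto
  thus "(\<Sum>i<h xs. G i xs) = rec_nat 0 (\<lambda>k y. y + G k xs) (h xs)" for xs .
qed

lemma computable_mult:
  assumes "computable n a" "computable n b" shows "computable n (\<lambda>xs. a xs * b xs)"
proof (rule computable_cong)
  show "computable n (\<lambda>xs. \<Sum>i<a xs. b xs)"
    using assms by (intro computable_sum computable_drop[where k = 1 and n = n]) auto
qed simp

lemma computable_pred: "computable n a \<Longrightarrow> computable n (\<lambda>xs. a xs - 1)"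
proof (erule computable_comp1[rotated], rule computable_cong)
  show "computable 1 (\<lambda>xs. rec_nat 0 (\<lambda>k y. k) (xs ! 0))"
    by (intro computable_rec_nat computable_nth computable_const) auto
  show "xs ! 0 - 1 = rec_nat 0 (\<lambda>k y. k) (xs ! 0)" for xs :: "nat list"
    by (cases "xs ! 0") auto
qed

lemma computable_diff:
  assumes "computable n a" "computable n b" shows "computable n (\<lambda>xs. a xs - b xs)"
proof (rule computable_cong)
  show "computable n (\<lambda>xs. rec_nat (a xs) (\<lambda>k y. y - 1) (b xs))"
    by (intro computable_rec_nat computable_pred computable_nth assms) simp
  have "p - m = rec_nat p (\<lambda>k y. y - 1) m" for p m :: nat
    by (induction m) auto
  thus "a xs - b xs = rec_nat (a xs) (\<lambda>k y. y - 1) (b xs)" for xs .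
qed

lemma computable_prod:
  fixes G :: "nat \<Rightarrow> nat list \<Rightarrow> nat"
  assumes "computable n h" "computable (Suc n) (\<lambda>ys. G (ys ! 0) (drop 1 ys))"
  shows "computable n (\<lambda>xs. \<Prod>i<h xs. G i xs)"
proof (rule computable_cong)
  show "computable n (\<lambda>xs. rec_nat 1 (\<lambda>k y. y * G k xs) (h xs))"
    by (intro computable_rec_nat computable_mult computable_nth computable_const
        computable_skip assms) auto
  have "(\<Prod>i<m. G i xs) = rec_nat 1 (\<lambda>k y. y * G k xs) m" for m xs
    by (induction m) auto
  thus "(\<Prod>i<h xs. G i xs) = rec_nat 1 (\<lambda>k y. y * G k xs) (h xs)" for xs .
qed

lemma decides_le: "computable n a \<Longrightarrow> computable n b \<Longrightarrow> decides n (\<lambda>xs. a xs \<le> b xs)"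
  unfolding decides_def
  by (rule computable_cong[where f = "\<lambda>xs. 1 - (a xs - b xs)"])
    (auto intro: computable_diff computable_const)

lemma decides_not: "decides n P \<Longrightarrow> decides n (\<lambda>xs. \<not> P xs)"
  unfolding decides_def
  by (rule computable_cong[where f = "\<lambda>xs. 1 - of_bool (P xs)"])
    (auto intro: computable_diff computable_const)

lemma decides_conj: "decides n P \<Longrightarrow> decides n Q \<Longrightarrow> decides n (\<lambda>xs. P xs \<and> Q xs)"
  unfolding decides_def
  by (rule computable_cong[where f = "\<lambda>xs. of_bool (P xs) * of_bool (Q xs)"])
    (auto intro: computable_mult)

lemma decides_cong: "decides n P \<Longrightarrow> (\<And>xs. length xs = n \<Longrightarrow> Q xs \<longleftrightarrow> P xs) \<Longrightarrow> decides n Q"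
  unfolding decides_def by (erule computable_cong) simp

lemma decides_disj: "decides n P \<Longrightarrow> decides n Q \<Longrightarrow> decides n (\<lambda>xs. P xs \<or> Q xs)"
  by (rule decides_cong[where P = "\<lambda>xs. \<not> (\<not> P xs \<and> \<not> Q xs)"])
    (intro decides_not decides_conj, auto)

lemma decides_less: "computable n a \<Longrightarrow> computable n b \<Longrightarrow> decides n (\<lambda>xs. a xs < b xs)"
  unfolding Suc_le_eq[symmetric] by (intro decides_le computable_Suc)

lemma decides_eq: "computable n a \<Longrightarrow> computable n b \<Longrightarrow> decides n (\<lambda>xs. a xs = (b xs :: nat))"
  by (rule decides_cong[where P = "\<lambda>xs. a xs \<le> b xs \<and> b xs \<le> a xs"])
    (intro decides_le decides_conj, auto)

lemma decides_all:
  assumes "computable n h" "decides (Suc n) (\<lambda>ys. P (ys ! 0) (drop 1 ys))"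
  shows "decides n (\<lambda>xs. \<forall>i<h xs. P i xs)"
  unfolding decides_def
proof (rule computable_cong)
  show "computable n (\<lambda>xs. \<Prod>i<h xs. of_bool (P i xs))"
    using assms unfolding decides_def by (rule computable_prod)
  have "(of_bool (\<forall>i<m. P i xs) :: nat) = (\<Prod>i<m. of_bool (P i xs))" for m xs
    by (induction m) (auto simp: less_Suc_eq)
  thus "(of_bool (\<forall>i<h xs. P i xs) :: nat) = (\<Prod>i<h xs. of_bool (P i xs))" for xs .
qed

lemma decides_ex:
  assumes "computable n h" "decides (Suc n) (\<lambda>ys. P (ys ! 0) (drop 1 ys))"
  shows "decides n (\<lambda>xs. \<exists>i<h xs. P i xs)"
  by (rule decides_cong[where P = "\<lambda>xs. \<not> (\<forall>i<h xs. \<not> P i xs)"])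
    (intro decides_not decides_all assms, auto)

lemma computable_if:
  assumes "decides n P" "computable n a" "computable n b"
  shows "computable n (\<lambda>xs. if P xs then a xs else b xs)"
  by (rule computable_cong[where f = "\<lambda>xs. of_bool (P xs) * a xs + (1 - of_bool (P xs)) * b xs"])
    (intro computable_add computable_mult computable_diff computable_const
      assms(1)[unfolded decides_def] assms(2,3), simp)

lemmas computable_basic_intros =
  computable_const computable_nth computable_drop_nth computable_Suc computable_add computable_mult
  computable_diff computable_sum computable_prod computable_if decides_le decides_less decides_eq
  decides_not decides_conj decides_disj decides_all decides_ex

lemma computable_drop_drop_nth: "computable n (\<lambda>xs. drop j (drop k xs) ! i)" if "j + k + i < n"
  using computable_drop_nth[of "j + k" i n] that by simp

lemma computable_drop_drop_drop_nth:
  "computable n (\<lambda>xs. drop h (drop j (drop k xs)) ! i)" if "h + j + k + i < n"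
  using computable_drop_nth[of "h + j + k" i n] that by (simp add: add.assoc)

lemma computable_drop4_nth:
  "computable n (\<lambda>xs. drop g (drop h (drop j (drop k xs))) ! i)" if "g + h + j + k + i < n"
  using computable_drop_nth[of "g + h + j + k" i n] that by (simp add: add.assoc)

lemma computable_power:
  assumes "computable n a" "computable n b" shows "computable n (\<lambda>xs. a xs ^ b xs)"
proof (rule computable_comp2[OF _ assms])
  show "computable 2 (\<lambda>ys. (ys ! 0) ^ (ys ! 1))"
    by (rule computable_cong[where f = "\<lambda>ys. \<Prod>i<ys ! 1. ys ! 0"])
      (intro computable_basic_intros, simp_all)
qed

lemma computable_fact: "computable n a \<Longrightarrow> computable n (\<lambda>xs. fact (a xs))"
proof (erule computable_comp1[rotated])
  show "computable 1 (\<lambda>ys. fact (ys ! 0))"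
    by (rule computable_cong[where f = "\<lambda>ys. \<Prod>i<ys ! 0. Suc i"])
      (intro computable_basic_intros, simp_all add: fact_prod_Suc atLeast0LessThan)
qed

text \<open>The quotient counts the positive multiples of the divisor up to the dividend; division
  by 0 gives 0, as in HOL.\<close>

lemma computable_div:
  assumes "computable n a" "computable n b" shows "computable n (\<lambda>xs. a xs div b xs)"
proof (rule computable_comp2[OF _ assms], rule computable_cong)
  show "computable 2 (\<lambda>ys. if ys ! 1 = 0 then 0 else
      \<Sum>i<ys ! 0. if Suc i * ys ! 1 \<le> ys ! 0 then 1 else 0)"
    by (intro computable_basic_intros) simp_all
  have "p div q = (\<Sum>i<p. if Suc i * q \<le> p then 1 else 0)" if "q > 0" for p q :: nat
  proof -
    have "(\<Sum>i<p. if Suc i * q \<le> p then 1 else 0) = (\<Sum>i\<in>{i\<in>{..<p}. Suc i * q \<le> p}. 1)"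
      by (rule sum.inter_filter[symmetric]) simp
    also have "{i\<in>{..<p}. Suc i * q \<le> p} = {..<p div q}"
    proof -
      have "Suc i * q \<le> p \<longleftrightarrow> i < p div q" for i
        using that by (simp only: less_eq_div_iff_mult_less_eq[OF that, symmetric] Suc_le_eq)
      moreover have "i < p" if "i < p div q" for i using that div_le_dividend order_less_le_trans by blast
      ultimately show ?thesis by auto
    qed
    also have "(\<Sum>i<p div q. 1) = p div q" by simp
    finally show ?thesis by (rule sym)
  qed
  thus "ys ! 0 div ys ! 1 = (if ys ! 1 = 0 then 0 else
      \<Sum>i<ys ! 0. if Suc i * ys ! 1 \<le> ys ! 0 then 1 else 0)" for ys :: "nat list"
    by simp
qed

lemma computable_mod:
  assumes "computable n a" "computable n b" shows "computable n (\<lambda>xs. a xs mod b xs)"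
  by (rule computable_cong[where f = "\<lambda>xs. a xs - b xs * (a xs div b xs)"])
    (intro computable_diff computable_mult computable_div assms, simp add: minus_mult_div_eq_mod)

lemma computable_prod_encode:
  assumes "computable n a" "computable n b" shows "computable n (\<lambda>xs. prod_encode (a xs, b xs))"
  unfolding prod_encode_def triangle_def prod.case
  using assms by (intro computable_basic_intros computable_div)

text \<open>Decoding as a bounded search written as a sum: both components are at most the code, and
  exactly one pair contributes.\<close>

lemma sum_prod_decode:
  fixes h :: "nat \<Rightarrow> nat \<Rightarrow> nat"
  shows "(\<Sum>i<Suc c. \<Sum>j<Suc c. if prod_encode (i, j) = c then h i j else 0) =
    h (fst (prod_decode c)) (snd (prod_decode c))"
proof -
  obtain p q where c: "c = prod_encode (p, q)" by (metis prod_decode_inverse surj_pair)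
  have "(\<Sum>j<Suc c. if prod_encode (i, j) = c then h i j else 0) = (if i = p then h p q else 0)" for i
    using le_prod_encode_2[of q p] by (simp add: c less_Suc_eq_le)
  thus ?thesis using le_prod_encode_1[of p q] by (simp add: c less_Suc_eq_le)
qed

lemma computable_fst_prod_decode:
  "computable n a \<Longrightarrow> computable n (\<lambda>xs. fst (prod_decode (a xs)))"
proof (erule computable_comp1[rotated], rule computable_cong)
  show "computable 1 (\<lambda>ys. \<Sum>i<Suc (ys ! 0). \<Sum>j<Suc (ys ! 0).
      if prod_encode (i, j) = ys ! 0 then i else 0)"
    by (intro computable_basic_intros computable_prod_encode computable_drop_drop_nth) simp_all
qed (simp only: sum_prod_decode)

lemma computable_snd_prod_decode:
  "computable n a \<Longrightarrow> computable n (\<lambda>xs. snd (prod_decode (a xs)))"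
proof (erule computable_comp1[rotated], rule computable_cong)
  show "computable 1 (\<lambda>ys. \<Sum>i<Suc (ys ! 0). \<Sum>j<Suc (ys ! 0).
      if prod_encode (i, j) = ys ! 0 then j else 0)"
    by (intro computable_basic_intros computable_prod_encode computable_drop_drop_nth) simp_all
qed (simp only: sum_prod_decode)

lemmas computable_intros = computable_basic_intros computable_drop_drop_nth
  computable_drop_drop_drop_nth computable_drop4_nth computable_power computable_fact
  computable_div computable_mod computable_prod_encode computable_fst_prod_decode
  computable_snd_prod_decode

section \<open>Lists coded as numbers\<close>

definition code_hd :: "nat \<Rightarrow> nat" where
  "code_hd c = fst (prod_decode (c - 1))"

text \<open>The empty list has code 0 and \<open>0 - 1 = 0\<close> decodes to a pair of zeros, so
  dropping past the end stays at the empty list.\<close>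

definition code_drop :: "nat \<Rightarrow> nat \<Rightarrow> nat" where
  "code_drop c i = rec_nat c (\<lambda>_ y. snd (prod_decode (y - 1))) i"

definition code_nth :: "nat \<Rightarrow> nat \<Rightarrow> nat" where
  "code_nth c i = code_hd (code_drop c i)"

text \<open>A list is never longer than its code, which bounds the count.\<close>

definition code_length :: "nat \<Rightarrow> nat" where
  "code_length c = (\<Sum>i<c. if code_drop c i = 0 then 0 else 1)"

lemma code_drop_encode: "code_drop (list_encode xs) i = list_encode (drop i xs)"
proof (induction i)
  case 0 thus ?case by (simp add: code_drop_def)
next
  case (Suc i)
  have "snd (prod_decode (0 - 1)) = 0"
    using prod_encode_inverse[of "(0, 0)"] by (simp add: prod_encode_def)
  hence "snd (prod_decode (list_encode ys - 1)) = list_encode (tl ys)" for ys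
    by (cases ys) auto
  thus ?case using Suc by (simp add: code_drop_def drop_Suc tl_drop)
qed

lemma code_nth_encode: "i < length xs \<Longrightarrow> code_nth (list_encode xs) i = xs ! i"
  unfolding code_nth_def code_drop_encode code_hd_def
  by (simp add: Cons_nth_drop_Suc[symmetric])

lemma length_le_list_encode: "length xs \<le> list_encode xs"
proof (induction xs)
  case (Cons x xs)
  have "list_encode xs \<le> prod_encode (x, list_encode xs)" by (rule le_prod_encode_2)
  thus ?case using Cons by simp
qed simp

lemma code_length_encode: "code_length (list_encode xs) = length xs"
proof -
  have "list_encode ys = 0 \<longleftrightarrow> ys = []" for ys by (cases ys) auto
  hence nz: "list_encode (drop i xs) = 0 \<longleftrightarrow> \<not> i < length xs" for i by (simp add: not_less)
  have "code_length (list_encode xs) = (\<Sum>i<list_encode xs. if i < length xs then 1 else 0)"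
    unfolding code_length_def code_drop_encode nz by (intro sum.cong) auto
  also have "\<dots> = (\<Sum>i<length xs. if i < length xs then 1 else 0)"
    using length_le_list_encode by (intro sum.mono_neutral_right) auto
  finally show ?thesis by simp
qed

lemma computable_code_drop:
  assumes "computable n a" "computable n b" shows "computable n (\<lambda>xs. code_drop (a xs) (b xs))"
proof (rule computable_comp2[OF _ assms])
  show "computable 2 (\<lambda>ys. code_drop (ys ! 0) (ys ! 1))"
    unfolding code_drop_def by (intro computable_rec_nat computable_intros) simp_all
qed

lemma computable_code_nth:
  assumes "computable n a" "computable n b" shows "computable n (\<lambda>xs. code_nth (a xs) (b xs))"
  unfolding code_nth_def code_hd_def by (intro computable_intros computable_code_drop assms)

lemma computable_code_length:
  "computable n a \<Longrightarrow> computable n (\<lambda>xs. code_length (a xs))"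
proof (erule computable_comp1[rotated])
  show "computable 1 (\<lambda>ys. code_length (ys ! 0))"
    unfolding code_length_def by (intro computable_intros computable_code_drop) simp_all
qed

text \<open>List codes grow at the front, so the recursion produces the last entry first; hence the
  index \<open>h xs - 1 - m\<close>.\<close>

lemma computable_tabulate:
  assumes h: "computable n h" and G: "computable (Suc n) (\<lambda>ys. G (ys ! 0) (drop 1 ys))"
  shows "computable n (\<lambda>xs. list_encode (map (\<lambda>i. G i xs) [0..<h xs]))"
proof (rule computable_cong)
  have "computable (Suc (Suc n)) (\<lambda>ys. (\<lambda>ys. G (ys ! 0) (drop 1 ys))
      (map (\<lambda>g. g ys) ((\<lambda>ys. h (drop 2 ys) - 1 - ys ! 0) # map (\<lambda>i ys. ys ! (i + 2)) [0..<n])))"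
  proof (rule computable_comp)
    fix g assume "g \<in> set ((\<lambda>ys. h (drop 2 ys) - 1 - ys ! 0) # map (\<lambda>i ys. ys ! (i + 2)) [0..<n])"
    moreover have "computable (Suc (Suc n)) (\<lambda>ys. h (drop 2 ys) - 1 - ys ! 0)"
      by (intro computable_diff computable_const computable_nth computable_drop[OF h]) simp_all
    ultimately show "computable (Suc (Suc n)) g" by (auto intro: computable_nth)
  qed (use G in simp)
  hence "computable (Suc (Suc n)) (\<lambda>ys. G (h (drop 2 ys) - 1 - ys ! 0) (drop 2 ys))"
  proof (rule computable_cong)
    fix ys :: "nat list" assume "length ys = Suc (Suc n)"
    hence "map (\<lambda>i. ys ! (i + 2)) [0..<n] = drop 2 ys" by (intro nth_equalityI) auto
    thus "G (h (drop 2 ys) - 1 - ys ! 0) (drop 2 ys) = (\<lambda>ys. G (ys ! 0) (drop 1 ys))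
      (map (\<lambda>g. g ys) ((\<lambda>ys. h (drop 2 ys) - 1 - ys ! 0) # map (\<lambda>i ys. ys ! (i + 2)) [0..<n]))"
      by (simp add: comp_def)
  qed
  thus "computable n (\<lambda>xs. rec_nat 0 (\<lambda>m y. Suc (prod_encode (G (h xs - 1 - m) xs, y))) (h xs))"
    by (intro computable_rec_nat computable_intros h) auto
  have "list_encode (map (\<lambda>i. G i xs) [p - m..<p]) =
      rec_nat 0 (\<lambda>m y. Suc (prod_encode (G (p - 1 - m) xs, y))) m" if "m \<le> p" for m p xs
    using that
  proof (induction m)
    case (Suc m)
    hence "[p - Suc m..<p] = (p - Suc m) # [p - m..<p]"
      by (metis Suc_diff_Suc Suc_le_lessD diff_less upt_conv_Cons zero_less_Suc order_less_le_trans)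
    thus ?case using Suc by simp
  qed simp
  thus "list_encode (map (\<lambda>i. G i xs) [0..<h xs]) =
      rec_nat 0 (\<lambda>m y. Suc (prod_encode (G (h xs - 1 - m) xs, y))) (h xs)" for xs
    by (metis diff_self_eq_0 order_refl)
qed

section \<open>Integer-valued computable functions\<close>

text \<open>The difference is in no normal form, so sums and products need no case distinction on
  signs.\<close>

definition computable_int :: "nat \<Rightarrow> (nat list \<Rightarrow> int) \<Rightarrow> bool" where
  "computable_int n f \<longleftrightarrow> (\<exists>a b. computable n a \<and> computable n b \<and>
     (\<forall>xs. length xs = n \<longrightarrow> f xs = int (a xs) - int (b xs)))"

lemma computable_intI:
  assumes "computable n a" "computable n b"
    "\<And>xs. length xs = n \<Longrightarrow> f xs = int (a xs) - int (b xs)"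
  shows "computable_int n f"
  using assms unfolding computable_int_def by blast

lemma computable_int_of_nat: "computable n a \<Longrightarrow> computable_int n (\<lambda>xs. int (a xs))"
  by (rule computable_intI[of _ a "\<lambda>_. 0"]) (auto intro: computable_const)

lemma computable_int_add:
  assumes "computable_int n f" "computable_int n g"
  shows "computable_int n (\<lambda>xs. f xs + g xs)"
proof -
  obtain a b c d where *: "computable n a" "computable n b" "computable n c" "computable n d"
    "\<And>xs. length xs = n \<Longrightarrow> f xs = int (a xs) - int (b xs)"
    "\<And>xs. length xs = n \<Longrightarrow> g xs = int (c xs) - int (d xs)"
    using assms unfolding computable_int_def by blast
  show ?thesis
    by (rule computable_intI[of _ "\<lambda>xs. a xs + c xs" "\<lambda>xs. b xs + d xs"])
      (auto simp: * intro!: computable_add *(1-4))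
qed

lemma computable_int_minus:
  assumes "computable_int n f" shows "computable_int n (\<lambda>xs. - f xs)"
proof -
  obtain a b where *: "computable n a" "computable n b"
    "\<And>xs. length xs = n \<Longrightarrow> f xs = int (a xs) - int (b xs)"
    using assms unfolding computable_int_def by blast
  show ?thesis by (rule computable_intI[OF *(2,1)]) (simp add: *(3))
qed

lemma computable_int_diff:
  assumes "computable_int n f" "computable_int n g"
  shows "computable_int n (\<lambda>xs. f xs - g xs)"
  using computable_int_add[OF assms(1) computable_int_minus[OF assms(2)]] by simp

lemma computable_int_mult:
  assumes "computable_int n f" "computable_int n g"
  shows "computable_int n (\<lambda>xs. f xs * g xs)"
proof -
  obtain a b c d where *: "computable n a" "computable n b" "computable n c" "computable n d"
    "\<And>xs. length xs = n \<Longrightarrow> f xs = int (a xs) - int (b xs)"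
    "\<And>xs. length xs = n \<Longrightarrow> g xs = int (c xs) - int (d xs)"
    using assms unfolding computable_int_def by blast
  show ?thesis
    by (rule computable_intI[of _ "\<lambda>xs. a xs * c xs + b xs * d xs" "\<lambda>xs. a xs * d xs + b xs * c xs"])
      (auto simp: * algebra_simps intro!: computable_add computable_mult *(1-4))
qed

lemma computable_int_sum:
  fixes G :: "nat \<Rightarrow> nat list \<Rightarrow> int"
  assumes "computable n h" "computable_int (Suc n) (\<lambda>ys. G (ys ! 0) (drop 1 ys))"
  shows "computable_int n (\<lambda>xs. \<Sum>i<h xs. G i xs)"
proof -
  obtain a b where *: "computable (Suc n) a" "computable (Suc n) b"
    "\<And>ys. length ys = Suc n \<Longrightarrow> G (ys ! 0) (drop 1 ys) = int (a ys) - int (b ys)"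
    using assms(2) unfolding computable_int_def by blast
  have c: "computable n (\<lambda>xs. \<Sum>i<h xs. a (i # xs))" if "computable (Suc n) a" for a
  proof (rule computable_sum[OF assms(1)])
    show "computable (Suc n) (\<lambda>ys. a (ys ! 0 # drop 1 ys))"
    proof (rule computable_cong[OF that])
      fix ys :: "nat list" assume "length ys = Suc n"
      thus "a (ys ! 0 # drop 1 ys) = a ys" by (cases ys) auto
    qed
  qed
  show ?thesis
  proof (rule computable_intI[OF c[OF *(1)] c[OF *(2)]])
    fix xs :: "nat list" assume "length xs = n"
    hence "G i xs = int (a (i # xs)) - int (b (i # xs))" for i
      using *(3)[of "i # xs"] by simp
    thus "(\<Sum>i<h xs. G i xs) = int (\<Sum>i<h xs. a (i # xs)) - int (\<Sum>i<h xs. b (i # xs))"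
      by (simp add: sum_subtractf)
  qed
qed

lemma computable_int_if:
  assumes "decides n P" "computable_int n f" "computable_int n g"
  shows "computable_int n (\<lambda>xs. if P xs then f xs else g xs)"
proof -
  obtain a b c d where *: "computable n a" "computable n b" "computable n c" "computable n d"
    "\<And>xs. length xs = n \<Longrightarrow> f xs = int (a xs) - int (b xs)"
    "\<And>xs. length xs = n \<Longrightarrow> g xs = int (c xs) - int (d xs)"
    using assms unfolding computable_int_def by blast
  show ?thesis
    by (rule computable_intI[OF computable_if[OF assms(1) *(1,3)] computable_if[OF assms(1) *(2,4)]])
      (simp add: *)
qed

lemma int_decode_eq:
  "int_decode c = int (if c mod 2 = 0 then c div 2 else 0) - int (if c mod 2 = 0 then 0 else Suc (c div 2))"
  unfolding int_decode_def sum_decode_def by auto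

lemma computable_int_decode: "computable n a \<Longrightarrow> computable_int n (\<lambda>xs. int_decode (a xs))"
  by (rule computable_intI[OF _ _ int_decode_eq]) (intro computable_intros; assumption)+

lemma computable_int_encode:
  assumes "computable_int n f" shows "computable n (\<lambda>xs. int_encode (f xs))"
proof -
  obtain a b where *: "computable n a" "computable n b"
    "\<And>xs. length xs = n \<Longrightarrow> f xs = int (a xs) - int (b xs)"
    using assms unfolding computable_int_def by blast
  show ?thesis
  proof (rule computable_cong)
    show "computable n (\<lambda>xs. if b xs \<le> a xs then 2 * (a xs - b xs) else Suc (2 * (b xs - a xs - 1)))"
      by (intro computable_intros *(1,2))
    show "int_encode (f xs) =
        (if b xs \<le> a xs then 2 * (a xs - b xs) else Suc (2 * (b xs - a xs - 1)))"
      if "length xs = n" for xs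
      unfolding int_encode_def sum_encode_def *(3)[OF that] by (auto simp: nat_diff_distrib)
  qed
qed

lemma decides_int_eq:
  assumes "computable_int n f" "computable_int n g" shows "decides n (\<lambda>xs. f xs = g xs)"
proof -
  obtain a b c d where *: "computable n a" "computable n b" "computable n c" "computable n d"
    "\<And>xs. length xs = n \<Longrightarrow> f xs = int (a xs) - int (b xs)"
    "\<And>xs. length xs = n \<Longrightarrow> g xs = int (c xs) - int (d xs)"
    using assms unfolding computable_int_def by blast
  have "decides n (\<lambda>xs. a xs + d xs = c xs + b xs)" by (intro computable_intros *(1-4))
  thus ?thesis by (rule decides_cong) (simp add: *(5,6), linarith)
qed

lemma computable_nat_abs:
  assumes "computable_int n f" shows "computable n (\<lambda>xs. nat \<bar>f xs\<bar>)"
proof -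
  obtain a b where *: "computable n a" "computable n b"
    "\<And>xs. length xs = n \<Longrightarrow> f xs = int (a xs) - int (b xs)"
    using assms unfolding computable_int_def by blast
  show ?thesis
  proof (rule computable_cong)
    show "computable n (\<lambda>xs. (a xs - b xs) + (b xs - a xs))"
      by (intro computable_intros *(1,2))
    show "nat \<bar>f xs\<bar> = (a xs - b xs) + (b xs - a xs)" if "length xs = n" for xs
      unfolding *(3)[OF that] by auto
  qed
qed

lemma computable_int_const: "computable_int n (\<lambda>xs. c)"
  by (rule computable_intI[of _ "\<lambda>_. nat c" "\<lambda>_. nat (- c)"]) (auto intro: computable_const)

lemmas computable_int_intros = computable_int_const computable_int_of_nat computable_int_add
  computable_int_minus computable_int_diff computable_int_mult computable_int_sum computable_int_if
  computable_int_decode computable_int_encode decides_int_eq computable_nat_abs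
  computable_code_drop computable_code_nth computable_code_length computable_tabulate

lemma computable_int_comp:
  assumes f: "computable_int (length gs) f" and gs: "\<And>g. g \<in> set gs \<Longrightarrow> computable n g"
  shows "computable_int n (\<lambda>xs. f (map (\<lambda>g. g xs) gs))"
proof -
  obtain a b where *: "computable (length gs) a" "computable (length gs) b"
    "\<And>xs. length xs = length gs \<Longrightarrow> f xs = int (a xs) - int (b xs)"
    using f unfolding computable_int_def by blast
  show ?thesis
    by (rule computable_intI[OF computable_comp[OF *(1) gs] computable_comp[OF *(2) gs]])
      (auto simp: *(3))
qed

text \<open>Two complementary semi-decisions in one unbounded search: the least candidate confirming
  either side is found, and evaluating \<open>V\<close> there tells which side it is.\<close>

lemma decision_by_search:
  assumes V: "decides 2 (\<lambda>xs. V (xs ! 0) (xs ! 1))" and B: "decides 2 (\<lambda>xs. B (xs ! 0) (xs ! 1))"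
    and eq: "\<And>e. (\<exists>c. B c e) \<longleftrightarrow> \<not> (\<exists>c. V c e)"
  shows "\<exists>f. \<forall>e. rec_eval f [e] (if \<exists>c. V c e then 1 else 0)"
proof -
  have "computable 2 (\<lambda>xs. if V (xs ! 0) (xs ! 1) \<or> B (xs ! 0) (xs ! 1) then 0 else 1)"
    by (intro computable_intros V B)
  then obtain r where r: "\<And>c e. rec_eval r [c, e] (if V c e \<or> B c e then 0 else 1)"
    unfolding computable_def by (metis One_nat_def length_Cons list.size(3) nth_Cons_0 nth_Cons_Suc numeral_2_eq_2)
  obtain v where v: "\<And>c e. rec_eval v [c, e] (of_bool (V c e))"
    using V unfolding decides_def computable_def
    by (metis One_nat_def length_Cons list.size(3) nth_Cons_0 nth_Cons_Suc numeral_2_eq_2)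
  have "rec_eval (Comp v [Mu r, Proj 0]) [e] (if \<exists>c. V c e then 1 else 0)" for e
  proof -
    have ex: "\<exists>c. V c e \<or> B c e" using eq by blast
    define c where "c = (LEAST c. V c e \<or> B c e)"
    have c: "V c e \<or> B c e" unfolding c_def by (rule LeastI_ex[OF ex])
    have less: "\<not> (V m e \<or> B m e)" if "m < c" for m using that not_less_Least unfolding c_def by blast
    have "rec_eval (Mu r) [e] c"
    proof (rule rec_eval.mu)
      show "rec_eval r [c, e] 0" using r[of c e] c by simp
      show "\<forall>m<c. \<exists>y. rec_eval r [m, e] (Suc y)"
      proof (intro allI impI)
        fix m assume "m < c"
        thus "\<exists>y. rec_eval r [m, e] (Suc y)" using r[of m e] less[of m] by (intro exI[of _ 0]) simp
      qed
    qed
    moreover have "rec_eval (Proj 0) [e] e" using rec_eval.proj[of 0 "[e]"] by simp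
    ultimately have "rec_eval (Comp v [Mu r, Proj 0]) [e] (of_bool (V c e))"
      by (intro rec_eval.comp[where ys = "[c, e]"] v) simp
    moreover have "V c e \<longleftrightarrow> (\<exists>c. V c e)" using c eq by blast
    ultimately show ?thesis by (cases "V c e") auto
  qed
  thus ?thesis by blast
qed

section \<open>The decision procedure for integer systems\<close>

text \<open>With words as base \<open>k\<close> numbers, quantifying over all words of a given
  length becomes bounded quantification over numbers.\<close>

definition digit :: "nat \<Rightarrow> nat \<Rightarrow> nat \<Rightarrow> nat" where
  "digit k c t = c div k ^ t mod k"

lemma digits_exist:
  "(\<And>t. t < m \<Longrightarrow> f t < k) \<Longrightarrow> \<exists>c<k ^ m. \<forall>t<m. digit k c t = f t"
proof (induction m)
  case (Suc m)
  then obtain c where c: "c < k ^ m" "\<forall>t<m. digit k c t = f t" by auto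
  have k: "k > 0" using Suc.prems[of m] by simp
  define d where "d = c + f m * k ^ m"
  have "d < k ^ Suc m"
  proof -
    have "d < (f m + 1) * k ^ m" unfolding d_def using c(1) by simp
    also have "\<dots> \<le> k * k ^ m" using Suc.prems[of m] by (intro mult_right_mono) auto
    finally show ?thesis by simp
  qed
  moreover have "digit k d t = f t" if "t < Suc m" for t
  proof (cases "t = m")
    case True
    have "d div k ^ m = f m" unfolding d_def using c(1) k by simp
    thus ?thesis unfolding digit_def True using Suc.prems[of m] by simp
  next
    case False
    hence t: "t < m" using that by simp
    have "f m * k ^ m = f m * k ^ (m - Suc t) * k * k ^ t"
    proof -
      have "k ^ m = k ^ (m - Suc t) * (k * k ^ t)"
        using t by (metis Suc_leI le_add_diff_inverse2 power_Suc power_add)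
      thus ?thesis by simp
    qed
    hence "d = c + f m * k ^ (m - Suc t) * k * k ^ t" unfolding d_def by (simp only:)
    hence "d div k ^ t = c div k ^ t + f m * k ^ (m - Suc t) * k" using k by simp
    thus ?thesis using c(2) t unfolding digit_def by simp
  qed
  ultimately show ?case by blast
qed simp

lemma zero_period_strided:
  "l > 0 \<Longrightarrow> zero_period (m * l) (strided l c) = fact ((2 * nat \<bar>c 0 * c m\<bar> + 1) ^ (m * l))"
  unfolding zero_period_def strided_def by simp

lemma decides_comp:
  assumes "decides (length gs) P" "\<And>g. g \<in> set gs \<Longrightarrow> computable n g"
  shows "decides n (\<lambda>xs. P (map (\<lambda>g. g xs) gs))"
  using computable_comp[OF assms[unfolded decides_def]] unfolding decides_def by simp

lemma computable_int_comp2: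
  assumes "computable_int 2 (\<lambda>ys. f (ys ! 0) (ys ! 1))" "computable n a" "computable n b"
  shows "computable_int n (\<lambda>xs. f (a xs) (b xs))"
  using computable_int_comp[of "[a, b]" "\<lambda>ys. f (ys ! 0) (ys ! 1)" n] assms
  by (auto simp: eval_nat_numeral)

lemma computable_int_comp4:
  assumes "computable_int 4 (\<lambda>ys. f (ys ! 0) (ys ! 1) (ys ! 2) (ys ! 3))"
    "computable n a" "computable n b" "computable n c" "computable n d"
  shows "computable_int n (\<lambda>xs. f (a xs) (b xs) (c xs) (d xs))"
  using computable_int_comp[of "[a, b, c, d]" "\<lambda>ys. f (ys ! 0) (ys ! 1) (ys ! 2) (ys ! 3)" n] assms
  by (auto simp: eval_nat_numeral)

text \<open>The first argument of every parameter is the code of an instance.\<close>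

locale computable_system =
  fixes k D T :: "nat \<Rightarrow> nat" and A :: "nat \<Rightarrow> nat \<Rightarrow> nat \<Rightarrow> nat \<Rightarrow> int"
    and x0 :: "nat \<Rightarrow> nat \<Rightarrow> int" and K :: "nat \<Rightarrow> nat \<Rightarrow> nat \<Rightarrow> nat \<Rightarrow> int"
  assumes k: "computable 1 (\<lambda>xs. k (xs ! 0))" and D: "computable 1 (\<lambda>xs. D (xs ! 0))"
    and T: "computable 1 (\<lambda>xs. T (xs ! 0))"
    and A: "computable_int 4 (\<lambda>xs. A (xs ! 0) (xs ! 1) (xs ! 2) (xs ! 3))"
    and x0: "computable_int 2 (\<lambda>xs. x0 (xs ! 0) (xs ! 1))"
    and K: "computable_int 4 (\<lambda>xs. K (xs ! 0) (xs ! 1) (xs ! 2) (xs ! 3))"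
begin

sublocale sys: int_system "k e" "D e" "T e" "A e" "x0 e" "K e" for e .

lemmas system_intros = computable_comp1[OF k] computable_comp1[OF D] computable_comp1[OF T]
  computable_int_comp4[OF A] computable_int_comp2[OF x0] computable_int_comp4[OF K]

definition letter :: "nat \<Rightarrow> nat \<Rightarrow> nat \<Rightarrow> nat \<Rightarrow> nat \<Rightarrow> nat" where
  "letter e v s l = lasso (digit (k e) v) s l"

text \<open>All coordinates share one list code because primitive recursion carries a single number
  from step to step.\<close>

definition state_code :: "nat \<Rightarrow> nat \<Rightarrow> nat \<Rightarrow> nat \<Rightarrow> nat \<Rightarrow> nat" where
  "state_code e v s l t = rec_nat (list_encode (map (\<lambda>i. int_encode (x0 e i)) [0..<D e]))
     (\<lambda>n y. list_encode (map (\<lambda>i. int_encode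
        (\<Sum>j<D e. A e (letter e v s l n) i j * int_decode (code_nth y j))) [0..<D e])) t"

definition state_entry :: "nat \<Rightarrow> nat \<Rightarrow> nat \<Rightarrow> nat \<Rightarrow> nat \<Rightarrow> nat \<Rightarrow> int" where
  "state_entry e v s l t i = int_decode (code_nth (state_code e v s l t) i)"

definition target_test :: "nat \<Rightarrow> nat \<Rightarrow> nat \<Rightarrow> nat \<Rightarrow> nat \<Rightarrow> nat \<Rightarrow> bool" where
  "target_test e v s l t \<tau> \<longleftrightarrow> (\<forall>i<D e. (\<Sum>j<D e. K e \<tau> i j * state_entry e v s l t j) = 0)"

lemma state_code: "state_code e v s l t =
    list_encode (map (\<lambda>i. int_encode (sys.state e (letter e v s l) t i)) [0..<D e])"
proof (induction t)
  case 0
  show ?case unfolding sys.state_0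
    by (auto simp: state_code_def sys.start_def intro!: arg_cong[where f = list_encode])
next
  case (Suc t)
  let ?c = "state_code e v s l t"
  have "state_code e v s l (Suc t) = list_encode (map (\<lambda>i. int_encode
        (\<Sum>j<D e. A e (letter e v s l t) i j * int_decode (code_nth ?c j))) [0..<D e])"
    by (simp add: state_code_def)
  moreover have "int_decode (code_nth ?c j) = sys.state e (letter e v s l) t j" if "j < D e" for j
    unfolding Suc using that by (simp add: code_nth_encode)
  ultimately show ?case
    by (auto simp: sys.state_Suc sys.step_def intro!: arg_cong[where f = list_encode] sum.cong
        arg_cong[where f = int_encode])
qed

lemma state_entry: "i < D e \<Longrightarrow> state_entry e v s l t i = sys.state e (letter e v s l) t i"
  unfolding state_entry_def state_code by (simp add: code_nth_encode)

lemma target_test: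
  "target_test e v s l t \<tau> \<longleftrightarrow> sys.in_target e \<tau> (sys.state e (letter e v s l) t)"
  unfolding target_test_def sys.in_target_def by (simp add: state_entry)

lemma computable_state_code: "computable 5 (\<lambda>ys. state_code (ys ! 0) (ys ! 1) (ys ! 2) (ys ! 3) (ys ! 4))"
  unfolding state_code_def letter_def lasso_def digit_def
  by (intro computable_rec_nat system_intros computable_intros computable_int_intros) simp_all

lemma computable_state_entry:
  assumes "computable n e" "computable n v" "computable n s" "computable n l" "computable n t"
    "computable n i"
  shows "computable_int n (\<lambda>xs. state_entry (e xs) (v xs) (s xs) (l xs) (t xs) (i xs))"
proof -
  have "computable n (\<lambda>xs. state_code (e xs) (v xs) (s xs) (l xs) (t xs))"
    using computable_comp[of "[e, v, s, l, t]"
        "\<lambda>ys. state_code (ys ! 0) (ys ! 1) (ys ! 2) (ys ! 3) (ys ! 4)" n]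
      computable_state_code assms by (auto simp: eval_nat_numeral)
  thus ?thesis unfolding state_entry_def by (intro computable_int_intros assms)
qed

lemma decides_target_test:
  assumes "computable n e" "computable n v" "computable n s" "computable n l" "computable n t"
    "computable n \<tau>"
  shows "decides n (\<lambda>xs. target_test (e xs) (v xs) (s xs) (l xs) (t xs) (\<tau> xs))"
proof -
  have "decides 6 (\<lambda>ys. target_test (ys ! 0) (ys ! 1) (ys ! 2) (ys ! 3) (ys ! 4) (ys ! 5))"
    unfolding target_test_def
    by (intro system_intros computable_intros computable_int_intros computable_state_entry) simp_all
  thus ?thesis
    using decides_comp[of "[e, v, s, l, t, \<tau>]"
        "\<lambda>ys. target_test (ys ! 0) (ys ! 1) (ys ! 2) (ys ! 3) (ys ! 4) (ys ! 5)" n] assms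
    by (auto simp: eval_nat_numeral)
qed

section \<open>The two tests behind the search\<close>

text \<open>The words \<open>v\<close> and \<open>w\<close> of \<open>bounded_hits\<close> are the
  first \<open>n\<close> and the next \<open>N\<close> digits of one number. The loop length 1 is a
  dummy, since only letters of the stem are read.\<close>

definition valid_test :: "nat \<Rightarrow> nat \<Rightarrow> bool" where
  "valid_test N e \<longleftrightarrow> (\<forall>n<Suc (D e ^ (N * T e)). \<forall>v<k e ^ (n + N). \<exists>j<N. \<exists>\<tau><T e.
     target_test e v (n + N) 1 (n + j) \<tau>)"

lemma decides_valid_test: "decides 2 (\<lambda>xs. valid_test (xs ! 0) (xs ! 1))"
  unfolding valid_test_def
  by (intro system_intros computable_intros decides_target_test) simp_all

lemma valid_test: "valid_test N e \<longleftrightarrow> sys.bounded_hits e N"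
proof
  assume *: "valid_test N e"
  show "sys.bounded_hits e N"
    unfolding sys.bounded_hits_short
  proof (intro allI impI, elim conjE)
    fix v w assume v: "sys.word e v" "length v \<le> D e ^ (N * T e)" and w: "sys.word e w" "length w = N"
    have "(v @ w) ! t < k e" if "t < length v + N" for t
    proof -
      have "(v @ w) ! t \<in> set (v @ w)" using that w by (intro nth_mem) simp
      thus ?thesis using v w unfolding sys.word_def by auto
    qed
    then obtain c where c: "c < k e ^ (length v + N)" "\<forall>t<length v + N. digit (k e) c t = (v @ w) ! t"
      using digits_exist by blast
    then obtain j \<tau> where j: "j < N" "\<tau> < T e" "target_test e c (length v + N) 1 (length v + j) \<tau>"
      using * v(2) unfolding valid_test_def by (metis le_imp_less_Suc)
    have "map (letter e c (length v + N) 1) [0..<length v + j] = v @ take j w"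
      using c(2) j(1) w(2) by (intro nth_equalityI) (auto simp: letter_def lasso_def nth_append)
    thus "\<exists>j<N. sys.hit e (fold (sys.step e) (v @ take j w) (sys.start e))"
      using j unfolding target_test sys.state_def sys.hit_def by auto
  qed
next
  assume *: "sys.bounded_hits e N"
  show "valid_test N e"
    unfolding valid_test_def
  proof (intro allI impI)
    fix n c assume c: "c < k e ^ (n + N)"
    let ?l = "letter e c (n + N) 1"
    \<comment> \<open>Digits are letters as soon as there is a letter; without letters only the
      empty word has a code in range.\<close>
    have "k e > 0 \<or> n + N = 0" using c by (cases "k e = 0") (auto simp: power_0_left split: if_splits)
    hence "sys.word e (map ?l [0..<n])" "sys.word e (map ?l [n..<n + N])"
      unfolding sys.word_def letter_def lasso_def digit_def by auto
    then obtain j where j: "j < N"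
      "sys.hit e (fold (sys.step e) (map ?l [0..<n] @ take j (map ?l [n..<n + N])) (sys.start e))"
      using * unfolding sys.bounded_hits_def by (metis diff_add_inverse length_map length_upt)
    have "map ?l [0..<n] @ take j (map ?l [n..<n + N]) = map ?l [0..<n + j]"
      using j(1) by (intro nth_equalityI) (auto simp: nth_append)
    thus "\<exists>j<N. \<exists>\<tau><T e. target_test e c (n + N) 1 (n + j) \<tau>"
      using j unfolding target_test sys.state_def sys.hit_def by auto
  qed
qed

text \<open>The condition \<open>k e > 0\<close> guarantees that all digits are letters.
  Coefficients and period are arguments so that both can be decoded from one number later.\<close>

definition certificate_test ::
  "nat \<Rightarrow> nat \<Rightarrow> nat \<Rightarrow> nat \<Rightarrow> (nat \<Rightarrow> int) \<Rightarrow> nat \<Rightarrow> nat \<Rightarrow> nat \<Rightarrow> bool" where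
  "certificate_test v s l m c N b e \<longleftrightarrow> k e > 0 \<and> l > 0 \<and> c 0 \<noteq> 0 \<and> c m \<noteq> 0 \<and>
     (\<forall>i<D e. (\<Sum>j<Suc m. c j * state_entry e v s l (s + j * l) i) = 0) \<and>
     (\<forall>a<b. \<forall>\<tau><T e. \<exists>n<N. \<not> target_test e v s l (s + a + b * n) \<tau>)"

definition invalid_test :: "nat \<Rightarrow> nat \<Rightarrow> bool" where
  "invalid_test q e \<longleftrightarrow> certificate_test (code_nth q 0) (code_nth q 1) (code_nth q 2) (code_nth q 3)
     (\<lambda>j. int_decode (code_nth (code_nth q 4) j)) (code_nth q 5)
     (fact ((2 * nat \<bar>int_decode (code_nth (code_nth q 4) 0) *
        int_decode (code_nth (code_nth q 4) (code_nth q 3))\<bar> + 1) ^ (code_nth q 3 * code_nth q 2))) e"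

lemma decides_invalid_test: "decides 2 (\<lambda>xs. invalid_test (xs ! 0) (xs ! 1))"
  unfolding invalid_test_def certificate_test_def
  by (intro system_intros computable_intros computable_int_intros decides_target_test
      computable_state_entry) simp_all

lemma certificate_test:
  assumes "b = fact ((2 * nat \<bar>c 0 * c m\<bar> + 1) ^ (m * l))"
  shows "certificate_test v s l m c N b e \<longleftrightarrow>
    k e > 0 \<and> sys.miss_certificate e s l (letter e v s l) m c N"
proof (cases "l > 0")
  case True
  show ?thesis
    unfolding certificate_test_def sys.miss_certificate_def zero_period_strided[OF True]
      target_test assms[symmetric] lessThan_Suc_atMost using state_entry by auto
qed (simp add: certificate_test_def sys.miss_certificate_def)

lemma invalid_test_iff: "invalid_test q e \<longleftrightarrow> k e > 0 \<and>
    sys.miss_certificate e (code_nth q 1) (code_nth q 2)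
      (letter e (code_nth q 0) (code_nth q 1) (code_nth q 2)) (code_nth q 3)
      (\<lambda>j. int_decode (code_nth (code_nth q 4) j)) (code_nth q 5)"
  unfolding invalid_test_def by (rule certificate_test) (rule refl)

lemma invalid_test: "(\<exists>q. invalid_test q e) \<longleftrightarrow> \<not> sys.valid e"
proof
  assume "\<exists>q. invalid_test q e"
  then obtain v s l m c N where "k e > 0" "sys.miss_certificate e s l (letter e v s l) m c N"
    unfolding invalid_test_iff by blast
  thus "\<not> sys.valid e"
    by (intro sys.miss_certificate_sound[where f = "digit (k e) v"]) (auto simp: letter_def digit_def)
next
  assume "\<not> sys.valid e"
  hence "\<not> (\<exists>N. sys.bounded_hits e N)" by (simp add: sys.valid_iff_bounded_hits)
  then obtain f s l m c N where f: "\<And>t. t < s + l \<Longrightarrow> f t < k e"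
    and cert: "sys.miss_certificate e s l (lasso f s l) m c N"
    by (rule sys.miss_certificate_complete) (rule that)
  obtain v where v: "\<forall>t<s + l. digit (k e) v t = f t" using digits_exist f by blast
  have l: "l > 0" using cert unfolding sys.miss_certificate_def by blast
  have "k e > 0" using f[of 0] l by (cases "k e = 0") auto
  have eq: "letter e v s l = lasso f s l"
  proof
    fix t
    have "(if t < s + l then t else s + (t - s) mod l) < s + l" using l by auto
    thus "letter e v s l t = lasso f s l t" using v unfolding letter_def lasso_def by blast
  qed
  \<comment> \<open>Only the coefficients up to index \<open>m\<close> enter a certificate, so a
    finite list represents \<open>c\<close>; decoded values beyond \<open>m\<close> may differ from
    it.\<close>
  define cl where "cl = list_encode (map (\<lambda>j. int_encode (c j)) [0..<Suc m])"
  have cl: "int_decode (code_nth cl j) = c j" if "j \<le> m" for j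
    unfolding cl_def using that by (simp add: code_nth_encode del: upt_Suc)
  have c0: "strided l (\<lambda>j. int_decode (code_nth cl j)) 0 = strided l c 0"
    "strided l (\<lambda>j. int_decode (code_nth cl j)) (m * l) = strided l c (m * l)"
    unfolding strided_def using cl l by auto
  hence "zero_period (m * l) (strided l (\<lambda>j. int_decode (code_nth cl j))) = zero_period (m * l) (strided l c)"
    unfolding zero_period_def by simp
  hence "sys.miss_certificate e s l (letter e v s l) m (\<lambda>j. int_decode (code_nth cl j)) N"
    using cert cl unfolding sys.miss_certificate_def eq by simp
  moreover define q where "q = list_encode [v, s, l, m, cl, N]"
  have q: "code_nth q 0 = v" "code_nth q 1 = s" "code_nth q 2 = l" "code_nth q 3 = m"
    "code_nth q 4 = cl" "code_nth q 5 = N"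
    unfolding q_def by (subst code_nth_encode; simp)+
  ultimately have "invalid_test q e"
    using \<open>k e > 0\<close> unfolding invalid_test_iff q by blast
  thus "\<exists>q. invalid_test q e" ..
qed

theorem decision_procedure: "\<exists>f. \<forall>e. rec_eval f [e] (if sys.valid e then 1 else 0)"
proof -
  have V: "(\<exists>N. valid_test N e) \<longleftrightarrow> sys.valid e" for e
    unfolding valid_test sys.valid_iff_bounded_hits ..
  have "\<exists>f. \<forall>e. rec_eval f [e] (if \<exists>N. valid_test N e then 1 else 0)"
    by (rule decision_by_search[OF decides_valid_test decides_invalid_test])
      (simp add: V invalid_test)
  thus ?thesis unfolding V .
qed

end

section \<open>Supports and projections\<close>

text \<open>Polarisation: the form is real on the diagonal, and its values at v + w and v + i w
  settle the imaginary and the real part of the claim.\<close>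

lemma positive_mat_symmetric:
  assumes A: "positive_mat d A" and v: "v \<in> carrier_vec d" and w: "w \<in> carrier_vec d"
  shows "(A *\<^sub>v w) \<bullet>c v = cnj ((A *\<^sub>v v) \<bullet>c w)"
proof -
  have Ac: "A \<in> carrier_mat d d" using A unfolding positive_mat_def by blast
  define s where "s v w = (A *\<^sub>v v) \<bullet>c w" for v w
  have real: "Im (s v v) = 0" if "v \<in> carrier_vec d" for v
    using A that unfolding positive_mat_def s_def by (auto simp: less_eq_complex_def)
  have add: "s (a + b) c = s a c + s b c" "s c (a + b) = s c a + s c b"
    if "a \<in> carrier_vec d" "b \<in> carrier_vec d" "c \<in> carrier_vec d" for a b c
    unfolding s_def using that Ac
    by (simp_all add: mult_add_distrib_mat_vec[of _ d d] conjugate_add_vec[of _ d]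
        add_scalar_prod_distrib[of _ d] scalar_prod_add_distrib[of _ d])
  have smult: "s (x \<cdot>\<^sub>v a) c = x * s a c" "s c (x \<cdot>\<^sub>v a) = cnj x * s c a"
    if "a \<in> carrier_vec d" "c \<in> carrier_vec d" for a c x
    unfolding s_def using that Ac
    by (simp_all add: mult_mat_vec[of _ d d] conjugate_smult_vec)
  have "s (v + w) (v + w) = s v v + s w w + (s v w + s w v)"
    using v w by (simp add: add)
  hence 1: "Im (s v w + s w v) = 0" using real[of "v + w"] real[OF v] real[OF w] v w by simp
  have iw: "\<i> \<cdot>\<^sub>v w \<in> carrier_vec d" using w by simp
  have "s (v + \<i> \<cdot>\<^sub>v w) (v + \<i> \<cdot>\<^sub>v w) =
      s v v + s (\<i> \<cdot>\<^sub>v w) (\<i> \<cdot>\<^sub>v w) + (- \<i> * s v w + \<i> * s w v)"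
    using v w iw by (simp add: add smult complex_eq_iff)
  hence 2: "Im (- \<i> * s v w + \<i> * s w v) = 0"
    using real[of "v + \<i> \<cdot>\<^sub>v w"] real[OF v] real[OF iw] v iw by simp
  show ?thesis using 1 2 unfolding s_def[symmetric] by (simp add: complex_eq_iff)
qed

inductive_set eigen_sums :: "nat \<Rightarrow> complex mat \<Rightarrow> complex vec set" for d A where
  zero: "0\<^sub>v d \<in> eigen_sums d A"
| add: "w \<in> eigen_sums d A \<Longrightarrow> x \<in> carrier_vec d \<Longrightarrow> A *\<^sub>v x = \<mu> \<cdot>\<^sub>v x \<Longrightarrow> w + x \<in> eigen_sums d A"

lemma eigen_sums_carrier: "w \<in> eigen_sums d A \<Longrightarrow> w \<in> carrier_vec d"
  by (induction rule: eigen_sums.induct) auto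

locale positive_matrix =
  fixes d :: nat and A :: "complex mat"
  assumes A: "positive_mat d A"
begin

lemma A_carrier: "A \<in> carrier_mat d d"
  using A unfolding positive_mat_def by blast

definition shift :: "complex \<Rightarrow> complex vec \<Rightarrow> complex vec" where
  "shift k u = A *\<^sub>v u - k \<cdot>\<^sub>v u"

lemma shift_carrier [simp]: "u \<in> carrier_vec d \<Longrightarrow> shift k u \<in> carrier_vec d"
  unfolding shift_def using A_carrier by simp

lemma shift_add:
  "u \<in> carrier_vec d \<Longrightarrow> v \<in> carrier_vec d \<Longrightarrow> shift k (u + v) = shift k u + shift k v"
  unfolding shift_def using A_carrier
  by (intro eq_vecI) (auto simp: mult_add_distrib_mat_vec[of _ d d] algebra_simps)

text \<open>For Hermitian A, the kernels of (A - k)^2 and A - k agree. With y = (A - k) v,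
  positivity makes \<open>k\<close> real unless y = 0, and moving A across the inner product gives
  <y, y> = 0.\<close>

lemma shift_shift_zero:
  assumes v: "v \<in> carrier_vec d" and 0: "shift k (shift k v) = 0\<^sub>v d"
  shows "shift k v = 0\<^sub>v d"
proof -
  define y where "y = shift k v"
  have y: "y \<in> carrier_vec d" unfolding y_def using v by simp
  have Ay: "A *\<^sub>v y = k \<cdot>\<^sub>v y"
  proof (rule eq_vecI)
    fix i assume i: "i < dim_vec (k \<cdot>\<^sub>v y)"
    have "shift k y $ i = 0" using 0 i y unfolding y_def by simp
    thus "(A *\<^sub>v y) $ i = (k \<cdot>\<^sub>v y) $ i" using i y A_carrier unfolding shift_def by simp
  qed (use y A_carrier in auto)
  have "0 \<le> (A *\<^sub>v y) \<bullet>c y" using A y unfolding positive_mat_def by blast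
  hence "Im (k * (y \<bullet>c y)) = 0" unfolding Ay using y by (simp add: less_eq_complex_def)
  moreover have yy: "Im (y \<bullet>c y) = 0"
    using conjugate_square_ge_0_vec[of y] by (simp add: less_eq_complex_def)
  ultimately have k: "y = 0\<^sub>v d \<or> cnj k = k"
    using y conjugate_square_eq_0_vec[of y d] by (auto simp: complex_eq_iff)
  have "y \<bullet>c y = (A *\<^sub>v v) \<bullet>c y - k * (v \<bullet>c y)"
    unfolding y_def shift_def using v A_carrier y[unfolded y_def shift_def]
    by (simp add: minus_scalar_prod_distrib[of _ d])
  also have "(A *\<^sub>v v) \<bullet>c y = cnj ((A *\<^sub>v y) \<bullet>c v)"
    by (rule positive_mat_symmetric[OF A y v])
  also have "(A *\<^sub>v y) \<bullet>c v = k * (y \<bullet>c v)" unfolding Ay using v y by simp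
  also have "cnj (k * (y \<bullet>c v)) = cnj k * (v \<bullet>c y)"
  proof -
    have "cnj (conjugate y \<bullet> v) = y \<bullet>c v" using conjugate_conjugate_sprod[OF y v] by simp
    hence "cnj (y \<bullet>c v) = v \<bullet>c y"
      unfolding conjugate_vec_sprod_comm[OF v y] by (metis complex_cnj_cnj)
    thus ?thesis by simp
  qed
  finally have "y = 0\<^sub>v d \<or> y \<bullet>c y = 0" using k by auto
  thus ?thesis using y conjugate_square_eq_0_vec[of y d] unfolding y_def by auto
qed

text \<open>Eigenvectors for eigenvalues other than \<open>k\<close> lie in the range of A - k,
  those for \<open>k\<close> in its kernel.\<close>

lemma eigen_sums_split:
  assumes "w \<in> eigen_sums d A"
  shows "\<exists>s\<in>eigen_sums d A. \<exists>w0\<in>carrier_vec d. w = shift k s + w0 \<and> shift k w0 = 0\<^sub>v d"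
  using assms
proof (induction rule: eigen_sums.induct)
  case zero
  have "shift k (0\<^sub>v d) = 0\<^sub>v d" unfolding shift_def using A_carrier by auto
  thus ?case by (intro bexI[of _ "0\<^sub>v d"] eigen_sums.zero) auto
next
  case (add w x \<mu>)
  then obtain s w0 where s: "s \<in> eigen_sums d A" "w0 \<in> carrier_vec d" "w = shift k s + w0"
    "shift k w0 = 0\<^sub>v d" by blast
  have sc: "s \<in> carrier_vec d" using s(1) by (rule eigen_sums_carrier)
  have fx: "shift k x = (\<mu> - k) \<cdot>\<^sub>v x"
    unfolding shift_def add.hyps by (intro eq_vecI) (auto simp: algebra_simps)
  show ?case
  proof (cases "\<mu> = k")
    case True
    have "shift k x = 0\<^sub>v d" unfolding fx using True add.hyps by auto
    hence "shift k (w0 + x) = 0\<^sub>v d" using s add.hyps by (simp add: shift_add)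
    moreover have "w + x = shift k s + (w0 + x)" unfolding s(3)
      using s sc add.hyps by (intro assoc_add_vec[of _ d]) auto
    ultimately show ?thesis using s add.hyps by (intro bexI[of _ s] bexI[of _ "w0 + x"]) auto
  next
    case False
    define x' where "x' = (1 / (\<mu> - k)) \<cdot>\<^sub>v x"
    have x': "x' \<in> carrier_vec d" "A *\<^sub>v x' = \<mu> \<cdot>\<^sub>v x'"
      unfolding x'_def using add.hyps A_carrier
      by (auto simp: mult_mat_vec[of _ d d] smult_smult_assoc mult.commute)
    have "shift k x' = (\<mu> - k) \<cdot>\<^sub>v x'"
      unfolding shift_def x'(2) by (intro eq_vecI) (auto simp: algebra_simps)
    hence sx: "shift k x' = x" unfolding x'_def using False add.hyps by (auto simp: smult_smult_assoc)
    have "w + x = shift k (s + x') + w0"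
      unfolding s(3) shift_add[OF sc x'(1)] sx using s sc add.hyps
      by (intro eq_vecI) auto
    thus ?thesis using s x' by (intro bexI[of _ "s + x'"] bexI[of _ w0] eigen_sums.add) auto
  qed
qed

text \<open>Splitting (A - k) u as (A - k) s + w0 shows that (A - k)^2 kills u - s. Then A - k kills
  it too, so it may be added to s.\<close>

lemma shift_in_eigen_sums:
  assumes u: "u \<in> carrier_vec d" and w: "shift k u \<in> eigen_sums d A"
  shows "u \<in> eigen_sums d A"
proof -
  obtain s w0 where s: "s \<in> eigen_sums d A" "w0 \<in> carrier_vec d" "shift k u = shift k s + w0"
    "shift k w0 = 0\<^sub>v d" using eigen_sums_split[OF w] by blast
  have sc: "s \<in> carrier_vec d" using s(1) by (rule eigen_sums_carrier)
  define x where "x = u - s"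
  have x: "x \<in> carrier_vec d" "u = s + x" unfolding x_def using u sc by auto
  have e: "shift k s + shift k x = shift k s + w0" using s(3) shift_add[OF sc x(1)] x(2) by simp
  have "shift k x = w0"
  proof (rule eq_vecI)
    fix i assume i: "i < dim_vec w0"
    have "(shift k s + shift k x) $ i = (shift k s + w0) $ i" using e by simp
    thus "shift k x $ i = w0 $ i"
      using i s(2) carrier_vecD[OF shift_carrier[OF x(1)]] by (simp del: shift_carrier)
  qed (use s(2) shift_carrier[OF x(1)] in auto)
  hence "shift k (shift k x) = 0\<^sub>v d" using s(4) by simp
  hence 0: "shift k x = 0\<^sub>v d" by (rule shift_shift_zero[OF x(1)])
  have "A *\<^sub>v x = k \<cdot>\<^sub>v x"
  proof (rule eq_vecI)
    fix i assume "i < dim_vec (k \<cdot>\<^sub>v x)"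
    hence i: "i < d" using x(1) by simp
    have "shift k x $ i = 0" using 0 i by simp
    thus "(A *\<^sub>v x) $ i = (k \<cdot>\<^sub>v x) $ i" using i x(1) A_carrier unfolding shift_def by simp
  qed (use x(1) A_carrier in auto)
  thus ?thesis unfolding x(2) using s(1) x(1) by (intro eigen_sums.add)
qed

text \<open>Since \<open>A\<close> is triangularizable, \<open>(A - e\<^sub>1) \<dots> (A - e\<^sub>d) = 0\<close> for the diagonal
  entries; undoing the factors one by one keeps a vector in \<open>eigen_sums\<close>.\<close>

lemma eigen_sums_eq_carrier:
  assumes u: "u \<in> carrier_vec d" shows "u \<in> eigen_sums d A"
proof -
  obtain es where es: "char_poly A = (\<Prod>e\<leftarrow>es. [:- e, 1:])"
    using char_poly_factorized[OF A_carrier] by blast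
  obtain B P Q where "schur_decomposition A es = (B, P, Q)" by (metis prod_cases3)
  hence sim: "similar_mat_wit A B P Q" and ut: "upper_triangular B" and diag: "diag_mat B = es"
    using schur_decomposition[OF A_carrier es] by auto
  have c: "B \<in> carrier_mat d d" "P \<in> carrier_mat d d" "Q \<in> carrier_mat d d" "P * Q = 1\<^sub>m d"
    "Q * P = 1\<^sub>m d" "A = P * B * Q"
    using similar_mat_witD2[OF A_carrier sim] by auto
  \<comment> \<open>Induction along the flag of the Schur basis: subtracting the diagonal entry B_nn
    maps the first n + 1 coordinates into the first n.\<close>
  have main: "P *\<^sub>v v \<in> eigen_sums d A"
    if "v \<in> carrier_vec d" "n \<le> d" "\<And>j. n \<le> j \<Longrightarrow> j < d \<Longrightarrow> v $ j = 0" for n v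
    using that
  proof (induction n arbitrary: v)
    case 0
    hence "v = 0\<^sub>v d" by auto
    hence "P *\<^sub>v v = 0\<^sub>v d" using c(2) by auto
    thus ?case by (simp add: eigen_sums.zero)
  next
    case (Suc n)
    define k where "k = B $$ (n, n)"
    define v' where "v' = B *\<^sub>v v - k \<cdot>\<^sub>v v"
    have v': "v' \<in> carrier_vec d" unfolding v'_def using Suc.prems c by simp
    have "v' $ j = 0" if j: "n \<le> j" "j < d" for j
    proof -
      have "(B *\<^sub>v v) $ j = (\<Sum>i<d. B $$ (j, i) * v $ i)"
        using j Suc.prems c by (simp add: scalar_prod_def atLeast0LessThan)
      also have "\<dots> = (\<Sum>i<d. if i = n then B $$ (j, n) * v $ n else 0)"
      proof (rule sum.cong)
        fix i assume i: "i \<in> {..<d}"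
        show "B $$ (j, i) * v $ i = (if i = n then B $$ (j, n) * v $ n else 0)"
        proof (cases "i < n")
          case True
          hence "B $$ (j, i) = 0" using ut j c unfolding upper_triangular_def by auto
          thus ?thesis using True by simp
        next
          case False
          thus ?thesis using Suc.prems(3)[of i] i by (cases "i = n") auto
        qed
      qed simp
      also have "\<dots> = B $$ (j, n) * v $ n" using Suc.prems(2) by simp
      also have "\<dots> = k * v $ j"
      proof (cases "j = n")
        case True thus ?thesis by (simp add: k_def)
      next
        case False
        hence "B $$ (j, n) = 0" using ut j c unfolding upper_triangular_def by auto
        thus ?thesis using Suc.prems(3)[of j] j False by simp
      qed
      finally show ?thesis unfolding v'_def using j Suc.prems(1) c by simp
    qed
    hence "P *\<^sub>v v' \<in> eigen_sums d A" using v' Suc.prems(2) by (intro Suc.IH) auto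
    moreover have "shift k (P *\<^sub>v v) = P *\<^sub>v v'"
    proof -
      have "A *\<^sub>v (P *\<^sub>v v) = P *\<^sub>v (B *\<^sub>v ((Q * P) *\<^sub>v v))"
        unfolding c(6) using c(1-3) Suc.prems(1) by (simp add: assoc_mult_mat_vec[of _ d d _ d])
      hence "A *\<^sub>v (P *\<^sub>v v) = P *\<^sub>v (B *\<^sub>v v)" unfolding c(5) using Suc.prems(1) by simp
      thus ?thesis unfolding shift_def v'_def using c(1-3) Suc.prems(1)
        by (simp add: mult_minus_distrib_mat_vec[of _ d d] mult_mat_vec[of _ d d])
    qed
    ultimately have "shift k (P *\<^sub>v v) \<in> eigen_sums d A" by simp
    thus ?case by (rule shift_in_eigen_sums[rotated]) (use c(2) Suc.prems(1) in simp)
  qed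
  have "P *\<^sub>v (Q *\<^sub>v u) \<in> eigen_sums d A" using c(3) u by (intro main[of _ d]) auto
  moreover have "P *\<^sub>v (Q *\<^sub>v u) = u"
    using u unfolding assoc_mult_mat_vec[OF c(2,3) u, symmetric] c(4) by simp
  ultimately show ?thesis by simp
qed

end

text \<open>The subspace consists of the vectors fixed by \<open>P\<close>. If the eigenvectors with
  nonzero eigenvalue are fixed, so is A u for every sum u of eigenvectors, that is for all u.
  Conversely, A v = k v is fixed, hence v is.\<close>

lemma supp_subset_iff:
  assumes A: "positive_mat d A" and P: "projection d P"
  shows "supp d A \<subseteq> proj_subspace d P \<longleftrightarrow> P * A = A"
proof
  note Ac = positive_matrix.A_carrier[OF positive_matrix.intro[OF A]]
  have Pc: "P \<in> carrier_mat d d" "P * P = P" using P unfolding projection_def by auto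
  interpret vec_space "TYPE(complex)" d .
  define S where "S = {v. \<exists>k. k \<noteq> 0 \<and> eigenvector A v k}"
  have S: "S \<subseteq> carrier_vec d" unfolding S_def eigenvector_def using Ac by auto
  have fixed: "v \<in> proj_subspace d P \<longleftrightarrow> v \<in> carrier_vec d \<and> P *\<^sub>v v = v" for v
  proof
    assume "v \<in> proj_subspace d P"
    then obtain x where x: "x \<in> carrier_vec d" "v = P *\<^sub>v x" unfolding proj_subspace_def by blast
    thus "v \<in> carrier_vec d \<and> P *\<^sub>v v = v"
      using Pc by (simp flip: assoc_mult_mat_vec)
  next
    assume "v \<in> carrier_vec d \<and> P *\<^sub>v v = v"
    thus "v \<in> proj_subspace d P" unfolding proj_subspace_def by (metis imageI)
  qed
  {
    assume sub: "supp d A \<subseteq> proj_subspace d P"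
    have "S \<subseteq> supp d A" unfolding supp_def S_def[symmetric] using in_own_span[of S] S by simp
    hence eig: "P *\<^sub>v v = v" if "v \<in> S" for v using sub that fixed by blast
    have "P *\<^sub>v (A *\<^sub>v u) = A *\<^sub>v u" if "u \<in> eigen_sums d A" for u
      using that
    proof (induction rule: eigen_sums.induct)
      case zero
      have "A *\<^sub>v 0\<^sub>v d = 0\<^sub>v d" "P *\<^sub>v 0\<^sub>v d = 0\<^sub>v d" using Ac Pc by auto
      thus ?case by simp
    next
      case (add w x \<mu>)
      have w: "w \<in> carrier_vec d" using add.hyps(1) by (rule eigen_sums_carrier)
      have "P *\<^sub>v (A *\<^sub>v x) = A *\<^sub>v x"
      proof (cases "\<mu> = 0 \<or> x = 0\<^sub>v d")
        case True
        hence "A *\<^sub>v x = 0\<^sub>v d" using add.hyps by auto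
        thus ?thesis using Pc by auto
      next
        case False
        hence "x \<in> S" unfolding S_def eigenvector_def using add.hyps Ac by auto
        thus ?thesis using eig add.hyps Pc by (simp add: mult_mat_vec[of _ d d])
      qed
      thus ?case using add w Ac Pc by (simp add: mult_add_distrib_mat_vec[of _ d d])
    qed
    hence *: "(P * A) *\<^sub>v u = A *\<^sub>v u" if "u \<in> carrier_vec d" for u
      using positive_matrix.eigen_sums_eq_carrier[OF positive_matrix.intro[OF A] that] Ac Pc that by simp
    show "P * A = A"
    proof (rule eq_matI)
      fix i j assume ij: "i < dim_row A" "j < dim_col A"
      have unit: "(M *\<^sub>v unit_vec d j) $ i = M $$ (i, j)" if "M \<in> carrier_mat d d" for M :: "complex mat"
        using that ij Ac by simp
      show "(P * A) $$ (i, j) = A $$ (i, j)"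
        using *[of "unit_vec d j"] unit[OF Ac] unit[of "P * A"] Pc(1) Ac by simp
    qed (use Ac Pc in auto)
  }
  {
    assume PA: "P * A = A"
    have "S \<subseteq> proj_subspace d P"
    proof
      fix v assume "v \<in> S"
      then obtain k where k: "k \<noteq> 0" "v \<in> carrier_vec d" "A *\<^sub>v v = k \<cdot>\<^sub>v v"
        unfolding S_def eigenvector_def using Ac by auto
      have "P *\<^sub>v (A *\<^sub>v v) = A *\<^sub>v v" using PA k Pc Ac by (metis assoc_mult_mat_vec)
      hence "k \<cdot>\<^sub>v (P *\<^sub>v v) = k \<cdot>\<^sub>v v" unfolding k(3) using Pc k by (simp add: mult_mat_vec[of _ d d])
      hence "(1 / k) \<cdot>\<^sub>v (k \<cdot>\<^sub>v (P *\<^sub>v v)) = (1 / k) \<cdot>\<^sub>v (k \<cdot>\<^sub>v v)" by simp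
      hence "P *\<^sub>v v = v" using k(1) by (simp add: smult_smult_assoc)
      thus "v \<in> proj_subspace d P" using fixed k by blast
    qed
    moreover have "submodule class_ring (proj_subspace d P) V"
    proof (rule submodule.intro)
      show "Module.module class_ring V" by unfold_locales
      show "proj_subspace d P \<subseteq> carrier V" using fixed by auto
      show "\<zero>\<^bsub>V\<^esub> \<in> proj_subspace d P" unfolding fixed using Pc by auto
      show "v \<oplus>\<^bsub>V\<^esub> w \<in> proj_subspace d P"
        if "v \<in> proj_subspace d P" "w \<in> proj_subspace d P" for v w
        using that Pc unfolding fixed by (auto simp: mult_add_distrib_mat_vec[of _ d d])
      show "a \<odot>\<^bsub>V\<^esub> v \<in> proj_subspace d P"
        if "a \<in> carrier class_ring" "v \<in> proj_subspace d P" for a v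
        using that Pc unfolding fixed by (auto simp: mult_mat_vec[of _ d d])
    qed
    ultimately show "supp d A \<subseteq> proj_subspace d P"
      unfolding supp_def S_def[symmetric] by (intro span_is_subset) auto
  }
qed

section \<open>Translation of quantum automata\<close>

text \<open>The factor e! is the same for all entries of an instance, so linear equations between
  them keep their meaning.\<close>

definition scaled_rat :: "nat \<Rightarrow> nat \<Rightarrow> int" where
  "scaled_rat e q = int_decode (fst (prod_decode q)) *
     int (fact e div nat \<bar>int_decode (snd (prod_decode q))\<bar>)"

text \<open>All denominators occurring in an instance divide \<open>fact e\<close>, because they are at most its
  code \<open>e\<close>.\<close>

lemma scaled_rat:
  assumes "x \<in> \<rat>" "encode_rational x \<le> e"
  shows "of_int (scaled_rat e (encode_rational x)) = fact e * x"
proof -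
  obtain r where r: "x = of_rat r" using assms(1) Rats_cases by blast
  obtain p q where pq: "quotient_of r = (p, q)" by fastforce
  have the: "(THE s. of_rat s = x) = r" unfolding r by (rule the_equality) auto
  have enc: "encode_rational x = prod_encode (int_encode p, int_encode q)"
    unfolding encode_rational_def the pq by simp
  have q: "q > 0" using quotient_of_denom_pos[OF pq] .
  have "nat q \<le> int_encode q" using q unfolding int_encode_def sum_encode_def by auto
  also have "\<dots> \<le> e" using assms(2) le_prod_encode_2[of "int_encode q" "int_encode p"] unfolding enc by simp
  finally have "nat q dvd fact e" using q by (intro dvd_fact) auto
  hence "(of_nat (fact e div nat q) :: real) = fact e / of_int q"
    using q by (simp add: real_of_nat_div)
  moreover have "x = of_int p / of_int q"
    unfolding r quotient_of_div[OF pq] by (simp add: of_rat_divide)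
  ultimately show ?thesis
    unfolding scaled_rat_def enc using q by simp
qed

definition scaled_entry :: "nat \<Rightarrow> nat \<Rightarrow> nat \<Rightarrow> nat \<Rightarrow> nat \<Rightarrow> int" where
  "scaled_entry e M i j p = (if p = 0
     then scaled_rat e (fst (prod_decode (code_nth (code_nth M i) j)))
     else scaled_rat e (snd (prod_decode (code_nth (code_nth M i) j))))"

definition part :: "nat \<Rightarrow> complex \<Rightarrow> real" where
  "part p z = (if p = 0 then Re z else Im z)"

lemma mem_list_encode_le: "x \<in> set xs \<Longrightarrow> x \<le> list_encode xs"
proof (induction xs)
  case (Cons y ys)
  have "y \<le> prod_encode (y, list_encode ys)" "list_encode ys \<le> prod_encode (y, list_encode ys)"
    by (rule le_prod_encode_1, rule le_prod_encode_2)
  thus ?case using Cons by auto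
qed simp

lemma scaled_entry:
  assumes M: "rational_mat M" "M \<in> carrier_mat n m" and ij: "i < n" "j < m"
    and e: "encode_mat M \<le> e"
  shows "of_int (scaled_entry e (encode_mat M) i j p) = fact e * part p (M $$ (i, j))"
proof -
  define row where "row = (\<lambda>i. list_encode [encode_complex (M $$ (i, j)). j \<leftarrow> [0..<m]])"
  have enc: "encode_mat M = list_encode (map row [0..<n])"
    unfolding encode_mat_def row_def using M(2) by simp
  have "code_nth (code_nth (encode_mat M) i) j = encode_complex (M $$ (i, j))"
    unfolding enc using ij by (simp add: code_nth_encode) (simp add: row_def code_nth_encode ij)
  hence nth: "code_nth (code_nth (encode_mat M) i) j =
      prod_encode (encode_rational (Re (M $$ (i, j))), encode_rational (Im (M $$ (i, j))))"
    unfolding encode_complex_def .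
  have "encode_complex (M $$ (i, j)) \<le> row i"
    unfolding row_def using ij by (intro mem_list_encode_le) auto
  also have "row i \<le> list_encode (map row [0..<n])"
    using ij by (intro mem_list_encode_le) auto
  also have "\<dots> \<le> e" using e unfolding enc .
  finally have "encode_rational (Re (M $$ (i, j))) \<le> e" "encode_rational (Im (M $$ (i, j))) \<le> e"
    unfolding encode_complex_def using le_prod_encode_1 le_prod_encode_2 le_trans by blast+
  moreover have "Re (M $$ (i, j)) \<in> \<rat>" "Im (M $$ (i, j)) \<in> \<rat>"
    using M ij unfolding rational_mat_def by auto
  ultimately show ?thesis
    unfolding scaled_entry_def part_def nth by (simp add: scaled_rat)
qed

text \<open>A complex matrix of size \<open>d\<close> becomes a real vector with index \<open>l = 2 * (i * d + j) + p\<close>,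
  where \<open>p\<close> selects the real or the imaginary part of the entry \<open>(i, j)\<close>.  Multiplication by a
  complex scalar \<open>c\<close> is then the \<open>2 \<times> 2\<close> matrix \<open>mult_part\<close>.\<close>

definition mult_part :: "nat \<Rightarrow> nat \<Rightarrow> complex \<Rightarrow> real" where
  "mult_part p' p c = (if p' = p then Re c else if p' = 0 then - Im c else Im c)"

definition scaled_mult :: "nat \<Rightarrow> nat \<Rightarrow> nat \<Rightarrow> nat \<Rightarrow> nat \<Rightarrow> nat \<Rightarrow> int" where
  "scaled_mult e M i j p' p = (if p' = p then scaled_entry e M i j 0
     else if p' = 0 then - scaled_entry e M i j 1 else scaled_entry e M i j 1)"

lemma scaled_mult:
  assumes "rational_mat M" "M \<in> carrier_mat n m" "i < n" "j < m" "encode_mat M \<le> e"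
  shows "of_int (scaled_mult e (encode_mat M) i j p' p) = fact e * mult_part p' p (M $$ (i, j))"
  unfolding scaled_mult_def mult_part_def using scaled_entry[OF assms] by (simp add: part_def)

lemma part_sum_mult:
  assumes "p' < 2"
  shows "part p' (\<Sum>m<n. c m * z m) =
    (\<Sum>l<2 * n. mult_part p' (l mod 2) (c (l div 2)) * part (l mod 2) (z (l div 2)))"
proof (induction n)
  case (Suc n)
  have "p' = 0 \<or> p' = 1" using assms by auto
  hence "part p' (c n * z n) = mult_part p' 0 (c n) * part 0 (z n) + mult_part p' 1 (c n) * part 1 (z n)"
    by (auto simp: part_def mult_part_def)
  moreover have "part p' (a + b) = part p' a + part p' b" for a b
    by (simp add: part_def)
  ultimately show ?case using Suc by (simp add: numeral_2_eq_2[symmetric])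
qed (simp add: part_def)

lemma sum_div_mod:
  fixes f :: "nat \<Rightarrow> nat \<Rightarrow> 'a::comm_monoid_add"
  shows "(\<Sum>m<n * d. f (m div d) (m mod d)) = (\<Sum>i<n. \<Sum>j<d. f i j)"
proof (cases "d = 0")
  case False
  have "(\<Sum>m<n * d. f (m div d) (m mod d)) = (\<Sum>(i, j)\<in>{..<n} \<times> {..<d}. f i j)"
  proof (rule sum.reindex_bij_witness[of _ "\<lambda>(i, j). i * d + j" "\<lambda>m. (m div d, m mod d)"])
    fix a assume "a \<in> {..<n * d}"
    thus "(a div d, a mod d) \<in> {..<n} \<times> {..<d}"
      using False by (simp add: less_mult_imp_div_less)
  next
    fix b assume b: "b \<in> {..<n} \<times> {..<d}"
    obtain i j where ij: "b = (i, j)" "i < n" "j < d" using b by auto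
    have "i * d + j < (i + 1) * d" using ij by simp
    also have "\<dots> \<le> n * d" using ij by (intro mult_right_mono) auto
    finally show "(case b of (i, j) \<Rightarrow> i * d + j) \<in> {..<n * d}" unfolding ij by simp
  qed auto
  thus ?thesis by (simp add: sum.cartesian_product)
qed simp

text \<open>Linearity of \<open>E\<close> is given for pairs of matrices of size \<open>d\<close>
  only, so the expansion grows one entry at a time: \<open>P n\<close> holds the first
  \<open>n\<close> entries in row order.\<close>

lemma linear_superop_expansion:
  assumes E: "linear_superop d E" and S: "S \<in> carrier_mat d d" and rs: "r < d" "s < d"
  shows "E S $$ (r, s) =
    (\<Sum>m<d * d. E (matrix_unit d (m div d) (m mod d)) $$ (r, s) * S $$ (m div d, m mod d))"
proof -
  define P where "P n = mat d d (\<lambda>(a, b). if a * d + b < n then S $$ (a, b) else 0)" for n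
  have Pc: "P n \<in> carrier_mat d d" for n unfolding P_def by simp
  have uc: "matrix_unit d i j \<in> carrier_mat d d" for i j unfolding matrix_unit_def by simp
  have add: "E (A + B) = E A + E B" if "A \<in> carrier_mat d d" "B \<in> carrier_mat d d" for A B
    using E that unfolding linear_superop_def by blast
  have smult: "E (c \<cdot>\<^sub>m A) = c \<cdot>\<^sub>m E A" if "A \<in> carrier_mat d d" for c A
    using E that unfolding linear_superop_def by blast
  have Ec: "E A \<in> carrier_mat d d" if "A \<in> carrier_mat d d" for A
    using E that unfolding linear_superop_def by blast
  have d: "d > 0" using rs by simp
  have main: "E (P n) $$ (r, s) =
      (\<Sum>m<n. E (matrix_unit d (m div d) (m mod d)) $$ (r, s) * S $$ (m div d, m mod d))"
    if "n \<le> d * d" for n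
    using that
  proof (induction n)
    case 0
    have "P 0 = 0 \<cdot>\<^sub>m P 0" unfolding P_def by (intro eq_matI) auto
    hence "E (P 0) = 0 \<cdot>\<^sub>m E (P 0)" using smult[OF Pc] by metis
    hence "E (P 0) $$ (r, s) = (0 \<cdot>\<^sub>m E (P 0)) $$ (r, s)" by simp
    also have "\<dots> = 0" using Ec[OF Pc[of 0]] rs by simp
    finally show ?case by simp
  next
    case (Suc n)
    let ?u = "matrix_unit d (n div d) (n mod d)" and ?c = "S $$ (n div d, n mod d)"
    have "P (Suc n) = P n + ?c \<cdot>\<^sub>m ?u"
    proof (rule eq_matI)
      fix a b assume "a < dim_row (P n + ?c \<cdot>\<^sub>m ?u)" "b < dim_col (P n + ?c \<cdot>\<^sub>m ?u)"
      hence ab: "a < d" "b < d" unfolding matrix_unit_def by auto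
      have "a * d + b = n \<longleftrightarrow> a = n div d \<and> b = n mod d" using ab by auto
      thus "P (Suc n) $$ (a, b) = (P n + ?c \<cdot>\<^sub>m ?u) $$ (a, b)"
        using ab unfolding P_def matrix_unit_def by (auto simp: less_Suc_eq)
    qed (simp_all add: P_def matrix_unit_def)
    hence "E (P (Suc n)) = E (P n) + ?c \<cdot>\<^sub>m E ?u"
      using add[OF Pc, of "?c \<cdot>\<^sub>m ?u"] smult[OF uc] uc by simp
    hence "E (P (Suc n)) $$ (r, s) = E (P n) $$ (r, s) + ?c * E ?u $$ (r, s)"
      using carrier_matD[OF Ec[OF uc[of "n div d" "n mod d"]]] rs by simp
    thus ?case using Suc by (simp add: mult.commute)
  qed
  have "P (d * d) = S"
  proof (rule eq_matI)
    fix a b assume "a < dim_row S" "b < dim_col S"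
    hence ab: "a < d" "b < d" using S by auto
    have "a * d + b < (a + 1) * d" using ab by simp
    also have "\<dots> \<le> d * d" using ab by (intro mult_right_mono) auto
    finally show "P (d * d) $$ (a, b) = S $$ (a, b)" unfolding P_def using ab by simp
  qed (use S in \<open>auto simp: P_def\<close>)
  thus ?thesis using main[of "d * d"] by simp
qed

text \<open>Complete positivity for k = 1, where the ampliation reduces to \<open>E\<close>.\<close>

lemma tp_superoperator_positive:
  assumes E: "tp_superoperator d E" and S: "positive_mat d S"
  shows "positive_mat d (E S)"
proof -
  have Sc: "S \<in> carrier_mat d d" using S unfolding positive_mat_def by blast
  have Ec: "E S \<in> carrier_mat d d"
    using E Sc unfolding tp_superoperator_def linear_superop_def by blast
  have "mat_block d S 0 0 = S" unfolding mat_block_def using Sc by (intro eq_matI) auto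
  hence "ampliation 1 d E S = E S" unfolding ampliation_def using Ec by (intro eq_matI) auto
  thus ?thesis
    using E S unfolding tp_superoperator_def completely_positive_def by (metis mult_1)
qed

section \<open>The integer system read off from the code of an instance\<close>

definition code_dim :: "nat \<Rightarrow> nat" where
  "code_dim e = code_nth (fst (prod_decode e)) 0"

definition code_letters :: "nat \<Rightarrow> nat" where
  "code_letters e = code_length (code_nth (fst (prod_decode e)) 1)"

definition code_targets :: "nat \<Rightarrow> nat" where
  "code_targets e = code_length (snd (prod_decode e))"

definition code_size :: "nat \<Rightarrow> nat" where
  "code_size e = 2 * (code_dim e * code_dim e)"

definition code_start :: "nat \<Rightarrow> nat \<Rightarrow> int" where
  "code_start e l = scaled_entry e (code_nth (fst (prod_decode e)) 2)
     (l div 2 div code_dim e) (l div 2 mod code_dim e) (l mod 2)"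

text \<open>Column \<open>l\<close> belongs to the image of a matrix unit and row \<open>l'\<close>
  to an entry of this image; overall factor e!.\<close>

definition code_step :: "nat \<Rightarrow> nat \<Rightarrow> nat \<Rightarrow> nat \<Rightarrow> int" where
  "code_step e a l' l = scaled_mult e
     (code_nth (code_nth (snd (prod_decode (code_nth (code_nth (fst (prod_decode e)) 1) a)))
        (l div 2 div code_dim e)) (l div 2 mod code_dim e))
     (l' div 2 div code_dim e) (l' div 2 mod code_dim e) (l' mod 2) (l mod 2)"

text \<open>The matrix of S \<mapsto> S - P S, times e!. Left multiplication does not mix the
  columns of S, hence the comparison of column indices.\<close>

definition code_target :: "nat \<Rightarrow> nat \<Rightarrow> nat \<Rightarrow> nat \<Rightarrow> int" where
  "code_target e t l' l = (if l' div 2 mod code_dim e = l div 2 mod code_dim e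
     then (if l' = l then int (fact e) else 0) -
       scaled_mult e (code_nth (snd (prod_decode e)) t)
         (l' div 2 div code_dim e) (l div 2 div code_dim e) (l' mod 2) (l mod 2)
     else 0)"

text \<open>The components are read from arbitrary numbers, so the decision procedure halts on every
  input; its answer is about an automaton when the input codes an instance.\<close>

interpretation quantum: computable_system code_letters code_size code_targets code_step code_start
  code_target
proof
  show "computable 1 (\<lambda>xs. code_letters (xs ! 0))" "computable 1 (\<lambda>xs. code_size (xs ! 0))"
    "computable 1 (\<lambda>xs. code_targets (xs ! 0))"
    unfolding code_letters_def code_size_def code_targets_def code_dim_def
    by (intro computable_intros computable_int_intros; simp)+
  show "computable_int 4 (\<lambda>xs. code_step (xs ! 0) (xs ! 1) (xs ! 2) (xs ! 3))"
    "computable_int 2 (\<lambda>xs. code_start (xs ! 0) (xs ! 1))"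
    "computable_int 4 (\<lambda>xs. code_target (xs ! 0) (xs ! 1) (xs ! 2) (xs ! 3))"
    unfolding code_step_def code_start_def code_target_def scaled_mult_def scaled_entry_def
      scaled_rat_def code_dim_def
    by (intro computable_intros computable_int_intros; simp)+
qed

definition realify :: "nat \<Rightarrow> complex mat \<Rightarrow> nat \<Rightarrow> real" where
  "realify d S l = part (l mod 2) (S $$ (l div 2 div d, l div 2 mod d))"

lemma index_bounds:
  fixes d l :: nat
  assumes "l < 2 * (d * d)"
  shows "l div 2 div d < d" "l div 2 mod d < d"
proof -
  have "l div 2 < d * d" using assms by (simp add: less_mult_imp_div_less mult.commute)
  thus "l div 2 div d < d" by (rule less_mult_imp_div_less)
  show "l div 2 mod d < d" using assms by (cases "d = 0") auto
qed

lemma realify_eq_zero_iff: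
  "(\<forall>l<2 * (d * d). realify d S l = 0) \<longleftrightarrow> (\<forall>i<d. \<forall>j<d. S $$ (i, j) = 0)"
proof (intro iffI allI impI)
  fix i j assume *: "\<forall>l<2 * (d * d). realify d S l = 0" and ij: "i < d" "j < d"
  have "i * d + j < (i + 1) * d" using ij by simp
  also have "\<dots> \<le> d * d" using ij by (intro mult_right_mono) auto
  finally have m: "i * d + j < d * d" .
  have "realify d S (2 * (i * d + j)) = 0" "realify d S (2 * (i * d + j) + 1) = 0"
    using * m by auto
  thus "S $$ (i, j) = 0" using ij unfolding realify_def part_def
    by (simp add: complex_eq_iff)
next
  fix l assume "\<forall>i<d. \<forall>j<d. S $$ (i, j) = 0" "l < 2 * (d * d)"
  thus "realify d S l = 0" using index_bounds[of l d] unfolding realify_def by (simp add: part_def)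
qed

section \<open>Correctness of the translation\<close>

locale rational_instance =
  fixes A :: quantum_automaton and \<phi> :: "complex mat list"
  assumes inst: "(A, \<phi>) \<in> rational_instances"
begin

definition e where "e = encode_instance (A, \<phi>)"
definition d where "d = qdim A"
text \<open>Letters of the integer system are positions in this list, since the action names form an
  arbitrary finite set of numbers.\<close>

definition acts where "acts = sorted_list_of_set (Act A)"

lemma wf: "wf_automaton A" and rat: "rational_automaton A"
  and projections: "P \<in> set \<phi> \<Longrightarrow> projection d P \<and> rational_mat P"
  using inst unfolding rational_instances_def d_def by auto

lemma set_acts: "set acts = Act A"
  unfolding acts_def using wf by (simp add: wf_automaton_def)

lemma superop_act: "a < length acts \<Longrightarrow>
    tp_superoperator d (superop A (acts ! a)) \<and> rational_superop d (superop A (acts ! a))"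
  using wf rat set_acts nth_mem[of a acts]
  unfolding wf_automaton_def rational_automaton_def d_def by auto

definition act_codes where
  "act_codes = map (\<lambda>\<alpha>. prod_encode (\<alpha>, encode_superop d (superop A \<alpha>))) acts"

lemma e_eq: "e = prod_encode (list_encode [d, list_encode act_codes, encode_mat (init A)],
    list_encode (map encode_mat \<phi>))"
  unfolding e_def encode_instance_def encode_automaton_def act_codes_def acts_def d_def by simp

lemma automaton_code:
  "code_nth (fst (prod_decode e)) 0 = d"
  "code_nth (fst (prod_decode e)) 1 = list_encode act_codes"
  "code_nth (fst (prod_decode e)) 2 = encode_mat (init A)"
  unfolding e_eq prod_encode_inverse fst_conv by (subst code_nth_encode; simp)+

lemma code_dim: "code_dim e = d"
  unfolding code_dim_def automaton_code ..

lemma code_size: "code_size e = 2 * (d * d)"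
  unfolding code_size_def code_dim ..

lemma code_letters: "code_letters e = length acts"
  unfolding code_letters_def automaton_code code_length_encode act_codes_def by simp

lemma code_targets: "code_targets e = length \<phi>"
  unfolding code_targets_def e_eq prod_encode_inverse by (simp add: code_length_encode)

lemma component_le: "list_encode [d, list_encode act_codes, encode_mat (init A)] \<le> e"
  "list_encode (map encode_mat \<phi>) \<le> e"
  unfolding e_eq by (rule le_prod_encode_1, rule le_prod_encode_2)

lemma init_le: "encode_mat (init A) \<le> e"
  by (rule order_trans[OF mem_list_encode_le component_le(1)]) simp

lemma target_le: "t < length \<phi> \<Longrightarrow> encode_mat (\<phi> ! t) \<le> e"
  by (rule order_trans[OF mem_list_encode_le component_le(2)]) simp

lemma unit_code:
  assumes "a < length acts" "i < d" "j < d"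
  shows "code_nth (code_nth (snd (prod_decode (code_nth (list_encode act_codes) a))) i) j =
      encode_mat (superop A (acts ! a) (matrix_unit d i j))"
    "encode_mat (superop A (acts ! a) (matrix_unit d i j)) \<le> e"
proof -
  let ?E = "superop A (acts ! a)"
  define row where "row i = list_encode [encode_mat (?E (matrix_unit d i j)). j \<leftarrow> [0..<d]]" for i
  have enc: "encode_superop d ?E = list_encode (map row [0..<d])"
    unfolding encode_superop_def row_def ..
  have sup: "code_nth (list_encode act_codes) a = prod_encode (acts ! a, encode_superop d ?E)"
    unfolding act_codes_def using assms by (simp add: code_nth_encode)
  show "code_nth (code_nth (snd (prod_decode (code_nth (list_encode act_codes) a))) i) j =
      encode_mat (?E (matrix_unit d i j))"
    unfolding sup enc using assms by (simp add: code_nth_encode) (simp add: row_def code_nth_encode assms)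
  have "encode_mat (?E (matrix_unit d i j)) \<le> row i"
    unfolding row_def using assms by (intro mem_list_encode_le) auto
  also have "row i \<le> encode_superop d ?E"
    unfolding enc using assms by (intro mem_list_encode_le) auto
  also have "\<dots> \<le> prod_encode (acts ! a, encode_superop d ?E)" by (rule le_prod_encode_2)
  also have "\<dots> \<le> list_encode act_codes"
    unfolding act_codes_def using assms by (intro mem_list_encode_le) auto
  also have "\<dots> \<le> list_encode [d, list_encode act_codes, encode_mat (init A)]"
    by (intro mem_list_encode_le) simp
  also have "\<dots> \<le> e" by (rule component_le)
  finally show "encode_mat (?E (matrix_unit d i j)) \<le> e" .
qed

lemma init_positive: "positive_mat d (init A)"
  using wf unfolding wf_automaton_def density_mat_def d_def by blast

lemma code_start: "l < 2 * (d * d) \<Longrightarrow> of_int (code_start e l) = fact e * realify d (init A) l"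
  unfolding code_start_def automaton_code code_dim realify_def
  using init_positive rat init_le index_bounds[of l d]
  by (intro scaled_entry) (auto simp: positive_mat_def rational_automaton_def)

lemma code_step:
  assumes a: "a < length acts" and l: "l < 2 * (d * d)" "l' < 2 * (d * d)"
  shows "of_int (code_step e a l' l) = fact e * mult_part (l' mod 2) (l mod 2)
    (superop A (acts ! a) (matrix_unit d (l div 2 div d) (l div 2 mod d)) $$
      (l' div 2 div d, l' div 2 mod d))"
proof -
  let ?E = "superop A (acts ! a)"
  note b = index_bounds[OF l(1)] index_bounds[OF l(2)]
  have "matrix_unit d (l div 2 div d) (l div 2 mod d) \<in> carrier_mat d d"
    unfolding matrix_unit_def by simp
  hence "?E (matrix_unit d (l div 2 div d) (l div 2 mod d)) \<in> carrier_mat d d"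
    using superop_act[OF a] unfolding tp_superoperator_def linear_superop_def by blast
  moreover have "rational_mat (?E (matrix_unit d (l div 2 div d) (l div 2 mod d)))"
    using superop_act[OF a] b unfolding rational_superop_def by blast
  ultimately show ?thesis
    unfolding code_step_def code_dim automaton_code unit_code(1)[OF a b(1,2)]
    using b unit_code(2)[OF a b(1,2)] by (intro scaled_mult)
qed

lemma code_target:
  assumes t: "t < length \<phi>" and l: "l < 2 * (d * d)" "l' < 2 * (d * d)"
  shows "of_int (code_target e t l' l) = fact e * mult_part (l' mod 2) (l mod 2)
    (if l div 2 mod d = l' div 2 mod d
     then (if l div 2 div d = l' div 2 div d then 1 else 0) - \<phi> ! t $$ (l' div 2 div d, l div 2 div d)
     else 0)"
proof (cases "l div 2 mod d = l' div 2 mod d")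
  case True
  let ?P = "\<phi> ! t $$ (l' div 2 div d, l div 2 div d)"
  let ?m = "mult_part (l' mod 2) (l mod 2)"
  note b = index_bounds[OF l(1)] index_bounds[OF l(2)]
  have P: "projection d (\<phi> ! t)" "rational_mat (\<phi> ! t)" using projections t by auto
  have "code_nth (list_encode (map encode_mat \<phi>)) t = encode_mat (\<phi> ! t)"
    using t by (simp add: code_nth_encode)
  hence mat: "code_nth (snd (prod_decode e)) t = encode_mat (\<phi> ! t)"
    unfolding e_eq prod_encode_inverse by simp
  have eq: "l' = l \<longleftrightarrow> l div 2 div d = l' div 2 div d \<and> l' mod 2 = l mod 2"
    using True by (metis div_mult_mod_eq)
  have "of_int (code_target e t l' l) = (if l' = l then fact e else 0) -
      of_int (scaled_mult e (encode_mat (\<phi> ! t)) (l' div 2 div d) (l div 2 div d) (l' mod 2) (l mod 2) )"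
    unfolding code_target_def code_dim mat using True by simp
  also have "of_int (scaled_mult e (encode_mat (\<phi> ! t)) (l' div 2 div d) (l div 2 div d)
      (l' mod 2) (l mod 2)) = fact e * ?m ?P"
    using P b target_le[OF t] by (intro scaled_mult) (auto simp: projection_def)
  also have "(if l' = l then fact e else 0) - fact e * ?m ?P =
      fact e * ?m ((if l div 2 div d = l' div 2 div d then 1 else 0) - ?P)"
    unfolding eq mult_part_def by (auto simp: algebra_simps)
  finally show ?thesis using True by simp
next
  case False
  thus ?thesis unfolding code_target_def code_dim mult_part_def by auto
qed

lemma induced_state_positive:
  "(\<And>n. w n \<in> Act A) \<Longrightarrow> positive_mat d (induced_state A w n)"
proof (induction n)
  case (Suc n)
  thus ?case using wf tp_superoperator_positive unfolding wf_automaton_def d_def by auto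
qed (simp add: init_positive)

context
  fixes w \<omega> :: "nat \<Rightarrow> nat"
  assumes \<omega>: "\<And>n. \<omega> n < length acts" and w: "\<And>n. w n = acts ! \<omega> n"
begin

lemma w_act: "w n \<in> Act A"
  using \<omega> w set_acts nth_mem by metis

lemma positive: "positive_mat d (induced_state A w n)"
  using w_act by (rule induced_state_positive)

text \<open>One factor e! stems from the start vector and one from each step; such positive
  multiples lie in the same subspaces.\<close>

lemma state_realify:
  "l < 2 * (d * d) \<Longrightarrow> of_int (quantum.sys.state e \<omega> n l) =
     fact e ^ Suc n * realify d (induced_state A w n) l"
proof (induction n arbitrary: l)
  case 0
  thus ?case unfolding quantum.sys.state_0 quantum.sys.start_def by (simp add: code_size code_start)
next
  case (Suc n)
  let ?S = "induced_state A w n" and ?E = "superop A (acts ! \<omega> n)"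
  let ?c = "\<lambda>m. ?E (matrix_unit d (m div d) (m mod d)) $$ (l div 2 div d, l div 2 mod d)"
  let ?z = "\<lambda>m. ?S $$ (m div d, m mod d)"
  note b = index_bounds[OF Suc.prems]
  have "of_int (quantum.sys.state e \<omega> (Suc n) l) =
      (\<Sum>j<2 * (d * d). of_int (code_step e (\<omega> n) l j) * of_int (quantum.sys.state e \<omega> n j) :: real)"
    unfolding quantum.sys.state_Suc quantum.sys.step_def using Suc.prems by (simp add: code_size)
  also have "\<dots> = (\<Sum>j<2 * (d * d). fact e ^ Suc (Suc n) *
      (mult_part (l mod 2) (j mod 2) (?c (j div 2)) * part (j mod 2) (?z (j div 2))))"
    using Suc code_step[OF \<omega>] by (intro sum.cong) (auto simp: realify_def algebra_simps)
  also have "\<dots> = fact e ^ Suc (Suc n) * part (l mod 2) (\<Sum>m<d * d. ?c m * ?z m)"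
    by (subst part_sum_mult) (simp_all add: sum_distrib_left)
  also have "(\<Sum>m<d * d. ?c m * ?z m) = ?E ?S $$ (l div 2 div d, l div 2 mod d)"
    using superop_act[OF \<omega>] positive b unfolding tp_superoperator_def positive_mat_def
    by (intro linear_superop_expansion[symmetric]) auto
  finally show ?case unfolding realify_def by (simp add: w)
qed

text \<open>The power of e! is nonzero, so the integer equations hold exactly when all real and
  imaginary parts of S - P S vanish.\<close>

lemma in_target_iff:
  assumes t: "t < length \<phi>"
  shows "quantum.sys.in_target e t (quantum.sys.state e \<omega> n) \<longleftrightarrow>
    \<phi> ! t * induced_state A w n = induced_state A w n"
proof -
  let ?S = "induced_state A w n" and ?P = "\<phi> ! t"
  have S: "?S \<in> carrier_mat d d" using positive unfolding positive_mat_def by blast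
  have P: "?P \<in> carrier_mat d d" using projections t unfolding projection_def by simp
  have eq: "of_int (\<Sum>j<2 * (d * d). code_target e t l j * quantum.sys.state e \<omega> n j) =
      fact e ^ Suc (Suc n) * realify d (?S - ?P * ?S) l" if l: "l < 2 * (d * d)" for l
  proof -
    let ?r = "l div 2 div d" and ?s = "l div 2 mod d"
    let ?c = "\<lambda>m. if m mod d = ?s then (if m div d = ?r then 1 else 0) - ?P $$ (?r, m div d) else 0"
    let ?z = "\<lambda>m. ?S $$ (m div d, m mod d)"
    note b = index_bounds[OF l]
    have "of_int (\<Sum>j<2 * (d * d). code_target e t l j * quantum.sys.state e \<omega> n j) =
        (\<Sum>j<2 * (d * d). of_int (code_target e t l j) * of_int (quantum.sys.state e \<omega> n j) :: real)"
      by simp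
    also have "\<dots> = (\<Sum>j<2 * (d * d). fact e ^ Suc (Suc n) *
        (mult_part (l mod 2) (j mod 2) (?c (j div 2)) * part (j mod 2) (?z (j div 2))))"
    proof (rule sum.cong)
      fix j assume "j \<in> {..<2 * (d * d)}"
      hence j: "j < 2 * (d * d)" by simp
      show "of_int (code_target e t l j) * of_int (quantum.sys.state e \<omega> n j) = fact e ^ Suc (Suc n) *
        (mult_part (l mod 2) (j mod 2) (?c (j div 2)) * part (j mod 2) (?z (j div 2)))"
        unfolding code_target[OF t j l] state_realify[OF j] realify_def
        by (simp only: power_Suc mult_ac)
    qed simp
    also have "\<dots> = fact e ^ Suc (Suc n) * part (l mod 2) (\<Sum>m<d * d. ?c m * ?z m)"
      by (subst part_sum_mult) (simp_all add: sum_distrib_left)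
    also have "(\<Sum>m<d * d. ?c m * ?z m) = (\<Sum>i<d. \<Sum>j<d.
        (if j = ?s then (if i = ?r then 1 else 0) - ?P $$ (?r, i) else 0) * ?S $$ (i, j))"
      by (rule sum_div_mod)
    also have "\<dots> = (\<Sum>i<d. \<Sum>j<d.
        (if j = ?s then ((if i = ?r then 1 else 0) - ?P $$ (?r, i)) * ?S $$ (i, j) else 0))"
      by (intro sum.cong) auto
    also have "\<dots> = (\<Sum>i<d. ((if i = ?r then 1 else 0) - ?P $$ (?r, i)) * ?S $$ (i, ?s))"
      using b by simp
    also have "\<dots> = (\<Sum>i<d. (if i = ?r then ?S $$ (i, ?s) else 0) - ?P $$ (?r, i) * ?S $$ (i, ?s))"
      by (intro sum.cong) (auto simp: algebra_simps)
    also have "\<dots> = ?S $$ (?r, ?s) - (\<Sum>i<d. ?P $$ (?r, i) * ?S $$ (i, ?s))"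
      using b by (simp add: sum_subtractf)
    also have "\<dots> = (?S - ?P * ?S) $$ (?r, ?s)"
      using b S P by (simp add: scalar_prod_def atLeast0LessThan)
    finally show ?thesis unfolding realify_def .
  qed
  have "quantum.sys.in_target e t (quantum.sys.state e \<omega> n) \<longleftrightarrow>
      (\<forall>l<2 * (d * d). realify d (?S - ?P * ?S) l = 0)"
  proof -
    have "(\<Sum>j<2 * (d * d). code_target e t l j * quantum.sys.state e \<omega> n j) = 0 \<longleftrightarrow>
        realify d (?S - ?P * ?S) l = 0" if "l < 2 * (d * d)" for l
    proof -
      have "(\<Sum>j<2 * (d * d). code_target e t l j * quantum.sys.state e \<omega> n j) = 0 \<longleftrightarrow>
          of_int (\<Sum>j<2 * (d * d). code_target e t l j * quantum.sys.state e \<omega> n j) = (0 :: real)"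
        by (simp only: of_int_eq_0_iff)
      thus ?thesis unfolding eq[OF that] by simp
    qed
    thus ?thesis unfolding quantum.sys.in_target_def by (simp add: code_size)
  qed
  also have "\<dots> \<longleftrightarrow> (\<forall>i<d. \<forall>j<d. (?S - ?P * ?S) $$ (i, j) = 0)"
    by (rule realify_eq_zero_iff)
  also have "\<dots> \<longleftrightarrow> ?P * ?S = ?S"
  proof
    assume *: "\<forall>i<d. \<forall>j<d. (?S - ?P * ?S) $$ (i, j) = 0"
    show "?P * ?S = ?S"
    proof (rule eq_matI)
      fix i j assume "i < dim_row ?S" "j < dim_col ?S"
      hence ij: "i < d" "j < d" using S by auto
      have "(?S - ?P * ?S) $$ (i, j) = ?S $$ (i, j) - (?P * ?S) $$ (i, j)"
        using ij S P by (subst index_minus_mat) auto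
      thus "(?P * ?S) $$ (i, j) = ?S $$ (i, j)" using * ij by simp
    qed (use S P in auto)
  next
    assume "?P * ?S = ?S"
    thus "\<forall>i<d. \<forall>j<d. (?S - ?P * ?S) $$ (i, j) = 0" using S by simp
  qed
  finally show ?thesis .
qed

lemma hit_iff: "quantum.sys.hit e (quantum.sys.state e \<omega> n) \<longleftrightarrow> satisfies d (induced_state A w n) \<phi>"
proof -
  have "satisfies d (induced_state A w n) \<phi> \<longleftrightarrow>
      (\<exists>P\<in>set \<phi>. P * induced_state A w n = induced_state A w n)"
    unfolding satisfies_def using supp_subset_iff[OF positive] projections by blast
  also have "\<dots> \<longleftrightarrow> (\<exists>t<length \<phi>. \<phi> ! t * induced_state A w n = induced_state A w n)"
    by (metis in_set_conv_nth)
  also have "\<dots> \<longleftrightarrow> quantum.sys.hit e (quantum.sys.state e \<omega> n)"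
    unfolding quantum.sys.hit_def by (simp add: code_targets in_target_iff cong: conj_cong)
  finally show ?thesis by simp
qed

end

lemma box_diamond_valid_iff: "box_diamond_valid A \<phi> \<longleftrightarrow> quantum.sys.valid e"
proof
  assume *: "box_diamond_valid A \<phi>"
  show "quantum.sys.valid e"
    unfolding quantum.sys.valid_def
  proof (intro allI impI)
    fix \<omega> :: "nat \<Rightarrow> nat" assume "\<forall>n. \<omega> n < code_letters e"
    hence \<omega>: "\<forall>n. \<omega> n < length acts" by (simp add: code_letters)
    define w where "w n = acts ! \<omega> n" for n
    have "\<forall>n. w n \<in> Act A" unfolding w_def using \<omega> set_acts nth_mem by blast
    hence "infinite {n. satisfies d (induced_state A w n) \<phi>}"
      using * unfolding box_diamond_valid_def d_def by blast
    thus "infinite {n. quantum.sys.hit e (quantum.sys.state e \<omega> n)}"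
      using hit_iff[of \<omega> w] \<omega> w_def by simp
  qed
next
  assume *: "quantum.sys.valid e"
  show "box_diamond_valid A \<phi>"
    unfolding box_diamond_valid_def
  proof (intro allI impI)
    fix w :: "nat \<Rightarrow> nat" assume w: "\<forall>n. w n \<in> Act A"
    have "\<exists>a<length acts. acts ! a = w n" for n
      using w set_acts by (metis in_set_conv_nth)
    then obtain \<omega> :: "nat \<Rightarrow> nat" where \<omega>: "\<And>n. \<omega> n < length acts" "\<And>n. acts ! \<omega> n = w n" by metis
    have "\<forall>n. \<omega> n < code_letters e" using \<omega> by (simp add: code_letters)
    hence "infinite {n. quantum.sys.hit e (quantum.sys.state e \<omega> n)}"
      using * unfolding quantum.sys.valid_def by blast
    thus "infinite {n. satisfies (qdim A) (induced_state A w n) \<phi>}"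
      using hit_iff[of \<omega> w] \<omega> unfolding d_def by simp
  qed
qed

end

theorem theorem11:
  shows "decidable rational_instances encode_instance (\<lambda>(A, \<phi>). box_diamond_valid A \<phi>)"
proof -
  obtain f where f: "\<And>e. rec_eval f [e] (if quantum.sys.valid e then 1 else 0)"
    using quantum.decision_procedure by blast
  show ?thesis
    unfolding decidable_def
  proof (intro exI[of _ f] ballI)
    fix x assume x: "x \<in> rational_instances"
    obtain A \<phi> where A: "x = (A, \<phi>)" by (cases x)
    interpret rational_instance A \<phi> using x unfolding A by unfold_locales
    have "box_diamond_valid A \<phi> \<longleftrightarrow> quantum.sys.valid (encode_instance (A, \<phi>))"
      using box_diamond_valid_iff unfolding e_def .
    thus "rec_eval f [encode_instance x] (if case x of (A, \<phi>) \<Rightarrow> box_diamond_valid A \<phi> then 1 else 0)"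
      using f[of "encode_instance x"] unfolding A by simp
  qed
qed

end
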